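(* Let $(X,g_0)$ be a closed Riemannian surface and let $f:X\to[0,+\infty)$ be a smooth function which is not identically zero. For $t\in[0,1]$ put $g_t:=e^{-tf}g_0$, let $dx_t$ be the Riemannian area measure of $g_t$ and $\Delta_t$ the (non-negative) Laplace operator of $g_t$. Let $I_m=[\lambda_m-l_m,\lambda_m+l_m]$ $(m\in\mathbb{N})$ be intervals, independent of $t$, such that for every $t\in[0,1]$ and every $m$ there is at least one eigenvalue of $\Delta_t$ in $I_m$. Assume that $\lambda_m\to+\infty$ and $\sum_{m=1}^\infty l_m<\infty$. Let $(q_m)$ be a sequence of positive numbers with $q_m\to0$ and $\sum_{m=1}^\infty l_m/q_m<\infty$. Then, for almost every $t\in[0,1]$ (with respect to Lebesgue measure), the following holds: for any sequence $(\varphi_m(t))_m$ of eigenfunctions of $\Delta_t$, normalized by $\int_X|\varphi_m(t)|^2dx_t=1$, with eigenvalues $\mu_m(t)\in I_m$, one has $$\int_X f\,|\varphi_m(t)|^2\,dx_t=o(q_m)\qquad(m\to\infty).$$ In particular, if $\Gamma:=f^{-1}(0)$ is the zero set of $f$, then $\varphi_m(t)\to0$ in $L^2_{\rm loc}(X\setminus\Gamma)$.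
   Context: Closed means compact without boundary. One has $dx_t=e^{-tf}dx_0$ and $\Delta_t=e^{tf}\Delta_0$, where $\Delta_0$ is the non-negative Laplace operator of $g_0$. An exact mode is an $L^2(X,dx_t)$-normalized eigenfunction of $\Delta_t$. Here $l_m\ge0$. *)

theory Defs
  imports "HOL-Analysis.Analysis" "HOL-Library.Landau_Symbols"
begin

section \<open>Smooth maps between normed spaces\<close>

text \<open>Intended for open \<open>S\<close> in a finite-dimensional space.\<close>

primrec Ck_on :: "nat \<Rightarrow> 'a::real_normed_vector set \<Rightarrow> ('a \<Rightarrow> 'b::real_normed_vector) \<Rightarrow> bool" where
  "Ck_on 0 S f \<longleftrightarrow> continuous_on S f"
| "Ck_on (Suc k) S f \<longleftrightarrow>
     (\<forall>x\<in>S. f differentiable (at x)) \<and>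
     (\<forall>v. Ck_on k S (\<lambda>x. frechet_derivative f (at x) v))"

definition smooth_on :: "'a::real_normed_vector set \<Rightarrow> ('a \<Rightarrow> 'b::real_normed_vector) \<Rightarrow> bool" where
  "smooth_on S f \<longleftrightarrow> (\<forall>k. Ck_on k S f)"

definition partial_deriv :: "2 \<Rightarrow> (real^2 \<Rightarrow> 'b::real_normed_vector) \<Rightarrow> real^2 \<Rightarrow> 'b" where
  "partial_deriv i F x = frechet_derivative F (at x) (axis i 1)"


section \<open>Closed smooth surfaces\<close>

text \<open>A chart is a pair of its domain and its coordinate map; only the values of the
  coordinate map on the domain matter.\<close>

type_synonym 'a chart = "'a set \<times> ('a \<Rightarrow> real^2)"

definition coord_inv :: "'a chart \<Rightarrow> real^2 \<Rightarrow> 'a" where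
  "coord_inv c = inv_into (fst c) (snd c)"

definition is_chart :: "'a topology \<Rightarrow> 'a chart \<Rightarrow> bool" where
  "is_chart X c \<longleftrightarrow>
     openin X (fst c) \<and> open (snd c ` fst c) \<and>
     homeomorphic_map (subtopology X (fst c)) (top_of_set (snd c ` fst c)) (snd c)"

definition transition :: "'a chart \<Rightarrow> 'a chart \<Rightarrow> real^2 \<Rightarrow> real^2" where
  "transition c d = snd d \<circ> coord_inv c"

definition smooth_atlas :: "'a topology \<Rightarrow> 'a chart set \<Rightarrow> bool" where
  "smooth_atlas X A \<longleftrightarrow>
     (\<forall>c\<in>A. is_chart X c) \<and>
     (\<Union>c\<in>A. fst c) = topspace X \<and>
     (\<forall>c\<in>A. \<forall>d\<in>A. smooth_on (snd c ` (fst c \<inter> fst d)) (transition c d))"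

text \<open>Second countability is not listed because a compact locally Euclidean space is second
  countable. There is no boundary since the charts map onto open subsets of the plane.
  Connectedness is not required.\<close>

definition closed_surface :: "'a topology \<Rightarrow> 'a chart set \<Rightarrow> bool" where
  "closed_surface X A \<longleftrightarrow> Hausdorff_space X \<and> compact_space X \<and> smooth_atlas X A"

definition smooth_function :: "'a chart set \<Rightarrow> ('a \<Rightarrow> 'b::real_normed_vector) \<Rightarrow> bool" where
  "smooth_function A u \<longleftrightarrow> (\<forall>c\<in>A. smooth_on (snd c ` fst c) (u \<circ> coord_inv c))"


section \<open>Riemannian metrics\<close>

text \<open>A metric is given by its Gram matrices: for a chart \<open>c\<close> of the atlas and a point \<open>p\<close>
  in its domain, \<open>g c p $ i $ j\<close> is the inner product at \<open>p\<close> of the \<open>i\<close>-th and \<open>j\<close>-th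
  coordinate vector fields of \<open>c\<close>. The last clause of the definition below is the
  transformation law of a covariant 2-tensor. Values of \<open>g c p\<close> for other \<open>c\<close>, \<open>p\<close> are
  irrelevant.\<close>

type_synonym 'a metric_tensor = "'a chart \<Rightarrow> 'a \<Rightarrow> real^2^2"

definition jacobian :: "'a chart \<Rightarrow> 'a chart \<Rightarrow> 'a \<Rightarrow> real^2^2" where
  "jacobian c d p = matrix (frechet_derivative (transition c d) (at (snd c p)))"

definition riemannian_metric :: "'a chart set \<Rightarrow> 'a metric_tensor \<Rightarrow> bool" where
  "riemannian_metric A g \<longleftrightarrow>
     (\<forall>c\<in>A. smooth_on (snd c ` fst c) (g c \<circ> coord_inv c)) \<and>
     (\<forall>c\<in>A. \<forall>p\<in>fst c. transpose (g c p) = g c p \<and> (\<forall>v. v \<noteq> 0 \<longrightarrow> v \<bullet> (g c p *v v) > 0)) \<and>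
     (\<forall>c\<in>A. \<forall>d\<in>A. \<forall>p\<in>fst c \<inter> fst d.
        g c p = transpose (jacobian c d p) ** g d p ** jacobian c d p)"

definition conformal_metric :: "('a \<Rightarrow> real) \<Rightarrow> 'a metric_tensor \<Rightarrow> 'a metric_tensor" where
  "conformal_metric h g = (\<lambda>c p. h p *\<^sub>R g c p)"

definition area_density :: "'a metric_tensor \<Rightarrow> 'a chart \<Rightarrow> 'a \<Rightarrow> real" where
  "area_density g c p = sqrt (det (g c p))"

text \<open>The Riemannian area measure is the unique Borel measure that is given by
  \<open>sqrt (det g) dx\<close> in each chart.\<close>

definition area_measure :: "'a topology \<Rightarrow> 'a chart set \<Rightarrow> 'a metric_tensor \<Rightarrow> 'a measure" where
  "area_measure X A g = (THE M.
     space M = topspace X \<and>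
     sets M = sigma_sets (topspace X) {U. openin X U} \<and>
     (\<forall>c\<in>A. \<forall>E\<in>sets M. E \<subseteq> fst c \<longrightarrow>
        emeasure M E =
          (\<integral>\<^sup>+ x\<in>snd c ` E. ennreal (area_density g c (coord_inv c x)) \<partial>lborel)))"


section \<open>The Laplace operator\<close>

text \<open>The local expression
  \<open>- 1 / sqrt (det g) * (\<Sum>i j. \<partial>\<^sub>i (sqrt (det g) * g\<^sup>i\<^sup>j * \<partial>\<^sub>j u))\<close>, in the chart \<open>c\<close>.\<close>

definition laplace_in_chart ::
  "'a metric_tensor \<Rightarrow> 'a chart \<Rightarrow> ('a \<Rightarrow> 'b::real_normed_vector) \<Rightarrow> 'a \<Rightarrow> 'b" where
  "laplace_in_chart g c u p =
     - ((1 / area_density g c p) *\<^sub>R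
        (\<Sum>i\<in>UNIV. \<Sum>j\<in>UNIV.
           partial_deriv i
             (\<lambda>x. (area_density g c (coord_inv c x) * matrix_inv (g c (coord_inv c x)) $ i $ j) *\<^sub>R
                    partial_deriv j (u \<circ> coord_inv c) x)
             (snd c p)))"

text \<open>The choice of the chart is immaterial: for a Riemannian metric and a smooth function
  the local expressions in two charts agree on the overlap.\<close>

definition laplacian ::
  "'a chart set \<Rightarrow> 'a metric_tensor \<Rightarrow> ('a \<Rightarrow> 'b::real_normed_vector) \<Rightarrow> 'a \<Rightarrow> 'b" where
  "laplacian A g u p = laplace_in_chart g (SOME c. c \<in> A \<and> p \<in> fst c) u p"

text \<open>Eigenfunctions are complex-valued. Eigenvalues are taken real, which loses nothing since the
  Laplace operator is symmetric.\<close>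

definition eigenfunction ::
  "'a topology \<Rightarrow> 'a chart set \<Rightarrow> 'a metric_tensor \<Rightarrow> real \<Rightarrow> ('a \<Rightarrow> complex) \<Rightarrow> bool" where
  "eigenfunction X A g \<mu> u \<longleftrightarrow>
     smooth_function A u \<and> (\<exists>p\<in>topspace X. u p \<noteq> 0) \<and>
     (\<forall>p\<in>topspace X. laplacian A g u p = \<mu> *\<^sub>R u p)"

definition eigenvalue :: "'a topology \<Rightarrow> 'a chart set \<Rightarrow> 'a metric_tensor \<Rightarrow> real \<Rightarrow> bool" where
  "eigenvalue X A g \<mu> \<longleftrightarrow> (\<exists>u. eigenfunction X A g \<mu> u)"

definition tendsto_zero_L2_loc ::
  "'a topology \<Rightarrow> 'a measure \<Rightarrow> 'a set \<Rightarrow> (nat \<Rightarrow> 'a \<Rightarrow> complex) \<Rightarrow> bool" where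
  "tendsto_zero_L2_loc X M S u \<longleftrightarrow>
     (\<forall>K. compactin X K \<and> K \<subseteq> S \<longrightarrow>
        (\<lambda>m. set_lebesgue_integral M K (\<lambda>p. (cmod (u m p))\<^sup>2)) \<longlonglongrightarrow> 0)"

end

theory Submission
  imports Defs
begin

text \<open>In dimension two the Dirichlet form \<open>D\<close> is conformally invariant, and only the norm
  \<open>\<parallel>u\<parallel>\<^sub>t\<^sup>2 = \<integral> u\<^sup>2 exp (- t f) dx\<^sub>0\<close> depends on \<open>t\<close>. Let \<open>N t s\<close> be the largest dimension of a space
  on which \<open>D u \<le> s \<parallel>u\<parallel>\<^sub>t\<^sup>2\<close>. It decreases in \<open>t\<close>, increases in \<open>s\<close>, and
  \<open>N 0 s \<le> C (1 + s)\<close> by the Poincare inequality on small squares. If \<open>\<phi>\<close> is an eigenfunction at time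
  \<open>t\<close> with eigenvalue \<open>\<mu>\<close> and \<open>\<integral> f \<phi>\<^sup>2 dx\<^sub>t \<ge> \<eta>\<close>, then adding \<open>\<phi>\<close> to an optimal space just
  below \<open>\<mu>\<close> shows \<open>N (t - h) s \<ge> N t s + 1\<close> for small \<open>h\<close> and \<open>\<mu> - \<mu> h \<eta> / 4 \<le> s < \<mu>\<close>. Hence
  the antitone function \<open>t \<mapsto> \<integral> N t s ds\<close> over a neighbourhood of \<open>I\<^sub>m\<close>, whose variation is
  \<open>O(l\<^sub>m \<lambda>\<^sub>m)\<close>, has slope at least of order \<open>\<lambda>\<^sub>m \<eta>\<close> at \<open>t\<close>; by Vitali's covering theorem the set
  of such \<open>t\<close> has measure \<open>O(l\<^sub>m / \<eta>)\<close>. With \<open>\<eta> = \<epsilon> q\<^sub>m\<close> the claim follows from the Borel--Cantelli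
  lemma. No spectral decomposition of the Laplacian is needed.\<close>

section \<open>Linear systems and steep sets of antitone functions\<close>

text \<open>Heuristically, an eigenvalue branch with normalised mode \<phi> rises at speed \<mu>
  \<integral> f \<phi>^2 dx_t. A branch whose mode is not small on f crosses I_m fast: each of the
  O(\<lambda>_m) branches spends time O(l_m / (\<lambda>_m \<eta>)) there, in total O(l_m / \<eta>).
  Multiplicities and the free choice of eigenfunctions stand in the way of differentiating branches.
  Counting dimensions needs no labelled branches: up to sign, the slope of t \<mapsto> \<integral> N
  t s ds is the sum of the speeds in the window, and one concentrated mode at the single time t
  bounds it from one side. The bound looks backwards, from t to t - h, because the Rayleigh quotient
  of \<phi> falls in that direction; this is why times lie in (0, 1]. The factor \<lambda>_m in the
  variation is the linear growth of the count in dimension two, and it cancels the factor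
  \<lambda>_m in the slope.\<close>

lemma homogeneous_system_nontrivial:
  fixes L :: "'j \<Rightarrow> 'i \<Rightarrow> real"
  assumes "finite J" "finite K" "card J < card K"
  shows "\<exists>a. (\<exists>i\<in>K. a i \<noteq> 0) \<and> (\<forall>j\<in>J. (\<Sum>i\<in>K. a i * L j i) = 0)"
  using assms
proof (induction J arbitrary: K L rule: finite_induct)
  case empty
  then have "K \<noteq> {}" by auto
  then show ?case by (intro exI[of _ "\<lambda>_. 1"]) auto
next
  case (insert j J)
  show ?case
  proof (cases "\<forall>i\<in>K. L j i = 0")
    case True
    have "card J < card K" using insert by simp
    then obtain a where "\<exists>i\<in>K. a i \<noteq> 0" "\<forall>j\<in>J. (\<Sum>i\<in>K. a i * L j i) = 0"
      using insert.IH[OF insert.prems(1)] by blast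
    then show ?thesis using True by (intro exI[of _ a]) auto
  next
    case False
    \<comment> \<open>Gaussian elimination: equation \<open>j\<close> is solved for the unknown
      \<open>i0\<close> and substituted into the others, which removes one equation and one
      unknown.\<close>
    then obtain i0 where i0: "i0 \<in> K" "L j i0 \<noteq> 0" by blast
    define K' where "K' = K - {i0}"
    have K': "finite K'" "K = insert i0 K'" "i0 \<notin> K'" using i0 insert by (auto simp: K'_def)
    have "card J < card K'" using insert K' by simp
    then obtain a where a: "\<exists>i\<in>K'. a i \<noteq> 0"
      "\<forall>j'\<in>J. (\<Sum>i\<in>K'. a i * (L j' i - L j' i0 * L j i / L j i0)) = 0"
      using insert.IH[OF K'(1), of "\<lambda>j' i. L j' i - L j' i0 * L j i / L j i0"] by blast
    define b where "b = (\<lambda>i. if i = i0 then - (\<Sum>i\<in>K'. a i * L j i) / L j i0 else a i)"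
    have sb: "(\<Sum>i\<in>K. b i * L j' i) = (\<Sum>i\<in>K'. a i * L j' i) - (\<Sum>i\<in>K'. a i * L j i) / L j i0 * L j' i0" for j'
    proof -
      have "(\<Sum>i\<in>K'. b i * L j' i) = (\<Sum>i\<in>K'. a i * L j' i)"
        by (rule sum.cong) (use K' in \<open>auto simp: b_def\<close>)
      then show ?thesis using K' by (simp add: b_def)
    qed
    have "(\<Sum>i\<in>K. b i * L j' i) = 0" if "j' \<in> J" for j'
    proof -
      have "(\<Sum>i\<in>K'. a i * (L j' i - L j' i0 * L j i / L j i0))
        = (\<Sum>i\<in>K'. a i * L j' i) - (\<Sum>i\<in>K'. a i * L j i) / L j i0 * L j' i0"
        by (simp add: right_diff_distrib sum_subtractf sum_divide_distrib sum_distrib_right sum_distrib_left mult_ac)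
      then show ?thesis using a(2) that sb by simp
    qed
    moreover have "(\<Sum>i\<in>K. b i * L j i) = 0" using i0 by (simp add: sb)
    moreover have "\<exists>i\<in>K. b i \<noteq> 0" using a(1) K' by (auto simp: b_def)
    ultimately show ?thesis by (intro exI[of _ b]) auto
  qed
qed

section \<open>Total drop and steep points of an antitone function\<close>

text \<open>Peeling off the interval with the rightmost left endpoint leaves a family that ends no
  later than that endpoint, so the induction runs with a smaller right bound
  \<open>b\<close>.\<close>

lemma antimono_sum_disjoint_intervals:
  fixes G :: "real \<Rightarrow> real" and x y :: "'i \<Rightarrow> real"
  assumes "finite F" and G: "\<And>s t. \<lbrakk>a \<le> s; s \<le> t; t \<le> b\<rbrakk> \<Longrightarrow> G t \<le> G s"
    and xy: "\<And>i. i \<in> F \<Longrightarrow> a \<le> x i \<and> x i < y i \<and> y i \<le> b" and "a \<le> b"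
    and disj: "\<And>i j. \<lbrakk>i \<in> F; j \<in> F; i \<noteq> j\<rbrakk> \<Longrightarrow> y i \<le> x j \<or> y j \<le> x i"
  shows "(\<Sum>i\<in>F. G (x i) - G (y i)) \<le> G a - G b"
  using assms
proof (induction "card F" arbitrary: F b)
  case 0
  then show ?case by auto
next
  case (Suc n)
  then have "F \<noteq> {}" by auto
  then obtain m where m: "m \<in> F" "\<And>i. i \<in> F \<Longrightarrow> x i \<le> x m"
    using Max_in[of "x ` F"] Max_ge[of "x ` F"] \<open>finite F\<close>
    by (metis (no_types, lifting) finite_imageI imageE image_eqI image_is_empty)
  define F' where "F' = F - {m}"
  have F': "finite F'" "card F' = n" using Suc m by (auto simp: F'_def)
  \<comment> \<open>The other order, \<open>y m \<le> x i\<close>, would contradict the choice of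
    \<open>m\<close>.\<close>
  have ym: "y i \<le> x m" if "i \<in> F'" for i
    using Suc.prems(5)[of i m] m that Suc.prems(3)[of i] Suc.prems(3)[of m] m(2)[of i] by (force simp: F'_def)
  have "(\<Sum>i\<in>F'. G (x i) - G (y i)) \<le> G a - G (x m)"
  proof (rule Suc.hyps(1))
    show "n = card F'" using F' by simp
    show "G t \<le> G s" if "a \<le> s" "s \<le> t" "t \<le> x m" for s t
      using Suc.prems(2)[of s t] that Suc.prems(3)[OF m(1)] by auto
    show "a \<le> x i \<and> x i < y i \<and> y i \<le> x m" if "i \<in> F'" for i
      using Suc.prems(3)[of i] that ym by (auto simp: F'_def)
    show "a \<le> x m" using Suc.prems(3) m by auto
    show "y i \<le> x j \<or> y j \<le> x i" if "i \<in> F'" "j \<in> F'" "i \<noteq> j" for i j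
      using Suc.prems(5) that by (auto simp: F'_def)
  qed (use F' in auto)
  moreover have "G b \<le> G (y m)" using Suc.prems(2,3) m(1) by force
  moreover have "(\<Sum>i\<in>F. G (x i) - G (y i)) = (G (x m) - G (y m)) + (\<Sum>i\<in>F'. G (x i) - G (y i))"
    unfolding F'_def using m Suc.prems(1) by (simp add: sum.remove)
  ultimately show ?case by linarith
qed

text \<open>The intervals [t - h, t] on which \<open>G\<close> drops by at least
  \<open>c * h\<close> form a Vitali cover of \<open>B\<close>. A disjoint subfamily covering almost
  all of \<open>B\<close> has total length at most \<open>T / c\<close>, because the drops add up to
  at most \<open>T\<close>. \<open>B\<close> may be non-measurable, so a measurable superset is
  produced.\<close>

lemma antimono_steep_set_measure_le:
  fixes G :: "real \<Rightarrow> real"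
  assumes G: "\<And>s t. \<lbrakk>0 \<le> s; s \<le> t; t \<le> 1\<rbrakk> \<Longrightarrow> G t \<le> G s" and T: "G 0 - G 1 \<le> T" and c: "0 < c"
    and B: "B \<subseteq> {0<..1}"
    and steep: "\<And>t. t \<in> B \<Longrightarrow> \<exists>d>0. \<forall>h. 0 < h \<and> h < d \<longrightarrow> c * h \<le> G (t - h) - G t"
  obtains E where "E \<in> sets lebesgue" "B \<subseteq> E" "emeasure lebesgue E \<le> ennreal (T / c)"
proof -
  define K where "K = {(t, h). t \<in> B \<and> 0 < h \<and> h < t \<and> c * h \<le> G (t - h) - G t}"
  \<comment> \<open>Vitali's theorem is about balls; centre t - h/2 and radius h/2 turn the
    one-sided interval [t - h, t] into one.\<close>
  let ?a = "\<lambda>(t::real, h::real). t - h / 2" and ?r = "\<lambda>(t::real, h::real). h / 2"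
  have cb: "cball (?a i) (?r i) = {fst i - snd i .. fst i}" for i
    by (cases i) (auto simp: cball_eq_atLeastAtMost field_simps)
  obtain C where C: "countable C" "C \<subseteq> K"
    and disj: "pairwise (\<lambda>i j. disjnt (cball (?a i) (?r i)) (cball (?a j) (?r j))) C"
    and neg: "negligible (B - (\<Union>i\<in>C. cball (?a i) (?r i)))"
  proof (rule Vitali_covering_theorem_cballs[of K ?r B ?a])
    show "0 < ?r i" if "i \<in> K" for i using that by (auto simp: K_def)
    show "\<exists>i. i \<in> K \<and> x \<in> cball (?a i) (?r i) \<and> ?r i < d" if xB: "x \<in> B" "0 < d" for x d
    proof -
      obtain d' where d': "d' > 0" "\<forall>h. 0 < h \<and> h < d' \<longrightarrow> c * h \<le> G (x - h) - G x"
        using steep[OF xB(1)] by blast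
      have "0 < x" using B xB by auto
      \<comment> \<open>Halving makes all three bounds strict; h < t keeps the left endpoint
        positive, where \<open>G\<close> is known to be antitone.\<close>
      define h where "h = min (min d d') x / 2"
      have "0 < h" "h < d" "h < d'" "h < x" using xB d' \<open>0 < x\<close> by (auto simp: h_def)
      then show ?thesis using d' xB
        by (intro exI[of _ "(x, h)"]) (unfold cb, auto simp: K_def)
    qed
  qed auto
  define U where "U = (\<Union>i\<in>C. {fst i - snd i .. fst i})"
  have Cdisj: "disjnt {fst i - snd i .. fst i} {fst j - snd j .. fst j}" if "i \<in> C" "j \<in> C" "i \<noteq> j" for i j
    using disj that unfolding pairwise_def cb by blast
  have neg': "negligible (B - U)" using neg by (simp only: U_def cb)
  have CK: "fst i \<in> B" "0 < snd i" "snd i < fst i" "fst i \<le> 1" "c * snd i \<le> G (fst i - snd i) - G (fst i)" if "i \<in> C" for i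
    using subsetD[OF C(2) that] B by (auto simp: K_def)
  have fin: "(\<Sum>i\<in>F. snd i) \<le> T / c" if F: "finite F" "F \<subseteq> C" for F
  proof -
    have "(\<Sum>i\<in>F. G (fst i - snd i) - G (fst i)) \<le> G 0 - G 1"
    proof (rule antimono_sum_disjoint_intervals[where x = "\<lambda>i. fst i - snd i" and y = fst])
      show "0 \<le> fst i - snd i \<and> fst i - snd i < fst i \<and> fst i \<le> 1" if "i \<in> F" for i
        using CK(2,3,4)[of i] that F by auto
      show "fst i \<le> fst j - snd j \<or> fst j \<le> fst i - snd i" if "i \<in> F" "j \<in> F" "i \<noteq> j" for i j
      proof -
        have ij: "i \<in> C" "j \<in> C" using that F by auto
        have "fst i \<in> {fst i - snd i .. fst i}" "fst j \<in> {fst j - snd j .. fst j}"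
          using CK(2)[OF ij(1)] CK(2)[OF ij(2)] by auto
        then have "fst i \<notin> {fst j - snd j .. fst j}" "fst j \<notin> {fst i - snd i .. fst i}"
          using Cdisj[OF ij that(3)] unfolding disjnt_iff by blast+
        then show ?thesis by auto
      qed
    qed (use F G in auto)
    moreover have "(\<Sum>i\<in>F. c * snd i) \<le> (\<Sum>i\<in>F. G (fst i - snd i) - G (fst i))"
      by (rule sum_mono) (use CK F in auto)
    ultimately have "c * (\<Sum>i\<in>F. snd i) \<le> T" using T by (simp add: sum_distrib_left)
    then show ?thesis using c by (simp add: field_simps)
  qed
  have U: "U \<in> sets lebesgue" unfolding U_def using C(1) by (intro sets.countable_UN'') auto
  have U_bound: "U \<in> fmeasurable lebesgue \<and> measure lebesgue U \<le> T / c"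
  proof -
    have *: "measure lebesgue (\<Union>i\<in>F. {fst i - snd i .. fst i}) \<le> T / c" if F: "F \<subseteq> C" "finite F" for F
    proof -
      have "measure lebesgue (\<Union>i\<in>F. {fst i - snd i .. fst i}) \<le> (\<Sum>i\<in>F. measure lebesgue {fst i - snd i .. fst i})"
        using F by (intro measure_UNION_le) auto
      also have "\<dots> = (\<Sum>i\<in>F. snd i)"
      proof (rule sum.cong)
        fix i assume "i \<in> F"
        then have "0 < snd i" using CK(2) F by blast
        then show "measure lebesgue {fst i - snd i .. fst i} = snd i" by simp
      qed simp
      finally show ?thesis using fin F by force
    qed
    have m: "{fst i - snd i .. fst i} \<in> fmeasurable lebesgue" for i :: "real \<times> real"
      using lmeasurable_cbox[of "fst i - snd i" "fst i"] by simp
    show ?thesis unfolding U_def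
      using fmeasurable_UN_bound[OF C(1) m *] measure_UN_bound[OF C(1) m *] by blast
  qed
  then have eU: "emeasure lebesgue U \<le> ennreal (T / c)"
    by (simp add: emeasure_eq_measure2 ennreal_leI)
  have N: "B - U \<in> null_sets lebesgue" using neg' negligible_iff_null_sets by blast
  show thesis
  proof
    show "U \<union> (B - U) \<in> sets lebesgue"
      using U N by (intro sets.Un) (auto simp: null_sets_def)
    show "B \<subseteq> U \<union> (B - U)" by auto
    show "emeasure lebesgue (U \<union> (B - U)) \<le> ennreal (T / c)"
      using eU by (metis emeasure_Un_null_set U N)
  qed
qed

section \<open>Counting functions of a conformal pencil\<close>

text \<open>The Dirichlet form \<open>D\<close> of a metric, tested against the area measures \<open>exp (- t * f) M\<close> of a
  conformal family, on a space \<open>V\<close> of admissible real functions. The last assumption is the upper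
  half of Weyl's law for the metric at \<open>t = 0\<close>.\<close>

locale conformal_pencil = finite_measure M
  for M :: "'a measure" +
  fixes f :: "'a \<Rightarrow> real" and V :: "('a \<Rightarrow> real) set"
    and D :: "('a \<Rightarrow> real) \<Rightarrow> ('a \<Rightarrow> real) \<Rightarrow> real" and F C :: real
  assumes f_meas [measurable]: "f \<in> borel_measurable M"
    and f_nonneg: "x \<in> space M \<Longrightarrow> 0 \<le> f x" and f_le: "x \<in> space M \<Longrightarrow> f x \<le> F"
    and F_pos: "0 < F"
    and V_meas: "v \<in> V \<Longrightarrow> v \<in> borel_measurable M"
    and V_bdd: "v \<in> V \<Longrightarrow> \<exists>B. \<forall>x\<in>space M. \<bar>v x\<bar> \<le> B"
    and V_zero: "(\<lambda>x. 0) \<in> V"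
    and V_add: "u \<in> V \<Longrightarrow> v \<in> V \<Longrightarrow> (\<lambda>x. u x + v x) \<in> V"
    and V_scale: "v \<in> V \<Longrightarrow> (\<lambda>x. a * v x) \<in> V"
    and D_add: "u \<in> V \<Longrightarrow> v \<in> V \<Longrightarrow> w \<in> V \<Longrightarrow> D (\<lambda>x. u x + v x) w = D u w + D v w"
    and D_scale: "u \<in> V \<Longrightarrow> w \<in> V \<Longrightarrow> D (\<lambda>x. a * u x) w = a * D u w"
    and D_sym: "u \<in> V \<Longrightarrow> v \<in> V \<Longrightarrow> D u v = D v u"
    and D_nonneg: "u \<in> V \<Longrightarrow> 0 \<le> D u u"
    and C_nonneg: "0 \<le> C"
    and weyl: "\<lbrakk>0 \<le> s; \<And>i. i < k \<Longrightarrow> e i \<in> V;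
        \<And>a. \<exists>i<k. a i \<noteq> 0 \<Longrightarrow>
          0 < (\<integral>x. (\<Sum>i<k. a i * e i x)\<^sup>2 \<partial>M) \<and>
          D (\<lambda>x. \<Sum>i<k. a i * e i x) (\<lambda>x. \<Sum>i<k. a i * e i x) \<le> s * (\<integral>x. (\<Sum>i<k. a i * e i x)\<^sup>2 \<partial>M)\<rbrakk>
      \<Longrightarrow> real k \<le> C * (1 + s)"
begin

section \<open>Weighted norms and the counting function\<close>

definition ip :: "real \<Rightarrow> ('a \<Rightarrow> real) \<Rightarrow> ('a \<Rightarrow> real) \<Rightarrow> real" where
  "ip t u v = (\<integral>x. u x * v x * exp (- (t * f x)) \<partial>M)"

text \<open>Minus the derivative of \<open>ip t u u\<close> in t, and at the same time the
  concentration integral that the theorem estimates.\<close>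

definition ipf :: "real \<Rightarrow> ('a \<Rightarrow> real) \<Rightarrow> real" where
  "ipf t u = (\<integral>x. f x * (u x)\<^sup>2 * exp (- (t * f x)) \<partial>M)"

text \<open>A k-dimensional space is encoded by a spanning family. Strict positivity of the norm for
  every nonzero coefficient vector makes the family independent, even modulo null functions.\<close>

definition admissible :: "real \<Rightarrow> real \<Rightarrow> nat \<Rightarrow> bool" where
  "admissible t s k \<longleftrightarrow> (\<exists>u. (\<forall>i<k. u i \<in> V) \<and>
     (\<forall>a. (\<exists>i<k. a i \<noteq> 0) \<longrightarrow>
        (let w = (\<lambda>x. \<Sum>i<k. a i * u i x) in 0 < ip t w w \<and> D w w \<le> s * ip t w w)))"

text \<open>For nonnegative t and s the set is finite by the Weyl bound and contains 0, so
  \<open>Max\<close> is meaningful there.\<close>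

definition counting :: "real \<Rightarrow> real \<Rightarrow> nat" where
  "counting t s = Max {k. admissible t s k}"

lemma exp_bound: "x \<in> space M \<Longrightarrow> exp (- (t * f x)) \<le> exp (\<bar>t\<bar> * F)"
proof -
  assume x: "x \<in> space M"
  have "- (t * f x) \<le> \<bar>t * f x\<bar>" by simp
  also have "\<dots> \<le> \<bar>t\<bar> * F"
    unfolding abs_mult using f_nonneg[OF x] f_le[OF x] by (intro mult_left_mono) auto
  finally show ?thesis by simp
qed

lemma integrable_bdd:
  assumes "h \<in> borel_measurable M" "\<And>x. x \<in> space M \<Longrightarrow> \<bar>h x\<bar> \<le> B"
  shows "integrable M (h :: 'a \<Rightarrow> real)"
  by (rule integrable_const_bound[of _ B]) (use assms in auto)

lemma integrable_ip:
  assumes "u \<in> V" "v \<in> V"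
  shows "integrable M (\<lambda>x. u x * v x * exp (- (t * f x)))"
proof -
  note [measurable] = V_meas[OF assms(1)] V_meas[OF assms(2)]
  obtain A B where AB: "\<forall>x\<in>space M. \<bar>u x\<bar> \<le> A" "\<forall>x\<in>space M. \<bar>v x\<bar> \<le> B"
    using V_bdd assms by meson
  show ?thesis
  proof (rule integrable_bdd)
    show "\<bar>u x * v x * exp (- (t * f x))\<bar> \<le> \<bar>A\<bar> * \<bar>B\<bar> * exp (\<bar>t\<bar> * F)" if "x \<in> space M" for x
      unfolding abs_mult using AB that exp_bound[OF that, of t]
      by (intro mult_mono) force+
  qed measurable
qed

lemma integrable_ip2:
  assumes "u \<in> V"
  shows "integrable M (\<lambda>x. (u x)\<^sup>2 * exp (- (t * f x)))"
  using integrable_ip[OF assms assms] by (simp add: power2_eq_square)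

lemma integrable_ipf:
  assumes "u \<in> V"
  shows "integrable M (\<lambda>x. f x * (u x)\<^sup>2 * exp (- (t * f x)))"
proof -
  note [measurable] = V_meas[OF assms(1)]
  show ?thesis
  proof (rule Bochner_Integration.integrable_bound)
    show "integrable M (\<lambda>x. F * ((u x)\<^sup>2 * exp (- (t * f x))))"
      using integrable_ip2[OF assms] by simp
    show "AE x in M. norm (f x * (u x)\<^sup>2 * exp (- (t * f x))) \<le> norm (F * ((u x)\<^sup>2 * exp (- (t * f x))))"
      using f_nonneg f_le F_pos by (intro AE_I2) (auto simp: abs_mult mult.assoc intro!: mult_right_mono)
  qed measurable
qed

lemma ip_sym: "ip t u v = ip t v u"
  by (simp add: ip_def mult.commute)

lemma ip_add: "u \<in> V \<Longrightarrow> v \<in> V \<Longrightarrow> w \<in> V \<Longrightarrow> ip t (\<lambda>x. u x + v x) w = ip t u w + ip t v w"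
  using integrable_ip[of u w t] integrable_ip[of v w t]
  by (simp add: ip_def distrib_right)

lemma ip_scale: "ip t (\<lambda>x. a * u x) w = a * ip t u w"
  unfolding ip_def by (simp add: mult.assoc)

lemma ip_nonneg: "0 \<le> ip t u u"
  unfolding ip_def by (intro integral_nonneg_AE AE_I2) auto

lemma ip_antimono:
  assumes "u \<in> V" "t' \<le> t" shows "ip t u u \<le> ip t' u u"
  unfolding ip_def
  by (intro integral_mono integrable_ip)
    (use assms f_nonneg in \<open>auto intro!: mult_left_mono mult_right_mono\<close>)

text \<open>The weights never vanish, so norm zero means zero almost everywhere, at every time
  alike.\<close>

lemma ip_pos:
  assumes "u \<in> V" "0 < ip t u u" shows "0 < ip t' u u"
proof (rule ccontr)
  assume "\<not> 0 < ip t' u u"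
  then have 0: "ip t' u u = 0" using ip_nonneg[of t' u] by simp
  have "AE x in M. u x * u x * exp (- (t' * f x)) = 0"
    using 0 unfolding ip_def
    by (subst (asm) integral_nonneg_eq_0_iff_AE) (auto intro!: integrable_ip assms)
  then have "AE x in M. u x * u x * exp (- (t * f x)) = 0" by eventually_elim auto
  then have "ip t u u = 0" unfolding ip_def by (rule integral_eq_zero_AE)
  then show False using assms by simp
qed

text \<open>Pointwise this is 1 + y \<le> exp y with y = h f. The first-order expansion backwards in
  time is an exact lower bound, so no remainder has to be controlled.\<close>

lemma ip_decrease:
  assumes "u \<in> V" "0 \<le> h"
  shows "ip t u u + h * ipf t u \<le> ip (t - h) u u"
proof -
  have "ip t u u + h * ipf t u = (\<integral>x. u x * u x * exp (- (t * f x)) + h * (f x * (u x)\<^sup>2 * exp (- (t * f x))) \<partial>M)"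
    unfolding ip_def ipf_def
    by (subst Bochner_Integration.integral_add) (auto intro!: integrable_ip integrable_ipf assms)
  also have "\<dots> \<le> ip (t - h) u u"
    unfolding ip_def
  proof (rule integral_mono)
    fix x assume "x \<in> space M"
    have "1 + h * f x \<le> exp (h * f x)" by simp
    then have "(u x)\<^sup>2 * exp (- (t * f x)) * (1 + h * f x) \<le> (u x)\<^sup>2 * exp (- (t * f x)) * exp (h * f x)"
      by (intro mult_left_mono) auto
    also have "\<dots> = (u x)\<^sup>2 * exp (- ((t - h) * f x))"
      by (simp add: mult.assoc exp_add[symmetric] algebra_simps)
    finally show "u x * u x * exp (- (t * f x)) + h * (f x * (u x)\<^sup>2 * exp (- (t * f x))) \<le> u x * u x * exp (- ((t - h) * f x))"
      by (simp add: algebra_simps power2_eq_square)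
  qed (intro Bochner_Integration.integrable_add integrable_mult_right integrable_ip integrable_ipf assms)+
  finally show ?thesis .
qed

lemma V_sum: "(\<And>i. i < (k::nat) \<Longrightarrow> u i \<in> V) \<Longrightarrow> (\<lambda>x. \<Sum>i<k. a i * u i x) \<in> V"
  by (induction k) (auto intro!: V_zero V_add V_scale)

lemma ip_sum: "(\<And>i. i < (k::nat) \<Longrightarrow> u i \<in> V) \<Longrightarrow> w \<in> V \<Longrightarrow>
    ip t (\<lambda>x. \<Sum>i<k. a i * u i x) w = (\<Sum>i<k. a i * ip t (u i) w)"
proof (induction k)
  case 0
  then show ?case by (simp add: ip_def)
next
  case (Suc k)
  then show ?case by (simp add: ip_add ip_scale V_sum V_scale)
qed

lemma D_quadratic:
  assumes "u \<in> V" "v \<in> V"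
  shows "D (\<lambda>x. u x + b * v x) (\<lambda>x. u x + b * v x) = D u u + 2 * b * D u v + b\<^sup>2 * D v v"
proof -
  have V: "(\<lambda>x. b * v x) \<in> V" "(\<lambda>x. u x + b * v x) \<in> V" using assms V_add V_scale by auto
  have "D u (\<lambda>x. u x + b * v x) = D u u + b * D u v"
    using D_add[OF assms(1) V(1) assms(1)] D_scale[OF assms(2,1), of b] D_sym[OF assms(1) V(2)] D_sym[OF assms] by simp
  moreover have "D v (\<lambda>x. u x + b * v x) = D u v + b * D v v"
    using D_add[OF assms(1) V(1) assms(2)] D_scale[OF assms(2,2), of b] D_sym[OF assms(2) V(2)] by simp
  ultimately show ?thesis using assms V
    by (simp add: D_add D_scale power2_eq_square algebra_simps)
qed

lemma ip_quadratic:
  assumes "u \<in> V" "v \<in> V"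
  shows "ip t (\<lambda>x. u x + b * v x) (\<lambda>x. u x + b * v x) = ip t u u + 2 * b * ip t u v + b\<^sup>2 * ip t v v"
proof -
  have V: "(\<lambda>x. b * v x) \<in> V" "(\<lambda>x. u x + b * v x) \<in> V" using assms V_add V_scale by auto
  have "ip t u (\<lambda>x. u x + b * v x) = ip t u u + b * ip t u v"
    using ip_add[OF assms(1) V(1) assms(1)] ip_scale[of t b v u] ip_sym[of t u "\<lambda>x. u x + b * v x"] ip_sym[of t v u] by simp
  moreover have "ip t v (\<lambda>x. u x + b * v x) = ip t u v + b * ip t v v"
    using ip_add[OF assms(1) V(1) assms(2)] ip_scale[of t b v v] ip_sym[of t v "\<lambda>x. u x + b * v x"] by simp
  ultimately show ?thesis using assms V
    by (simp add: ip_add ip_scale power2_eq_square algebra_simps)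
qed

lemma admissible_0: "admissible t s 0"
  by (simp add: admissible_def)

text \<open>The same family serves: \<open>D\<close> does not depend on t, while the norm grows as t
  decreases.\<close>

lemma admissible_mono:
  assumes "admissible t s k" "t' \<le> t" "s \<le> s'" "0 \<le> s"
  shows "admissible t' s' k"
proof -
  obtain u where u: "\<forall>i<k. u i \<in> V"
    and *: "\<And>a. \<exists>i<k. a i \<noteq> 0 \<Longrightarrow>
        0 < ip t (\<lambda>x. \<Sum>i<k. a i * u i x) (\<lambda>x. \<Sum>i<k. a i * u i x) \<and>
        D (\<lambda>x. \<Sum>i<k. a i * u i x) (\<lambda>x. \<Sum>i<k. a i * u i x) \<le>
          s * ip t (\<lambda>x. \<Sum>i<k. a i * u i x) (\<lambda>x. \<Sum>i<k. a i * u i x)"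
    using assms(1) unfolding admissible_def Let_def by blast
  show ?thesis
    unfolding admissible_def Let_def
  proof (intro exI[of _ u] conjI allI impI)
    fix a :: "nat \<Rightarrow> real" assume a: "\<exists>i<k. a i \<noteq> 0"
    let ?w = "\<lambda>x. \<Sum>i<k. a i * u i x"
    have V: "?w \<in> V" using u by (intro V_sum) auto
    show "0 < ip t' ?w ?w" using *[OF a] ip_pos V by blast
    have "D ?w ?w \<le> s * ip t ?w ?w" using *[OF a] by blast
    also have "\<dots> \<le> s' * ip t' ?w ?w"
      using assms V ip_antimono ip_nonneg by (intro mult_mono) auto
    finally show "D ?w ?w \<le> s' * ip t' ?w ?w" .
  qed (use u in auto)
qed

text \<open>Among nonnegative times the norms are largest at 0, so the Weyl bound assumed there
  governs every later time.\<close>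

lemma admissible_le:
  assumes "admissible t s k" "0 \<le> t" "0 \<le> s"
  shows "real k \<le> C * (1 + s)"
proof -
  have "admissible 0 s k" using admissible_mono[OF assms(1)] assms by auto
  then obtain u where u: "\<forall>i<k. u i \<in> V"
    and *: "\<And>a. \<exists>i<k. a i \<noteq> 0 \<Longrightarrow>
        0 < ip 0 (\<lambda>x. \<Sum>i<k. a i * u i x) (\<lambda>x. \<Sum>i<k. a i * u i x) \<and>
        D (\<lambda>x. \<Sum>i<k. a i * u i x) (\<lambda>x. \<Sum>i<k. a i * u i x) \<le>
          s * ip 0 (\<lambda>x. \<Sum>i<k. a i * u i x) (\<lambda>x. \<Sum>i<k. a i * u i x)"
    unfolding admissible_def Let_def by blast
  show ?thesis
    by (rule weyl[OF assms(3), of k u]) (use u * in \<open>auto simp: ip_def power2_eq_square\<close>)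
qed

lemma finite_admissible:
  assumes "0 \<le> t" "0 \<le> s" shows "finite {k. admissible t s k}"
proof (rule finite_subset)
  show "{k. admissible t s k} \<subseteq> {.. nat \<lfloor>C * (1 + s)\<rfloor>}"
    using admissible_le[OF _ assms] by (auto simp: le_nat_floor)
qed auto

lemma admissible_counting: "0 \<le> t \<Longrightarrow> 0 \<le> s \<Longrightarrow> admissible t s (counting t s)"
  unfolding counting_def using Max_in[OF finite_admissible[of t s]] admissible_0 by blast

lemma counting_ge: "0 \<le> t \<Longrightarrow> 0 \<le> s \<Longrightarrow> admissible t s k \<Longrightarrow> k \<le> counting t s"
  unfolding counting_def by (rule Max_ge) (auto intro: finite_admissible)

lemma counting_mono:
  assumes "0 \<le> t'" "t' \<le> t" "0 \<le> s" "s \<le> s'"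
  shows "counting t s \<le> counting t' s'"
  using assms by (intro counting_ge admissible_mono[OF admissible_counting[of t s]]) auto

lemma counting_le: "0 \<le> t \<Longrightarrow> 0 \<le> s \<Longrightarrow> real (counting t s) \<le> C * (1 + s)"
  using admissible_le admissible_counting by blast

section \<open>Eigenfunctions make the counting function jump\<close>

text \<open>The weak eigenvalue equation, normalised at time t; it is the only information about
  \<phi> on which the abstract argument relies.\<close>

definition eigen :: "real \<Rightarrow> real \<Rightarrow> ('a \<Rightarrow> real) \<Rightarrow> bool" where
  "eigen t \<mu> \<phi> \<longleftrightarrow> \<phi> \<in> V \<and> ip t \<phi> \<phi> = 1 \<and> (\<forall>u\<in>V. D u \<phi> = \<mu> * ip t u \<phi>)"

text \<open>A space realising the counting function just below the eigenvalue \<open>\<mu>\<close> is made orthogonal to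
  the eigenfunction \<open>\<phi>\<close>, and then \<open>\<phi>\<close> is added to it.\<close>

lemma admissible_Suc:
  assumes e: "eigen t \<mu> \<phi>" and P: "admissible t s0 k" and s: "0 < s0" "s0 < s" "s < \<mu>"
    and h: "0 < h" and \<eta>: "\<eta> \<le> ipf t \<phi>"
    and \<kappa>: "\<mu> - s \<le> s * h * \<eta> / 2" and \<gamma>: "s * h * F \<le> s - s0"
  shows "admissible (t - h) s (Suc k)"
proof -
  have \<phi>: "\<phi> \<in> V" "ip t \<phi> \<phi> = 1" "\<And>u. u \<in> V \<Longrightarrow> D u \<phi> = \<mu> * ip t u \<phi>"
    using e by (auto simp: eigen_def)
  obtain u where u: "\<forall>i<k. u i \<in> V"
    and *: "\<And>a. \<exists>i<k. a i \<noteq> 0 \<Longrightarrow>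
        0 < ip t (\<lambda>x. \<Sum>i<k. a i * u i x) (\<lambda>x. \<Sum>i<k. a i * u i x) \<and>
        D (\<lambda>x. \<Sum>i<k. a i * u i x) (\<lambda>x. \<Sum>i<k. a i * u i x) \<le>
          s0 * ip t (\<lambda>x. \<Sum>i<k. a i * u i x) (\<lambda>x. \<Sum>i<k. a i * u i x)"
    using P unfolding admissible_def Let_def by blast
  define u' where "u' = (\<lambda>i. if i < k then (\<lambda>x. u i x + (- ip t (u i) \<phi>) * \<phi> x) else \<phi>)"
  show ?thesis
    unfolding admissible_def Let_def
  proof (intro exI[of _ u'] conjI allI impI)
    show "u' i \<in> V" if "i < Suc k" for i
    proof (cases "i < k")
      case True
      then have "(\<lambda>x. u i x + (- ip t (u i) \<phi>) * \<phi> x) \<in> V" using u \<phi> V_add V_scale by blast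
      then show ?thesis using True by (simp add: u'_def)
    qed (use \<phi> in \<open>simp add: u'_def\<close>)
  next
    fix a :: "nat \<Rightarrow> real" assume a: "\<exists>i<Suc k. a i \<noteq> 0"
    \<comment> \<open>A general combination \<open>w\<close> is the projected old combination
      \<open>v'\<close> plus \<open>c\<close> times \<phi>; \<open>\<alpha>\<close> is the component
      of \<open>v\<close> along \<phi> that the projection removes.\<close>
    define v where "v = (\<lambda>x. \<Sum>i<k. a i * u i x)"
    define \<alpha> where "\<alpha> = ip t v \<phi>"
    define v' where "v' = (\<lambda>x. v x + (-\<alpha>) * \<phi> x)"
    define c where "c = a k"
    define w where "w = (\<lambda>x. v' x + c * \<phi> x)"
    have vV: "v \<in> V" unfolding v_def using u by (intro V_sum) auto
    have v'V: "v' \<in> V" unfolding v'_def using vV \<phi> by (intro V_add V_scale)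
    have wV: "w \<in> V" unfolding w_def using v'V \<phi> by (intro V_add V_scale)
    have \<alpha>_sum: "\<alpha> = (\<Sum>i<k. a i * ip t (u i) \<phi>)"
      unfolding \<alpha>_def v_def using u \<phi> by (intro ip_sum) auto
    have w_eq: "(\<lambda>x. \<Sum>i<Suc k. a i * u' i x) = w"
      by (simp add: fun_eq_iff w_def v'_def v_def c_def u'_def \<alpha>_sum algebra_simps
          sum_subtractf sum_distrib_left sum_distrib_right)
    define n where "n = ip t v v"
    have v_bd: "D v v \<le> s0 * n" "(\<exists>i<k. a i \<noteq> 0) \<Longrightarrow> 0 < n"
    proof -
      show "(\<exists>i<k. a i \<noteq> 0) \<Longrightarrow> 0 < n" using * by (auto simp: n_def v_def)
      show "D v v \<le> s0 * n"
      proof (cases "\<exists>i<k. a i \<noteq> 0")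
        case True then show ?thesis using * by (auto simp: n_def v_def)
      next
        case False
        then have "v = (\<lambda>x. 0)" by (auto simp: v_def)
        then show ?thesis using D_scale[OF V_zero V_zero, of 0] by (simp add: n_def ip_def)
      qed
    qed
    have ipv': "ip t v' v' = n - \<alpha>\<^sup>2"
      unfolding v'_def ip_quadratic[OF vV \<phi>(1)] n_def[symmetric] \<phi>(2) \<alpha>_def[symmetric]
      by (simp add: power2_eq_square)
    have Dv': "D v' v' = D v v - \<mu> * \<alpha>\<^sup>2"
      unfolding v'_def D_quadratic[OF vV \<phi>(1)] \<phi>(3)[OF vV] \<phi>(3)[OF \<phi>(1)] \<phi>(2) \<alpha>_def[symmetric]
      by (simp add: power2_eq_square)
    have ort: "ip t v' \<phi> = 0"
      unfolding v'_def using ip_add[OF vV V_scale[OF \<phi>(1), of "-\<alpha>"] \<phi>(1), of t]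
        ip_scale[of t "-\<alpha>" \<phi> \<phi>] \<phi>(2) by (simp add: \<alpha>_def)
    \<comment> \<open>As \<phi> is an eigenfunction, orthogonality for \<open>ip t\<close> entails
      orthogonality for \<open>D\<close>, so both forms lose their cross terms.\<close>
    have ipw: "ip t w w = (n - \<alpha>\<^sup>2) + c\<^sup>2"
      unfolding w_def ip_quadratic[OF v'V \<phi>(1)] ort ipv' \<phi>(2) by simp
    have Dw: "D w w = D v v - \<mu> * \<alpha>\<^sup>2 + \<mu> * c\<^sup>2"
      unfolding w_def D_quadratic[OF v'V \<phi>(1)] \<phi>(3)[OF v'V] \<phi>(3)[OF \<phi>(1)] ort Dv' \<phi>(2) by simp
    define m where "m = n - \<alpha>\<^sup>2"
    have m0: "0 \<le> m" using ip_nonneg[of t v'] ipv' by (simp add: m_def)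
    \<comment> \<open>From (c \<phi>)^2 / 2 \<le> (c \<phi> + v')^2 + v'^2: the mixed term of f w^2
      is traded for a loss of \<open>F * m\<close>, which the gap between \<open>s0\<close> and
      \<open>s\<close> will pay.\<close>
    have f_low: "c\<^sup>2 * \<eta> / 2 - F * m \<le> ipf t w"
    proof -
      have "c\<^sup>2 * ipf t \<phi> / 2 - F * m = (\<integral>x. c\<^sup>2 / 2 * (f x * (\<phi> x)\<^sup>2 * exp (- (t * f x))) - F * ((v' x)\<^sup>2 * exp (- (t * f x))) \<partial>M)"
        using integrable_ipf[OF \<phi>(1), of t] integrable_ip2[OF v'V, of t] ipv'
        by (simp add: ipf_def m_def ip_def power2_eq_square)
      also have "\<dots> \<le> ipf t w"
        unfolding ipf_def
      proof (rule integral_mono)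
        fix x assume x: "x \<in> space M"
        have *: "c\<^sup>2 / 2 * (\<phi> x)\<^sup>2 \<le> (w x)\<^sup>2 + (v' x)\<^sup>2"
          unfolding w_def using zero_le_power2[of "c * \<phi> x / 2 + v' x"] zero_le_power2[of "c * \<phi> x + 2 * v' x"]
          by (simp add: power2_eq_square algebra_simps)
        have "f x * (v' x)\<^sup>2 \<le> F * (v' x)\<^sup>2" using f_le[OF x] by (intro mult_right_mono) auto
        moreover have "f x * (c\<^sup>2 / 2 * (\<phi> x)\<^sup>2) \<le> f x * ((w x)\<^sup>2 + (v' x)\<^sup>2)"
          using * f_nonneg[OF x] by (intro mult_left_mono) auto
        ultimately have "f x * (c\<^sup>2 / 2 * (\<phi> x)\<^sup>2) - F * (v' x)\<^sup>2 \<le> f x * (w x)\<^sup>2"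
          by (simp add: algebra_simps)
        then have "(f x * (c\<^sup>2 / 2 * (\<phi> x)\<^sup>2) - F * (v' x)\<^sup>2) * exp (- (t * f x)) \<le> f x * (w x)\<^sup>2 * exp (- (t * f x))"
          by (intro mult_right_mono) auto
        then show "c\<^sup>2 / 2 * (f x * (\<phi> x)\<^sup>2 * exp (- (t * f x))) - F * ((v' x)\<^sup>2 * exp (- (t * f x))) \<le> f x * (w x)\<^sup>2 * exp (- (t * f x))"
          by (simp add: algebra_simps)
      qed (intro Bochner_Integration.integrable_diff integrable_mult_right integrable_ipf integrable_ip2 \<phi> v'V wV)+
      finally have "c\<^sup>2 * ipf t \<phi> / 2 - F * m \<le> ipf t w" .
      moreover have "c\<^sup>2 * \<eta> \<le> c\<^sup>2 * ipf t \<phi>" using \<eta> by (intro mult_left_mono) auto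
      ultimately show ?thesis by linarith
    qed
    have s0: "0 < s" using s by simp
    have "D w w \<le> s0 * m - (\<mu> - s0) * \<alpha>\<^sup>2 + \<mu> * c\<^sup>2"
      using Dw v_bd(1) by (simp add: m_def algebra_simps)
    also have "\<dots> \<le> s0 * m + \<mu> * c\<^sup>2" using s by simp
    \<comment> \<open>Two budgets: on \<open>v'\<close> the gap \<open>s - s0\<close> pays for
      \<open>F * m\<close> by assumption \<open>\<gamma>\<close>; on \<phi> the excess
      \<open>\<mu> - s\<close> is paid, by assumption \<open>\<kappa>\<close>, from the norm gained
      through \<eta> on going back to t - h.\<close>
    also have "\<dots> = s * (m + c\<^sup>2) - (s - s0) * m + (\<mu> - s) * c\<^sup>2" by (simp add: algebra_simps)
    also have "\<dots> \<le> s * (m + c\<^sup>2) - (s * h * F) * m + (s * h * \<eta> / 2) * c\<^sup>2"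
      using mult_right_mono[OF \<gamma> m0] mult_right_mono[OF \<kappa>, of "c\<^sup>2"] by simp
    also have "\<dots> = s * (ip t w w + h * (c\<^sup>2 * \<eta> / 2 - F * m))"
      unfolding ipw m_def[symmetric] by (simp add: algebra_simps)
    also have "\<dots> \<le> s * (ip t w w + h * ipf t w)"
      using f_low h s0 by (intro mult_left_mono add_left_mono) auto
    also have "\<dots> \<le> s * ip (t - h) w w"
      using ip_decrease[OF wV, of h t] h s0 by (intro mult_left_mono) auto
    finally have "D w w \<le> s * ip (t - h) w w" .
    \<comment> \<open>The projection loses no dimension: if \<open>w\<close> were null, then
      \<open>c\<close> = 0 and \<open>v\<close> would agree in norm with its component along \<phi>.
      That forces Rayleigh quotient \<mu> or more, although the one of \<open>v\<close> is at most
      s0 < \<mu>.\<close>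
    moreover have "0 < ip t w w"
    proof (rule ccontr)
      assume "\<not> 0 < ip t w w"
      then have "m + c\<^sup>2 \<le> 0" using ipw by (simp add: m_def)
      moreover have "0 \<le> c\<^sup>2" by simp
      ultimately have "c\<^sup>2 = 0" and m: "m = 0" using m0 by linarith+
      then have c0: "c = 0" by simp
      have "\<exists>i<k. a i \<noteq> 0" using a c0 by (auto simp: c_def less_Suc_eq)
      then have "0 < n" using v_bd by blast
      have "D v' v' \<le> (s0 - \<mu>) * n" using Dv' v_bd(1) m by (simp add: m_def algebra_simps)
      also have "\<dots> < 0" using s \<open>0 < n\<close> by (simp add: mult_neg_pos)
      finally show False using D_nonneg[OF v'V] by simp
    qed
    ultimately show "0 < ip (t - h) (\<lambda>x. \<Sum>i<Suc k. a i * u' i x) (\<lambda>x. \<Sum>i<Suc k. a i * u' i x)"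
      and "D (\<lambda>x. \<Sum>i<Suc k. a i * u' i x) (\<lambda>x. \<Sum>i<Suc k. a i * u' i x) \<le>
         s * ip (t - h) (\<lambda>x. \<Sum>i<Suc k. a i * u' i x) (\<lambda>x. \<Sum>i<Suc k. a i * u' i x)"
      unfolding w_eq using ip_pos[OF wV] by blast+
  qed
qed

text \<open>For fixed t the count is integer valued, monotone in s and bounded by its value at
  \<mu>, hence constant on some interval [s0, \<mu>). A space at level s0 realises the count on this
  whole plateau and leaves a gap below \<mu>.\<close>

lemma counting_jump:
  assumes e: "eigen t \<mu> \<phi>" and \<mu>: "0 < \<mu>" and t: "0 < t" and \<eta>: "0 < \<eta>" "\<eta> \<le> ipf t \<phi>"
  obtains d where "0 < d" "\<And>h s. \<lbrakk>0 < h; h < d; \<mu> - \<mu> * h * \<eta> / 4 \<le> s; s < \<mu>\<rbrakk> \<Longrightarrow>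
    counting t s + 1 \<le> counting (t - h) s"
proof -
  define S where "S = counting t ` {\<mu>/2..<\<mu>}"
  have "S \<subseteq> {..counting t \<mu>}" unfolding S_def using \<mu> t by (auto intro!: counting_mono)
  then have "finite S" using finite_subset by blast
  moreover have "S \<noteq> {}" using \<mu> by (auto simp: S_def)
  ultimately obtain s0 where s0: "\<mu>/2 \<le> s0" "s0 < \<mu>" "\<And>s. \<mu>/2 \<le> s \<Longrightarrow> s < \<mu> \<Longrightarrow> counting t s \<le> counting t s0"
  proof -
    obtain s0 where "s0 \<in> {\<mu>/2..<\<mu>}" "Max S = counting t s0"
      using Max_in[OF \<open>finite S\<close> \<open>S \<noteq> {}\<close>] unfolding S_def by blast
    moreover have "counting t s \<le> Max S" if "\<mu>/2 \<le> s" "s < \<mu>" for s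
      using that by (intro Max_ge \<open>finite S\<close>) (auto simp: S_def)
    ultimately show ?thesis using that[of s0] by auto
  qed
  define \<gamma> where "\<gamma> = (\<mu> - s0) / 2"
  have \<gamma>: "0 < \<gamma>" using s0 by (simp add: \<gamma>_def)
  \<comment> \<open>The first bound keeps t - h positive, the second makes the loss
    \<open>\<mu> * h * F\<close> smaller than \<open>\<gamma>\<close>, and the third puts the window
    for s within \<open>\<gamma>\<close> of \<mu>, hence above s0 + \<open>\<gamma>\<close>.\<close>
  define d where "d = min t (min (\<gamma> / (\<mu> * F)) (4 * \<gamma> / (\<mu> * \<eta>)))"
  show thesis
  proof
    show "0 < d" using t \<gamma> \<mu> F_pos \<eta> by (simp add: d_def)
    fix h s assume h: "0 < h" "h < d" and s: "\<mu> - \<mu> * h * \<eta> / 4 \<le> s" "s < \<mu>"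
    have "h < t" "h < \<gamma> / (\<mu> * F)" "h < 4 * \<gamma> / (\<mu> * \<eta>)" using h by (auto simp: d_def)
    then have h': "h < t" "\<mu> * h * F < \<gamma>" "\<mu> * h * \<eta> < 4 * \<gamma>"
      using \<mu> F_pos \<eta> by (auto simp: pos_less_divide_eq mult_ac)
    have sg: "\<mu> - \<gamma> < s" using s h' by linarith
    moreover have "\<mu> - s0 = 2 * \<gamma>" by (simp add: \<gamma>_def)
    ultimately have ss0: "s - s0 > \<gamma>" by linarith
    have "s > \<mu>/2" using ss0 s0 \<gamma> by linarith
    have "admissible (t - h) s (Suc (counting t s0))"
    proof (rule admissible_Suc[OF e])
      show "admissible t s0 (counting t s0)" using s0 \<mu> t by (intro admissible_counting) auto
      \<comment> \<open>The window uses 1/4 where \<open>admissible_Suc\<close> has 1/2: replacing s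
        by its lower bound \<mu> / 2 costs the factor 2.\<close>
      have "\<mu> * (h * \<eta> / 4) \<le> (2 * s) * (h * \<eta> / 4)"
        using \<open>s > \<mu>/2\<close> h \<eta> by (intro mult_right_mono) auto
      then show "\<mu> - s \<le> s * h * \<eta> / 2" using s by (simp add: algebra_simps)
      have "s * (h * F) \<le> \<mu> * (h * F)" using s h F_pos by (intro mult_right_mono) auto
      then show "s * h * F \<le> s - s0" using h' ss0 by (simp add: mult_ac)
    qed (use s0 \<mu> s ss0 \<gamma> h \<eta> in auto)
    then have "Suc (counting t s0) \<le> counting (t - h) s"
      using h' \<open>s > \<mu>/2\<close> \<mu> by (intro counting_ge) auto
    moreover have "counting t s \<le> counting t s0" using s0 \<open>s > \<mu>/2\<close> s by auto
    ultimately show "counting t s + 1 \<le> counting (t - h) s" by simp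
  qed
qed

text \<open>The count is integrated over [lam - 2l, lam + 2l], so that the window just below an
  eigenvalue \<mu> \<ge> lam - l still fits. Length 4l, height C (1 + lam + 2l) and slope (lam - l)
  \<eta> / 4 produce the constant 16.\<close>

lemma exceptional_set_measure_le:
  assumes l: "0 < l" "0 < lam - 2 * l" and \<eta>: "0 < \<eta>"
  obtains E where "E \<in> sets lebesgue"
    "{t\<in>{0<..1}. \<exists>\<mu> \<phi>. \<mu> \<in> {lam - l..lam + l} \<and> eigen t \<mu> \<phi> \<and> \<eta> \<le> ipf t \<phi>} \<subseteq> E"
    "emeasure lebesgue E \<le> ennreal (16 * l * C * (1 + lam + 2 * l) / ((lam - l) * \<eta>))"
proof -
  define a b where "a = lam - 2 * l" and "b = lam + 2 * l"
  have ab: "0 < a" "a < b" using l by (auto simp: a_def b_def)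
  define G where "G = (\<lambda>t. integral {a..b} (\<lambda>s. real (counting t s)))"
  have int: "(\<lambda>s. real (counting t s)) integrable_on {a..b}" if "0 \<le> t" for t
    by (rule integrable_on_mono_on) (use that ab in \<open>auto simp: mono_on_def intro!: counting_mono\<close>)
  have G_mono: "G t \<le> G s" if "0 \<le> s" "s \<le> t" for s t
    unfolding G_def using that ab by (intro integral_le int) (auto intro!: counting_mono)
  have "G 0 \<le> integral {a..b} (\<lambda>s. C * (1 + b))"
    unfolding G_def
  proof (intro integral_le int)
    fix s assume s: "s \<in> {a..b}"
    then have "real (counting 0 s) \<le> C * (1 + s)" using ab by (intro counting_le) auto
    also have "\<dots> \<le> C * (1 + b)" using s C_nonneg by (intro mult_left_mono) auto
    finally show "real (counting 0 s) \<le> C * (1 + b)" .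
  qed auto
  then have G0: "G 0 \<le> (b - a) * (C * (1 + b))" using ab by (simp add: mult_ac)
  have G1: "0 \<le> G 1" unfolding G_def by (intro integral_nonneg int) auto
  define c where "c = (lam - l) * \<eta> / 4"
  have c: "0 < c" using l \<eta> by (simp add: c_def)
  define B where "B = {t\<in>{0<..1}. \<exists>\<mu> \<phi>. \<mu> \<in> {lam - l..lam + l} \<and> eigen t \<mu> \<phi> \<and> \<eta> \<le> ipf t \<phi>}"
  obtain E where E: "E \<in> sets lebesgue" "B \<subseteq> E" "emeasure lebesgue E \<le> ennreal ((b - a) * (C * (1 + b)) / c)"
  proof (rule antimono_steep_set_measure_le[of G "(b - a) * (C * (1 + b))" c B])
    show "G t \<le> G s" if "0 \<le> s" "s \<le> t" "t \<le> 1" for s t using G_mono that by auto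
    show "G 0 - G 1 \<le> (b - a) * (C * (1 + b))" using G0 G1 by simp
    show "0 < c" by fact
    show "B \<subseteq> {0<..1}" by (auto simp: B_def)
    show "\<exists>d>0. \<forall>h. 0 < h \<and> h < d \<longrightarrow> c * h \<le> G (t - h) - G t" if tB: "t \<in> B" for t
    proof -
      obtain \<mu> \<phi> where t: "0 < t" and \<mu>: "lam - l \<le> \<mu>" "\<mu> \<le> lam + l" and e: "eigen t \<mu> \<phi>" "\<eta> \<le> ipf t \<phi>"
        using tB by (auto simp: B_def)
      have \<mu>0: "0 < \<mu>" using \<mu> l by simp
      obtain d where d: "0 < d" "\<And>h s. \<lbrakk>0 < h; h < d; \<mu> - \<mu> * h * \<eta> / 4 \<le> s; s < \<mu>\<rbrakk> \<Longrightarrow>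
          counting t s + 1 \<le> counting (t - h) s"
        using counting_jump[OF e(1) \<mu>0 t \<eta> e(2)] by blast
      \<comment> \<open>The last bound makes the window below \<mu> shorter than l.\<close>
      define d' where "d' = min (min d t) (4 * l / (\<mu> * \<eta>))"
      have "0 < d'" using d t l \<mu>0 \<eta> by (simp add: d'_def)
      moreover have "c * h \<le> G (t - h) - G t" if h: "0 < h" "h < d'" for h
      proof -
        have h': "h < d" "h < t" "\<mu> * h * \<eta> < 4 * l" using h \<mu>0 \<eta>
          by (auto simp: d'_def pos_less_divide_eq mult_ac)
        define a' where "a' = \<mu> - \<mu> * h * \<eta> / 4"
        have a': "a \<le> a'" "a' \<le> \<mu>" "\<mu> \<le> b" using h' \<mu> h \<mu>0 \<eta> by (auto simp: a'_def a_def b_def)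
        have "c * h \<le> \<mu> - a'"
          unfolding c_def a'_def using \<mu> h \<eta> by (simp add: mult_right_mono)
        also have "\<dots> = integral {a'..\<mu>} (\<lambda>_. 1)" using a' by simp
        \<comment> \<open>The jump is known for s < \<mu> only; the endpoint is a null set.\<close>
        also have "\<dots> = integral {a'..\<mu>} (\<lambda>s. if s = \<mu> then 0 else 1)"
          by (rule integral_spike[of "{\<mu>}"]) auto
        also have "\<dots> = integral {a..b} (\<lambda>s. if s \<in> {a'..<\<mu>} then 1 else 0)"
        proof -
          have "integral {a'..\<mu>} (\<lambda>s. if s = \<mu> then 0 else (1::real)) = integral {a'..\<mu>} (\<lambda>s. if s \<in> {a'..<\<mu>} then 1 else 0)"
            by (rule integral_cong) auto
          also have "\<dots> = integral {a..b} (\<lambda>s. if s \<in> {a'..\<mu>} then (if s \<in> {a'..<\<mu>} then 1 else 0) else 0)"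
            using a' unfolding integral_restrict_Int by (simp add: Int_absorb2)
          also have "\<dots> = integral {a..b} (\<lambda>s. if s \<in> {a'..<\<mu>} then 1 else 0)"
            by (rule integral_cong) auto
          finally show ?thesis .
        qed
        also have "\<dots> \<le> integral {a..b} (\<lambda>s. real (counting (t - h) s) - real (counting t s))"
        proof (rule integral_le)
          have "(\<lambda>s. 1::real) integrable_on {a'..\<mu>}" by auto
          then have "(\<lambda>s. if s \<in> {a'..<\<mu>} then 1 else (0::real)) integrable_on {a'..\<mu>}"
            by (rule integrable_spike[of _ _ "{\<mu>}"]) auto
          then have "(\<lambda>s. if s \<in> {a'..\<mu>} then (if s \<in> {a'..<\<mu>} then 1 else 0) else (0::real)) integrable_on {a..b}"
            using a' by (subst integrable_restrict_Int) (auto simp: Int_absorb2)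
          then show "(\<lambda>s. if s \<in> {a'..<\<mu>} then 1 else (0::real)) integrable_on {a..b}"
            by (rule integrable_eq) auto
          show "(\<lambda>s. real (counting (t - h) s) - real (counting t s)) integrable_on {a..b}"
            using t h' by (intro integrable_diff int) auto
          fix s assume s: "s \<in> {a..b}"
          have "counting t s \<le> counting (t - h) s" using s ab h h' by (intro counting_mono) auto
          moreover have "counting t s + 1 \<le> counting (t - h) s" if "s \<in> {a'..<\<mu>}"
            using d(2)[OF h(1) h'(1)] that by (auto simp: a'_def)
          ultimately show "(if s \<in> {a'..<\<mu>} then 1 else 0) \<le> real (counting (t - h) s) - real (counting t s)"
            by (cases "s \<in> {a'..<\<mu>}") force+
        qed
        also have "\<dots> = G (t - h) - G t"
          unfolding G_def using t h' by (intro Henstock_Kurzweil_Integration.integral_diff int) auto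
        finally show ?thesis .
      qed
      ultimately show ?thesis by blast
    qed
  qed blast
  show thesis
  proof (rule that[OF E(1)])
    have "(b - a) * (C * (1 + b)) / c = 16 * l * C * (1 + lam + 2 * l) / ((lam - l) * \<eta>)"
      unfolding c_def a_def b_def using l \<eta> by (simp add: field_simps)
    then show "emeasure lebesgue E \<le> ennreal (16 * l * C * (1 + lam + 2 * l) / ((lam - l) * \<eta>))"
      using E(3) by simp
  qed (use E(2) B_def in simp)
qed

end

section \<open>Calculus in the plane\<close>

text \<open>Translation invariance of Lebesgue measure makes every difference quotient integrate to
  zero; dominated convergence passes to the derivative.\<close>

lemma integral_directional_derivative_eq_0:
  fixes H :: "'a::euclidean_space \<Rightarrow> real"
  assumes diff: "\<And>x. H differentiable (at x)"
    and cont: "continuous_on UNIV (\<lambda>x. frechet_derivative H (at x) v)"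
    and supp: "\<And>x. R < norm x \<Longrightarrow> H x = 0"
  shows "(\<integral>x. frechet_derivative H (at x) v \<partial>lborel) = 0"
proof -
  let ?D = "\<lambda>x. frechet_derivative H (at x) v"
  have der: "(H has_derivative frechet_derivative H (at x)) (at x)" for x
    using diff frechet_derivative_works by blast
  have line: "((\<lambda>\<tau>. H (x + \<tau> *\<^sub>R v)) has_real_derivative ?D (x + \<tau> *\<^sub>R v)) (at \<tau>)" for x \<tau>
  proof -
    have "((\<lambda>\<tau>. H (x + \<tau> *\<^sub>R v)) has_derivative (\<lambda>h. frechet_derivative H (at (x + \<tau> *\<^sub>R v)) (h *\<^sub>R v))) (at \<tau>)"
      by (rule has_derivative_compose[of "\<lambda>\<tau>. x + \<tau> *\<^sub>R v", OF _ der]) (auto intro!: derivative_eq_intros)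
    moreover have "frechet_derivative H (at (x + \<tau> *\<^sub>R v)) (h *\<^sub>R v) = h * ?D (x + \<tau> *\<^sub>R v)" for h
      using linear_frechet_derivative[OF diff] by (simp add: linear_cmul)
    ultimately show ?thesis by (simp add: has_field_derivative_def mult_commute_abs)
  qed
  have D0: "?D x = 0" if "R < norm x" for x
  proof -
    have op: "open {x::'a. R < norm x}" by (intro open_Collect_less continuous_intros)
    have "(H has_derivative (\<lambda>_. 0)) (at x)"
    proof (rule has_derivative_transform_within_open[OF has_derivative_const op])
      show "x \<in> {x. R < norm x}" using that by simp
      show "0 = H y" if "y \<in> {x. R < norm x}" for y using supp that by simp
    qed
    from fun_cong[OF frechet_derivative_at[OF this], of v] show ?thesis by simp
  qed
  have "compact (?D ` cball 0 R)"
    by (intro compact_continuous_image continuous_on_subset[OF cont]) auto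
  then obtain B where B: "\<forall>x\<in>cball 0 R. \<bar>?D x\<bar> \<le> B"
    using compact_imp_bounded[of "?D ` cball 0 R"] by (auto simp: bounded_iff)
  \<comment> \<open>For negative R the ball is empty and \<open>B\<close> could be negative.\<close>
  define B' where "B' = max B 0"
  have B': "\<bar>?D x\<bar> \<le> B'" for x
    using bspec[OF B, of x] D0[of x] by (cases "norm x \<le> R") (auto simp: B'_def)
  define s where "s = (\<lambda>n x. (H (x + (1 / real (Suc n)) *\<^sub>R v) - H x) / (1 / real (Suc n)))"
  have cH: "continuous_on UNIV H"
    by (intro continuous_at_imp_continuous_on ballI has_derivative_continuous[OF der])
  have mH: "H \<in> borel_measurable borel" by (rule borel_measurable_continuous_onI[OF cH])
  have intH: "integrable lborel H"
  proof -
    have "integrable lborel (\<lambda>x. indicator (cball 0 R) x *\<^sub>R H x)"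
      by (rule borel_integrable_compact) (auto intro: continuous_on_subset[OF cH])
    moreover have "(\<lambda>x. indicator (cball 0 R) x *\<^sub>R H x) = H"
      using supp by (auto simp: fun_eq_iff indicator_def)
    ultimately show ?thesis by simp
  qed
  have int_shift: "integrable lborel (\<lambda>x. H (x + c))" "(\<integral>x. H (x + c) \<partial>lborel) = (\<integral>x. H x \<partial>lborel)" for c
  proof -
    have "integrable (distr lborel borel ((+) c)) H" using intH by (simp add: lborel_distr_plus)
    then show "integrable lborel (\<lambda>x. H (x + c))"
      using mH by (subst (asm) integrable_distr_eq) (auto simp: add.commute)
    have "(\<integral>x. H x \<partial>lborel) = (\<integral>x. H x \<partial>(distr lborel borel ((+) c)))" by (simp add: lborel_distr_plus)
    also have "\<dots> = (\<integral>x. H (c + x) \<partial>lborel)" using mH by (subst integral_distr) auto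
    finally show "(\<integral>x. H (x + c) \<partial>lborel) = (\<integral>x. H x \<partial>lborel)" by (simp add: add.commute)
  qed
  have s0: "(\<integral>x. s n x \<partial>lborel) = 0" for n
    unfolding s_def using int_shift intH by simp
  have "(\<lambda>n. \<integral>x. s n x \<partial>lborel) \<longlonglongrightarrow> (\<integral>x. ?D x \<partial>lborel)"
  \<comment> \<open>Translations have length at most |v|, so all quotients are supported in the ball
    of radius R + |v|; the mean value theorem bounds them by \<open>B'\<close>.\<close>
  proof (rule integral_dominated_convergence[where w = "\<lambda>x. indicator (cball 0 (R + norm v)) x *\<^sub>R B'"])
    show "?D \<in> borel_measurable lborel" using borel_measurable_continuous_onI[OF cont] by simp
    show "s n \<in> borel_measurable lborel" for n
      unfolding s_def using int_shift(1) intH by (auto intro!: borel_measurable_integrable)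
    show "integrable lborel (\<lambda>x. indicator (cball 0 (R + norm v)) x *\<^sub>R B')"
      by (rule borel_integrable_compact) auto
    show "AE x in lborel. (\<lambda>n. s n x) \<longlonglongrightarrow> ?D x"
    proof (rule AE_I2)
      fix x
      have "(\<lambda>h. (H (x + h *\<^sub>R v) - H x) / h) \<midarrow>0\<rightarrow> ?D x"
        using line[of x 0] by (simp add: DERIV_def)
      moreover have "(\<lambda>n. 1 / real (Suc n)) \<longlonglongrightarrow> 0" using LIMSEQ_inverse_real_of_nat by (simp add: inverse_eq_divide)
      ultimately show "(\<lambda>n. s n x) \<longlonglongrightarrow> ?D x"
        unfolding s_def by (intro LIMSEQ_SEQ_conv[THEN iffD2, rule_format]) auto
    qed
    show "AE x in lborel. norm (s n x) \<le> indicator (cball 0 (R + norm v)) x *\<^sub>R B'" for n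
    proof (rule AE_I2)
      fix x
      let ?h = "1 / real (Suc n)"
      have h: "0 < ?h" "?h \<le> 1" by auto
      show "norm (s n x) \<le> indicator (cball 0 (R + norm v)) x *\<^sub>R B'"
      proof (cases "x \<in> cball 0 (R + norm v)")
        case True
        obtain z where "H (x + ?h *\<^sub>R v) - H (x + 0 *\<^sub>R v) = (?h - 0) * ?D (x + z *\<^sub>R v)"
          using MVT2[OF h(1), of "\<lambda>\<tau>. H (x + \<tau> *\<^sub>R v)" "\<lambda>\<tau>. ?D (x + \<tau> *\<^sub>R v)"] line by blast
        then have "s n x = ?D (x + z *\<^sub>R v)" by (simp add: s_def)
        then show ?thesis using B' True by simp
      next
        case False
        have "norm x \<le> norm (x + ?h *\<^sub>R v) + norm (?h *\<^sub>R v)"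
          using norm_triangle_ineq4[of "x + ?h *\<^sub>R v" "?h *\<^sub>R v"] by simp
        also have "norm (?h *\<^sub>R v) \<le> norm v" using mult_right_mono[OF h(2) norm_ge_zero[of v]] by simp
        finally have "R < norm (x + ?h *\<^sub>R v)" using False by simp
        moreover have "R < norm x" using False norm_ge_zero[of v] by (simp del: norm_ge_zero)
        ultimately show ?thesis using False supp by (simp add: s_def)
      qed
    qed
  qed
  then show ?thesis using s0 by (simp add: LIMSEQ_const_iff)
qed

section \<open>The Poincare inequality on pairs of reals\<close>

text \<open>The fundamental theorem of calculus followed by Cauchy-Schwarz; the latter appears as
  nonnegativity of the variance of |p'| about its mean \<open>m\<close>.\<close>

lemma diff_squared_le_integral_derivative:
  fixes p :: "real \<Rightarrow> real"
  assumes der: "\<And>x. x \<in> {a..b} \<Longrightarrow> (p has_real_derivative p' x) (at x within {a..b})"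
    and cont: "continuous_on {a..b} p'" and xy: "x \<in> {a..b}" "y \<in> {a..b}" and "a < b"
  shows "(p x - p y)\<^sup>2 \<le> (b - a) * integral {a..b} (\<lambda>s. (p' s)\<^sup>2)"
proof -
  have main: "(p x - p y)\<^sup>2 \<le> (b - a) * integral {a..b} (\<lambda>s. (p' s)\<^sup>2)"
    if xy: "a \<le> y" "y \<le> x" "x \<le> b" for x y
  proof -
    have ia: "(\<lambda>s. \<bar>p' s\<bar>) integrable_on {a..b}" "(\<lambda>s. (p' s)\<^sup>2) integrable_on {a..b}"
      by (intro integrable_continuous_interval continuous_intros cont)+
    have "(p' has_integral (p x - p y)) {y..x}"
      using xy der unfolding has_real_derivative_iff_has_vector_derivative
      by (intro fundamental_theorem_of_calculus)
        (auto intro: has_vector_derivative_within_subset[of p _ _ "{a..b}"])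
    then have "\<bar>p x - p y\<bar> = \<bar>integral {y..x} p'\<bar>" by (simp add: integral_unique)
    also have "\<dots> \<le> integral {y..x} (\<lambda>s. \<bar>p' s\<bar>)"
    proof -
      have "p' integrable_on {y..x}" "(\<lambda>s. \<bar>p' s\<bar>) integrable_on {y..x}"
        using xy by (intro integrable_continuous_interval continuous_intros continuous_on_subset[OF cont]; auto)+
      then show ?thesis using integral_norm_bound_integral[of p' "{y..x}" "\<lambda>s. \<bar>p' s\<bar>"] by simp
    qed
    also have "\<dots> \<le> integral {a..b} (\<lambda>s. \<bar>p' s\<bar>)"
      using xy ia by (intro integral_subset_le integrable_subinterval_real[OF ia(1)]) auto
    finally have 1: "\<bar>p x - p y\<bar> \<le> integral {a..b} (\<lambda>s. \<bar>p' s\<bar>)" .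
    define m where "m = integral {a..b} (\<lambda>s. \<bar>p' s\<bar>) / (b - a)"
    have m: "integral {a..b} (\<lambda>s. \<bar>p' s\<bar>) = m * (b - a)" using \<open>a < b\<close> by (simp add: m_def)
    have "0 \<le> integral {a..b} (\<lambda>s. (\<bar>p' s\<bar> - m)\<^sup>2)"
      by (intro integral_nonneg integrable_continuous_interval continuous_intros cont) auto
    also have "\<dots> = integral {a..b} (\<lambda>s. (p' s)\<^sup>2 - 2 * m * \<bar>p' s\<bar> + m\<^sup>2)"
      by (intro integral_cong) (simp add: power2_diff)
    also have "\<dots> = integral {a..b} (\<lambda>s. (p' s)\<^sup>2) - 2 * m * integral {a..b} (\<lambda>s. \<bar>p' s\<bar>) + m\<^sup>2 * (b - a)"
    proof (rule integral_unique)
      have "((\<lambda>s. m\<^sup>2) has_integral m\<^sup>2 * (b - a)) {a..b}"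
        using has_integral_const_real[of "m\<^sup>2" a b] \<open>a < b\<close> by (simp add: mult.commute)
      then show "((\<lambda>s. (p' s)\<^sup>2 - 2 * m * \<bar>p' s\<bar> + m\<^sup>2) has_integral integral {a..b} (\<lambda>s. (p' s)\<^sup>2) -
          2 * m * integral {a..b} (\<lambda>s. \<bar>p' s\<bar>) + m\<^sup>2 * (b - a)) {a..b}"
        by (intro has_integral_add has_integral_diff has_integral_mult_right integrable_integral ia)
    qed
    also have "\<dots> = integral {a..b} (\<lambda>s. (p' s)\<^sup>2) - m\<^sup>2 * (b - a)"
      unfolding m by (simp add: power2_eq_square)
    finally have "m\<^sup>2 * (b - a) \<le> integral {a..b} (\<lambda>s. (p' s)\<^sup>2)" by simp
    then have "(b - a) * (m\<^sup>2 * (b - a)) \<le> (b - a) * integral {a..b} (\<lambda>s. (p' s)\<^sup>2)"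
      using \<open>a < b\<close> by (intro mult_left_mono) auto
    moreover have "(p x - p y)\<^sup>2 \<le> (m * (b - a))\<^sup>2"
      using power_mono[OF 1[unfolded m] abs_ge_zero, of 2] by simp
    ultimately show ?thesis by (simp add: power2_eq_square mult_ac)
  qed
  show ?thesis
  proof (cases "y \<le> x")
    case True then show ?thesis using main xy by auto
  next
    case False then show ?thesis using main[of x y] xy by (simp add: power2_commute)
  qed
qed

text \<open>Going from p to q first horizontally and then vertically bounds (W p - W q)^2 by the
  energies on one horizontal and one vertical segment. Integrated over all pairs (p, q), the left
  side becomes 2 h^2 times the integral of W^2, because the mean vanishes.\<close>

lemma poincare_square_prod:
  fixes W :: "real \<times> real \<Rightarrow> real"
  assumes h: "0 < h" and Q: "Q = cbox (a, b) (a + h, b + h)"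
    and c: "continuous_on Q W" "continuous_on Q W1" "continuous_on Q W2"
    and d1: "\<And>x y. x \<in> {a..a+h} \<Longrightarrow> y \<in> {b..b+h} \<Longrightarrow> ((\<lambda>s. W (s, y)) has_real_derivative W1 (x, y)) (at x)"
    and d2: "\<And>x y. x \<in> {a..a+h} \<Longrightarrow> y \<in> {b..b+h} \<Longrightarrow> ((\<lambda>s. W (x, s)) has_real_derivative W2 (x, y)) (at y)"
    and mean: "integral Q W = 0"
  shows "integral Q (\<lambda>p. (W p)\<^sup>2) \<le> h\<^sup>2 * integral Q (\<lambda>p. (W1 p)\<^sup>2 + (W2 p)\<^sup>2)"
proof -
  define X Y where "X = {a..a+h}" and "Y = {b..b+h}"
  have Qeq: "Q = X \<times> Y" "Q = cbox (a, b) (a + h, b + h)" unfolding Q X_def Y_def cbox_Pair_eq by auto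
  have XY: "X = cbox a (a+h)" "Y = cbox b (b+h)" by (auto simp: X_def Y_def)
  have intQ: "g integrable_on Q" if "continuous_on Q g" for g :: "real \<times> real \<Rightarrow> real"
    using that unfolding Q by (rule integrable_continuous)
  have fub: "integral Q g = integral X (\<lambda>x. integral Y (\<lambda>y. g (x, y)))"
    "integral Q g = integral Y (\<lambda>y. integral X (\<lambda>x. g (x, y)))" if "continuous_on Q g" for g :: "real \<times> real \<Rightarrow> real"
  proof -
    show 1: "integral Q g = integral X (\<lambda>x. integral Y (\<lambda>y. g (x, y)))"
      unfolding Q XY using that by (intro integral_prod_continuous) (simp add: Q)
    have "continuous_on (cbox (a, b) (a + h, b + h)) (\<lambda>(x, y). g (x, y))" using that by (simp add: Q)
    then show "integral Q g = integral Y (\<lambda>y. integral X (\<lambda>x. g (x, y)))"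
      unfolding 1 XY by (rule integral_swap_continuous)
  qed
  have areaQ: "integral Q (\<lambda>p. k) = k * h\<^sup>2" for k :: real
  proof -
    have "integral Q (\<lambda>p. k) = integral X (\<lambda>x. integral Y (\<lambda>y. k))" by (rule fub) auto
    then show ?thesis using h by (simp add: X_def Y_def power2_eq_square)
  qed
  \<comment> \<open>Energy on the horizontal segment at height y; \<open>B\<close> is the energy on
    the vertical segment at x.\<close>
  define A where "A = (\<lambda>y. integral X (\<lambda>x. (W1 (x, y))\<^sup>2))"
  define B where "B = (\<lambda>x. integral Y (\<lambda>y. (W2 (x, y))\<^sup>2))"
  have cA: "continuous_on Y A"
  proof -
    have "continuous_on (Y \<times> X) (\<lambda>p. (W1 (snd p, fst p))\<^sup>2)"
      by (intro continuous_on_power continuous_on_compose2[OF c(2)] continuous_on_Pair continuous_on_fst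
          continuous_on_snd continuous_on_id) (auto simp: Qeq(1))
    then show ?thesis
      unfolding A_def XY by (intro integral_continuous_on_param) (simp add: case_prod_beta)
  qed
  have cB: "continuous_on X B"
  proof -
    have "continuous_on (X \<times> Y) (\<lambda>p. (W2 (fst p, snd p))\<^sup>2)"
      by (intro continuous_on_power continuous_on_compose2[OF c(3)] continuous_on_Pair continuous_on_fst
          continuous_on_snd continuous_on_id) (auto simp: Qeq(1))
    then show ?thesis
      unfolding B_def XY by (intro integral_continuous_on_param) (simp add: case_prod_beta)
  qed
  have cA': "continuous_on Q (\<lambda>p. A (snd p))"
    by (rule continuous_on_compose2[OF cA _ ]) (auto simp: Qeq(1) continuous_on_snd)
  have cB': "continuous_on Q (\<lambda>p. B (fst p))"
    by (rule continuous_on_compose2[OF cB _ ]) (auto simp: Qeq(1) continuous_on_fst)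
  have c2: "continuous_on Q (\<lambda>p. (W p)\<^sup>2)" "continuous_on Q (\<lambda>p. (W1 p)\<^sup>2)" "continuous_on Q (\<lambda>p. (W2 p)\<^sup>2)"
    using c by (auto intro!: continuous_intros)
  define I1 where "I1 = integral Q (\<lambda>p. (W1 p)\<^sup>2)"
  define I2 where "I2 = integral Q (\<lambda>p. (W2 p)\<^sup>2)"
  define I where "I = integral Q (\<lambda>p. (W p)\<^sup>2)"
  have IA: "integral Q (\<lambda>p. A (snd p)) = h * I1"
  proof -
    have "integral Q (\<lambda>p. A (snd p)) = integral X (\<lambda>x. integral Y A)" using fub(1)[OF cA'] by simp
    also have "integral Y A = I1" unfolding I1_def A_def using fub(2)[OF c2(2)] by simp
    finally show ?thesis using h by (simp add: X_def)
  qed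
  have IB: "integral Q (\<lambda>p. B (fst p)) = h * I2"
  proof -
    have "integral Q (\<lambda>p. B (fst p)) = integral Y (\<lambda>y. integral X B)" using fub(2)[OF cB'] by simp
    also have "integral X B = I2" unfolding I2_def B_def using fub(1)[OF c2(3)] by simp
    finally show ?thesis using h by (simp add: Y_def)
  qed
  have pt: "(W p - W q)\<^sup>2 \<le> 2 * h * A (snd p) + 2 * h * B (fst q)" if "p \<in> Q" "q \<in> Q" for p q
  proof -
    obtain x y x' y' where pq: "p = (x, y)" "q = (x', y')" "x \<in> X" "y \<in> Y" "x' \<in> X" "y' \<in> Y"
      using \<open>p \<in> Q\<close> \<open>q \<in> Q\<close> Qeq by auto
    have cont1: "continuous_on {a..a+h} (\<lambda>s. W1 (s, y))"
      by (rule continuous_on_compose2[OF c(2)])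
        (use pq in \<open>auto simp: X_def Y_def Qeq(1) intro!: continuous_on_Pair continuous_on_id continuous_on_const\<close>)
    have cont2: "continuous_on {b..b+h} (\<lambda>s. W2 (x', s))"
      by (rule continuous_on_compose2[OF c(3)])
        (use pq in \<open>auto simp: X_def Y_def Qeq(1) intro!: continuous_on_Pair continuous_on_id continuous_on_const\<close>)
    have "(W (x, y) - W (x', y))\<^sup>2 \<le> (a + h - a) * integral {a..a+h} (\<lambda>s. (W1 (s, y))\<^sup>2)"
      by (rule diff_squared_le_integral_derivative[where p = "\<lambda>s. W (s, y)", OF _ cont1])
        (use pq h in \<open>auto simp: X_def Y_def intro!: has_field_derivative_at_within[OF d1]\<close>)
    then have 1: "(W (x, y) - W (x', y))\<^sup>2 \<le> h * A y" by (simp add: A_def X_def)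
    have "(W (x', y) - W (x', y'))\<^sup>2 \<le> (b + h - b) * integral {b..b+h} (\<lambda>s. (W2 (x', s))\<^sup>2)"
      by (rule diff_squared_le_integral_derivative[where p = "\<lambda>s. W (x', s)", OF _ cont2])
        (use pq h in \<open>auto simp: X_def Y_def intro!: has_field_derivative_at_within[OF d2]\<close>)
    then have 2: "(W (x', y) - W (x', y'))\<^sup>2 \<le> h * B x'" by (simp add: B_def Y_def)
    have "(W (x, y) - W (x', y'))\<^sup>2 \<le> 2 * (W (x, y) - W (x', y))\<^sup>2 + 2 * (W (x', y) - W (x', y'))\<^sup>2"
      using zero_le_power2[of "(W (x, y) - W (x', y)) - (W (x', y) - W (x', y'))"]
      by (simp add: power2_eq_square algebra_simps)
    then show ?thesis using 1 2 pq by simp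
  qed
  \<comment> \<open>Integration over q; the cross term carries the factor
    \<open>integral Q W\<close> and drops out.\<close>
  have step: "(W p)\<^sup>2 * h\<^sup>2 + I \<le> 2 * h * A (snd p) * h\<^sup>2 + 2 * h * (h * I2)" if p: "p \<in> Q" for p
  proof -
    have "(W p)\<^sup>2 * h\<^sup>2 - 2 * W p * integral Q W + I = integral Q (\<lambda>q. (W p)\<^sup>2 - 2 * W p * W q + (W q)\<^sup>2)"
      unfolding I_def areaQ[symmetric]
      by (subst Henstock_Kurzweil_Integration.integral_add integral_diff integral_mult_right;
          (intro intQ continuous_intros c)?; simp)+
    also have "\<dots> = integral Q (\<lambda>q. (W p - W q)\<^sup>2)"
      by (intro integral_cong) (simp add: power2_diff)
    also have "\<dots> \<le> integral Q (\<lambda>q. 2 * h * A (snd p) + 2 * h * B (fst q))"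
      by (intro integral_le intQ continuous_intros c cB' pt p)
    also have "\<dots> = 2 * h * A (snd p) * h\<^sup>2 + 2 * h * (h * I2)"
      unfolding IB[symmetric] areaQ[symmetric]
      by (subst Henstock_Kurzweil_Integration.integral_add; (intro intQ continuous_intros cB')?; simp)
    finally show ?thesis using mean by simp
  qed
  have "I * h\<^sup>2 + I * h\<^sup>2 = integral Q (\<lambda>p. (W p)\<^sup>2 * h\<^sup>2 + I)"
    unfolding areaQ[symmetric, of I] I_def
    by (subst Henstock_Kurzweil_Integration.integral_add; (intro intQ continuous_intros c)?; simp add: areaQ)
  also have "\<dots> \<le> integral Q (\<lambda>p. 2 * h * A (snd p) * h\<^sup>2 + 2 * h * (h * I2))"
    by (intro integral_le intQ continuous_intros c cA' step)
  also have "\<dots> = integral Q (\<lambda>p. (2 * h * h\<^sup>2) * A (snd p)) + integral Q (\<lambda>p. 2 * h * (h * I2))"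
    by (subst Henstock_Kurzweil_Integration.integral_add[symmetric])
      (intro intQ continuous_intros cA' | simp add: mult_ac)+
  also have "\<dots> = 2 * h * (h * I1) * h\<^sup>2 + 2 * h * (h * I2) * h\<^sup>2"
    unfolding areaQ integral_mult_right IA by simp
  finally have "(h\<^sup>2 * 2) * I \<le> (h\<^sup>2 * 2) * (h\<^sup>2 * (I1 + I2))"
    by (simp add: power2_eq_square algebra_simps)
  then have "I \<le> h\<^sup>2 * (I1 + I2)" using h by (simp add: mult_le_cancel_left)
  moreover have "I1 + I2 = integral Q (\<lambda>p. (W1 p)\<^sup>2 + (W2 p)\<^sup>2)"
    unfolding I1_def I2_def by (intro Henstock_Kurzweil_Integration.integral_add[symmetric] intQ c2)
  ultimately show ?thesis by (simp add: I_def)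
qed

section \<open>Linear algebra of a metric and its inverse\<close>

lemma ex_2: "(\<exists>i::2. P i) \<longleftrightarrow> P 1 \<or> P 2"
  using forall_2[of "\<lambda>i. \<not> P i"] by blast

lemma matrix_inv_works:
  fixes A :: "real^'n^'n"
  assumes "invertible A"
  shows matrix_inv_right: "A ** matrix_inv A = mat 1" and matrix_inv_left: "matrix_inv A ** A = mat 1"
  using someI_ex[OF assms[unfolded invertible_def]] unfolding matrix_inv_def by auto

lemma matrix_inv_unique:
  fixes A :: "real^'n^'n"
  assumes "A ** B = mat 1" "B ** A = mat 1"
  shows "matrix_inv A = B"
proof -
  have "invertible A" using assms invertible_def by blast
  then have "matrix_inv A ** A ** B = B" by (simp add: matrix_inv_left)
  then show ?thesis using assms(1) by (simp flip: matrix_mul_assoc)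
qed

text \<open>In the index type \<open>2\<close> the map i \<mapsto> 3 - i swaps the two indices, so
  this is the adjugate divided by the determinant.\<close>

lemma matrix_inv_2x2:
  fixes G :: "real^2^2"
  assumes "det G \<noteq> 0"
  shows "matrix_inv G = (\<chi> i j. (if i = j then G $ (3 - i) $ (3 - j) else - G $ i $ j) / det G)"
    (is "_ = ?B")
proof -
  obtain D where D: "det G = D" and d: "D \<noteq> 0" and eq: "D = G$1$1 * G$2$2 - G$1$2 * G$2$1"
    using assms by (auto simp: det_2)
  have n: "3 - 1 = (2::2)" "3 - 2 = (1::2)" by (simp_all add: numeral_3_eq_3)
  have B: "?B $ 1 $ 1 = G$2$2 / det G" "?B $ 2 $ 2 = G$1$1 / det G"
    "?B $ 1 $ 2 = - G$1$2 / det G" "?B $ 2 $ 1 = - G$2$1 / det G"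
    by (simp_all add: n)
  have "G ** ?B = mat 1" "?B ** G = mat 1"
    unfolding vec_eq_iff forall_2 matrix_matrix_mult_def mat_def sum_2 vec_lambda_beta B[unfolded vec_lambda_beta]
    using d eq unfolding D by (auto simp: divide_simps n)
  then show ?thesis by (rule matrix_inv_unique)
qed

text \<open>The determinant is tested on w = (G12, -G11), where the form equals G11 det G. The bound
  on the inverse says that no eigenvalue of \<open>G\<close> exceeds its trace; after multiplication
  by det G the defect is the squared norm of adj(G) v.\<close>

lemma posdef_2x2:
  fixes G :: "real^2^2"
  assumes sym: "transpose G = G" and pos: "\<And>v. v \<noteq> 0 \<Longrightarrow> v \<bullet> (G *v v) > 0"
  shows posdef_2x2_det: "det G > 0" and posdef_2x2_trace: "G$1$1 + G$2$2 > 0"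
    and posdef_2x2_inv: "(norm v)\<^sup>2 \<le> (G$1$1 + G$2$2) * (v \<bullet> (matrix_inv G *v v))"
    and "matrix_inv G $ 1 $ 2 = matrix_inv G $ 2 $ 1"
proof -
  have s: "G$2$1 = G$1$2" using arg_cong[OF sym, of "\<lambda>m. m $ 2 $ 1"] by (simp add: transpose_def)
  have g1: "G$1$1 > 0" using pos[of "axis 1 1"]
    by (simp add: inner_vec_def sum_2 matrix_vector_mult_def axis_def vec_eq_iff ex_2)
  have g2: "G$2$2 > 0" using pos[of "axis 2 1"]
    by (simp add: inner_vec_def sum_2 matrix_vector_mult_def axis_def vec_eq_iff ex_2)
  define w :: "real^2" where "w = (\<chi> i. if i = 1 then G$1$2 else - G$1$1)"
  have "w \<noteq> 0" using g1 by (auto simp: w_def vec_eq_iff ex_2 forall_2)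
  then have "0 < w \<bullet> (G *v w)" by (rule pos)
  also have "\<dots> = G$1$1 * det G"
    by (simp add: w_def inner_vec_def sum_2 matrix_vector_mult_def det_2 s algebra_simps)
  finally show d: "det G > 0" using g1 by (simp add: zero_less_mult_iff)
  show "G$1$1 + G$2$2 > 0" using g1 g2 by simp
  have n: "3 - 1 = (2::2)" "3 - 2 = (1::2)" by (simp_all add: numeral_3_eq_3)
  show "matrix_inv G $ 1 $ 2 = matrix_inv G $ 2 $ 1"
    using d by (simp add: matrix_inv_2x2 s)
  have "(G$1$1 + G$2$2) * (v \<bullet> (matrix_inv G *v v)) * det G - (norm v)\<^sup>2 * det G
     = (G$2$2 * v$1 - G$1$2 * v$2)\<^sup>2 + (G$1$2 * v$1 - G$1$1 * v$2)\<^sup>2"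
  proof -
    have 1: "(v \<bullet> (matrix_inv G *v v)) * det G = G$2$2 * (v$1)\<^sup>2 - 2 * G$1$2 * v$1 * v$2 + G$1$1 * (v$2)\<^sup>2"
      using d by (simp add: matrix_inv_2x2 inner_vec_def sum_2 matrix_vector_mult_def n s power2_eq_square field_simps)
    have 2: "(norm v)\<^sup>2 = (v$1)\<^sup>2 + (v$2)\<^sup>2"
      unfolding power2_norm_eq_inner by (simp add: inner_vec_def sum_2 power2_eq_square)
    show ?thesis
      unfolding mult.assoc 1 2 by (simp add: det_2 s power2_eq_square algebra_simps)
  qed
  then have "(norm v)\<^sup>2 * det G \<le> (G$1$1 + G$2$2) * (v \<bullet> (matrix_inv G *v v)) * det G"
    using zero_le_power2[of "G$2$2 * v$1 - G$1$2 * v$2"] zero_le_power2[of "G$1$2 * v$1 - G$1$1 * v$2"] by linarith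
  then show "(norm v)\<^sup>2 \<le> (G$1$1 + G$2$2) * (v \<bullet> (matrix_inv G *v v))"
    using d by simp
qed

text \<open>Differentials transform by the transposed Jacobian, so this is the coordinate
  independence of the inner product of two covectors. With y = Gc^{-1} J^T b, cancelling J^T shows
  Gd (J y) = b.\<close>

lemma cometric_transform:
  fixes J :: "real^'n^'n" and Gc Gd :: "real^'n^'n"
  assumes Gc: "Gc = transpose J ** Gd ** J" and "det Gc \<noteq> 0"
  shows "(transpose J *v a) \<bullet> (matrix_inv Gc *v (transpose J *v b)) = a \<bullet> (matrix_inv Gd *v b)"
proof -
  have "det J \<noteq> 0" "det Gd \<noteq> 0" using assms by (auto simp: det_mul)
  then have inv: "invertible Gc" "invertible J" "invertible Gd" "invertible (transpose J)"
    using assms(2) by (auto simp: invertible_det_nz)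
  define y where "y = matrix_inv Gc *v (transpose J *v b)"
  have "Gc *v y = transpose J *v b"
    unfolding y_def by (simp add: matrix_vector_mul_assoc matrix_mul_assoc matrix_inv_right inv)
  then have "transpose J *v (Gd *v (J *v y)) = transpose J *v b"
    by (simp add: Gc matrix_vector_mul_assoc matrix_mul_assoc)
  then have "matrix_inv (transpose J) *v (transpose J *v (Gd *v (J *v y))) = matrix_inv (transpose J) *v (transpose J *v b)"
    by simp
  then have "Gd *v (J *v y) = b"
    by (simp only: matrix_vector_mul_assoc matrix_mul_assoc matrix_inv_left[OF inv(4)] matrix_mul_lid matrix_vector_mul_lid)
  then have "matrix_inv Gd *v (Gd *v (J *v y)) = matrix_inv Gd *v b" by simp
  then have "J *v y = matrix_inv Gd *v b"
    by (simp only: matrix_vector_mul_assoc matrix_mul_assoc matrix_inv_left[OF inv(3)] matrix_mul_lid matrix_vector_mul_lid)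
  then show ?thesis unfolding y_def[symmetric]
    using dot_lmul_matrix[of a J y] by (simp add: transpose_matrix_vector)
qed

section \<open>Gradients and functions of class C1\<close>

definition grad :: "(real^2 \<Rightarrow> real) \<Rightarrow> real^2 \<Rightarrow> real^2" where
  "grad F x = (\<chi> i. partial_deriv i F x)"

lemma grad_unique:
  assumes "(F has_derivative (\<lambda>v. a \<bullet> v)) (at x)"
  shows "grad F x = a"
  using frechet_derivative_at[OF assms, symmetric]
  by (simp add: grad_def partial_deriv_def inner_axis vec_eq_iff)

lemma has_derivative_grad:
  assumes "F differentiable (at x)"
  shows "(F has_derivative (\<lambda>v. grad F x \<bullet> v)) (at x)"
proof -
  have lin: "linear (frechet_derivative F (at x))" by (rule linear_frechet_derivative[OF assms])
  have "frechet_derivative F (at x) v = grad F x \<bullet> v" for v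
  proof -
    have "frechet_derivative F (at x) v = frechet_derivative F (at x) (\<Sum>i\<in>UNIV. v $ i *\<^sub>R axis i 1)"
      by (simp add: basis_expansion scalar_mult_eq_scaleR[symmetric])
    also have "\<dots> = grad F x \<bullet> v"
      by (simp add: linear_sum[OF lin] linear_cmul[OF lin] grad_def partial_deriv_def inner_vec_def mult.commute)
    finally show ?thesis .
  qed
  then have "frechet_derivative F (at x) = (\<lambda>v. grad F x \<bullet> v)" by blast
  then show ?thesis using assms unfolding frechet_derivative_works by simp
qed

text \<open>With \<open>at x\<close> instead of \<open>at x within S\<close>, a function on a closed
  square is differentiable at boundary points as a function on the plane; restriction from a chart
  image supplies this.\<close>

definition C1_on :: "(real^2) set \<Rightarrow> (real^2 \<Rightarrow> real) \<Rightarrow> bool" where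
  "C1_on S F \<longleftrightarrow> (\<forall>x\<in>S. F differentiable (at x)) \<and> continuous_on S (grad F)"

lemma C1_onI:
  assumes "\<And>x. x \<in> S \<Longrightarrow> (F has_derivative (\<lambda>v. G x \<bullet> v)) (at x)" "continuous_on S G"
  shows "C1_on S F"
proof -
  have "grad F x = G x" if "x \<in> S" for x using grad_unique assms that by blast
  then have "continuous_on S (grad F)" using assms(2) by (simp cong: continuous_on_cong)
  then show ?thesis using assms(1) unfolding C1_on_def differentiable_def by blast
qed

lemma C1_onD:
  assumes "C1_on S F"
  shows "x \<in> S \<Longrightarrow> (F has_derivative (\<lambda>v. grad F x \<bullet> v)) (at x)" "continuous_on S (grad F)"
    "continuous_on S F"
proof -
  show d: "(F has_derivative (\<lambda>v. grad F x \<bullet> v)) (at x)" if "x \<in> S" for x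
    using assms that by (auto simp: C1_on_def intro: has_derivative_grad)
  show "continuous_on S (grad F)" using assms by (simp add: C1_on_def)
  show "continuous_on S F"
    by (intro continuous_at_imp_continuous_on ballI has_derivative_continuous[OF d])
qed

lemma C1_on_subset: "C1_on S F \<Longrightarrow> T \<subseteq> S \<Longrightarrow> C1_on T F"
  unfolding C1_on_def using continuous_on_subset by blast

lemma grad_cong:
  assumes "open S" "x \<in> S" "\<And>y. y \<in> S \<Longrightarrow> F y = H y" "F differentiable (at x)"
  shows "grad H x = grad F x" "H differentiable (at x)"
proof -
  have "(H has_derivative (\<lambda>v. grad F x \<bullet> v)) (at x)"
    using has_derivative_transform_within_open[OF has_derivative_grad[OF assms(4)] assms(1,2)] assms(3) by blast
  then show "grad H x = grad F x" "H differentiable (at x)"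
    using grad_unique unfolding differentiable_def by blast+
qed

lemma C1_on_cong:
  assumes "open S" "\<And>y. y \<in> S \<Longrightarrow> F y = H y" "C1_on S F"
  shows "C1_on S H"
proof (rule C1_onI)
  show "(H has_derivative (\<lambda>v. grad F x \<bullet> v)) (at x)" if "x \<in> S" for x
    using has_derivative_transform_within_open[OF C1_onD(1)[OF assms(3) that] assms(1) that] assms(2) by blast
qed (rule C1_onD[OF assms(3)])

lemma C1_on_local:
  assumes "\<And>x. x \<in> S \<Longrightarrow> \<exists>U. open U \<and> x \<in> U \<and> C1_on U F"
  shows "C1_on S F"
proof -
  have "isCont (grad F) x" if "x \<in> S" for x
    using assms[OF that] by (auto simp: C1_on_def continuous_on_eq_continuous_at)
  moreover have "F differentiable (at x)" if "x \<in> S" for x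
    using assms[OF that] by (auto simp: C1_on_def)
  ultimately show ?thesis
    unfolding C1_on_def by (auto intro: continuous_at_imp_continuous_on)
qed

lemma C1_on_const: "C1_on S (\<lambda>_. k)"
  by (rule C1_onI[of _ _ "\<lambda>_. 0"]) auto

lemma C1_on_add:
  assumes "C1_on S F" "C1_on S H"
  shows "C1_on S (\<lambda>x. F x + H x)"
  by (rule C1_onI[of _ _ "\<lambda>x. grad F x + grad H x"])
    (auto intro!: derivative_eq_intros C1_onD(1)[OF assms(1)] C1_onD(1)[OF assms(2)] continuous_intros C1_onD assms
      simp: inner_add_left)

lemma grad_add:
  assumes "F differentiable (at x)" "H differentiable (at x)"
  shows "grad (\<lambda>x. F x + H x) x = grad F x + grad H x"
  by (rule grad_unique)
    (auto intro!: derivative_eq_intros has_derivative_grad assms simp: inner_add_left)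

lemma grad_cmul:
  assumes "F differentiable (at x)"
  shows "grad (\<lambda>x. a * F x) x = a *\<^sub>R grad F x"
  by (rule grad_unique)
    (auto intro!: derivative_eq_intros has_derivative_grad assms)

lemma grad_mult:
  assumes "F differentiable (at x)" "H differentiable (at x)"
  shows "grad (\<lambda>x. F x * H x) x = F x *\<^sub>R grad H x + H x *\<^sub>R grad F x"
  by (rule grad_unique)
    (auto intro!: derivative_eq_intros has_derivative_grad assms simp: inner_add_left)

lemma C1_on_mult:
  assumes "C1_on S F" "C1_on S H"
  shows "C1_on S (\<lambda>x. F x * H x)"
  by (rule C1_onI[of _ _ "\<lambda>x. F x *\<^sub>R grad H x + H x *\<^sub>R grad F x"])
    (auto intro!: derivative_eq_intros C1_onD(1)[OF assms(1)] C1_onD(1)[OF assms(2)] continuous_intros C1_onD assms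
      simp: inner_add_left)

lemma C1_on_sum: "(\<And>i. i \<in> I \<Longrightarrow> C1_on S (F i)) \<Longrightarrow> C1_on S (\<lambda>x. \<Sum>i\<in>I. F i x)"
  by (induction I rule: infinite_finite_induct) (auto intro: C1_on_const C1_on_add)

lemma C1_on_chain:
  assumes "C1_on S F" "\<And>x. x \<in> S \<Longrightarrow> (p has_real_derivative p' (F x)) (at (F x))"
    "continuous_on (F ` S) p'"
  shows "C1_on S (\<lambda>x. p (F x))"
proof (rule C1_onI)
  fix x assume x: "x \<in> S"
  have "((\<lambda>x. p (F x)) has_derivative (\<lambda>v. p' (F x) * (grad F x \<bullet> v))) (at x)"
    using has_derivative_compose[OF C1_onD(1)[OF assms(1) x] assms(2)[OF x, unfolded has_field_derivative_def]] .
  then show "((\<lambda>x. p (F x)) has_derivative (\<lambda>v. (p' (F x) *\<^sub>R grad F x) \<bullet> v)) (at x)" by simp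
next
  show "continuous_on S (\<lambda>x. p' (F x) *\<^sub>R grad F x)"
    by (intro continuous_on_scaleR C1_onD(2)[OF assms(1)] continuous_on_compose2[OF assms(3) C1_onD(3)[OF assms(1)]]) auto
qed

lemma C1_on_divide:
  assumes "C1_on S F" "C1_on S H" "\<And>x. x \<in> S \<Longrightarrow> H x \<noteq> 0"
  shows "C1_on S (\<lambda>x. F x / H x)"
proof -
  have "C1_on S (\<lambda>x. inverse (H x))"
    by (rule C1_on_chain[where p = inverse and p' = "\<lambda>y. - (inverse y * inverse y)"])
      (use assms in \<open>auto intro!: assms derivative_eq_intros continuous_intros simp: power2_eq_square\<close>)
  then show ?thesis using C1_on_mult[OF assms(1)] by (simp add: divide_inverse)
qed

lemma C1_on_sqrt:
  assumes "C1_on S F" "\<And>x. x \<in> S \<Longrightarrow> 0 < F x"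
  shows "C1_on S (\<lambda>x. sqrt (F x))"
  by (rule C1_on_chain[where p = sqrt and p' = "\<lambda>y. inverse (sqrt y) / 2"])
    (use assms in \<open>force intro!: assms DERIV_real_sqrt continuous_intros\<close>)+

lemma grad_compose:
  assumes "(\<tau> has_derivative \<tau>') (at x)" "F differentiable (at (\<tau> x))"
  shows "grad (\<lambda>x. F (\<tau> x)) x = transpose (matrix \<tau>') *v grad F (\<tau> x)"
proof (rule grad_unique)
  have "((\<lambda>x. F (\<tau> x)) has_derivative (\<lambda>v. grad F (\<tau> x) \<bullet> \<tau>' v)) (at x)"
    by (rule has_derivative_compose[OF assms(1) has_derivative_grad[OF assms(2)]])
  moreover have "\<tau>' v = matrix \<tau>' *v v" for v
    using assms(1) by (simp add: matrix_works has_derivative_linear)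
  ultimately show "((\<lambda>x. F (\<tau> x)) has_derivative (\<lambda>v. (transpose (matrix \<tau>') *v grad F (\<tau> x)) \<bullet> v)) (at x)"
    by (simp add: dot_lmul_matrix transpose_matrix_vector)
qed

lemma C1_on_compose:
  fixes \<tau> :: "real^2 \<Rightarrow> real^2"
  assumes "C1_on T F" "Ck_on 1 S \<tau>" "\<tau> ` S \<subseteq> T"
  shows "C1_on S (\<lambda>x. F (\<tau> x))"
proof -
  have \<tau>: "\<tau> differentiable (at x)" if "x \<in> S" for x using assms(2) that by simp
  have c\<tau>: "continuous_on S (\<lambda>x. frechet_derivative \<tau> (at x) v)" for v using assms(2) by simp
  have gr: "grad (\<lambda>x. F (\<tau> x)) x = (\<chi> i. grad F (\<tau> x) \<bullet> frechet_derivative \<tau> (at x) (axis i 1))"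
    and df: "(\<lambda>x. F (\<tau> x)) differentiable (at x)" if x: "x \<in> S" for x
  proof -
    have "((\<lambda>x. F (\<tau> x)) has_derivative (\<lambda>v. grad F (\<tau> x) \<bullet> frechet_derivative \<tau> (at x) v)) (at x)"
      using \<tau>[OF x] x assms by (intro has_derivative_compose[OF _ C1_onD(1)[OF assms(1)]])
        (auto simp: frechet_derivative_works)
    note d = this
    show "grad (\<lambda>x. F (\<tau> x)) x = (\<chi> i. grad F (\<tau> x) \<bullet> frechet_derivative \<tau> (at x) (axis i 1))"
      using frechet_derivative_at[OF d, symmetric] by (simp add: grad_def partial_deriv_def)
    show "(\<lambda>x. F (\<tau> x)) differentiable (at x)" using d by (auto simp: differentiable_def)
  qed
  have "continuous_on S \<tau>" using \<tau> by (intro continuous_at_imp_continuous_on ballI differentiable_imp_continuous_within)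
  then have "continuous_on S (\<lambda>x. \<chi> i. grad F (\<tau> x) \<bullet> frechet_derivative \<tau> (at x) (axis i 1))"
    by (intro continuous_on_vec_lambda continuous_on_inner c\<tau> continuous_on_compose2[OF C1_onD(2)[OF assms(1)]] assms)
  then show ?thesis unfolding C1_on_def using gr df by (simp cong: continuous_on_cong)
qed

lemma
  assumes L: "bounded_linear (L :: 'b::real_normed_vector \<Rightarrow> real)" and F: "F differentiable (at x)"
  shows partial_deriv_bounded_linear: "partial_deriv i (\<lambda>x. L (F x)) x = L (partial_deriv i F x)"
    and differentiable_bounded_linear: "(\<lambda>x. L (F x)) differentiable (at x)"
proof -
  have "((\<lambda>x. L (F x)) has_derivative (\<lambda>v. L (frechet_derivative F (at x) v))) (at x)"
    by (rule bounded_linear.has_derivative[OF L F[unfolded frechet_derivative_works]])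
  then show "partial_deriv i (\<lambda>x. L (F x)) x = L (partial_deriv i F x)" "(\<lambda>x. L (F x)) differentiable (at x)"
    using frechet_derivative_at[of "\<lambda>x. L (F x)" _ x, symmetric] unfolding partial_deriv_def differentiable_def by auto
qed

text \<open>Serves for the matrix entries of a metric and for real and imaginary parts of
  eigenfunctions.\<close>

lemma Ck_on_1_bounded_linear:
  assumes L: "bounded_linear (L :: 'b::real_normed_vector \<Rightarrow> real)" and F: "Ck_on 1 S F"
  shows "C1_on S (\<lambda>x. L (F x))"
proof -
  have d: "F differentiable (at x)" if "x \<in> S" for x using F that by simp
  have c: "continuous_on S (\<lambda>x. partial_deriv i F x)" for i using F by (simp add: partial_deriv_def)
  have "continuous_on S (\<lambda>x. \<chi> i. L (partial_deriv i F x))"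
    by (intro continuous_on_vec_lambda bounded_linear.continuous_on[OF L] c)
  moreover have "grad (\<lambda>x. L (F x)) x = (\<chi> i. L (partial_deriv i F x))" if "x \<in> S" for x
    using partial_deriv_bounded_linear[OF L d[OF that]] by (simp add: grad_def)
  ultimately show ?thesis unfolding C1_on_def
    using differentiable_bounded_linear[OF L d] by (simp cong: continuous_on_cong)
qed

text \<open>The open sets \<Omega> and \<open>- K\<close> cover the plane, and on the second the
  extension is zero.\<close>

lemma C1_on_extend_by_zero:
  assumes "C1_on \<Omega> F" "open \<Omega>" "closed K" "K \<subseteq> \<Omega>" "\<And>x. x \<in> \<Omega> \<Longrightarrow> x \<notin> K \<Longrightarrow> F x = 0"
  shows "C1_on UNIV (\<lambda>x. if x \<in> \<Omega> then F x else 0)"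
proof (rule C1_on_local)
  fix x
  show "\<exists>U. open U \<and> x \<in> U \<and> C1_on U (\<lambda>x. if x \<in> \<Omega> then F x else 0)"
  proof (cases "x \<in> \<Omega>")
    case True
    then show ?thesis using assms(1,2) by (intro exI[of _ \<Omega>]) (auto intro: C1_on_cong)
  next
    case False
    have "C1_on (- K) (\<lambda>x. if x \<in> \<Omega> then F x else 0)"
      by (rule C1_on_cong[OF _ _ C1_on_const[of _ 0]]) (use assms in auto)
    then show ?thesis using False assms by (intro exI[of _ "- K"]) auto
  qed
qed

text \<open>Integration by parts: the integrand is the i-th derivative of the product \<psi> H
  extended by zero.\<close>

lemma integral_partial_deriv_product_eq_0:
  assumes \<psi>: "C1_on \<Omega> \<psi>" and H: "C1_on \<Omega> H" and \<Omega>: "open \<Omega>" and K: "compact K" "K \<subseteq> \<Omega>"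
    and supp: "\<And>x. x \<in> \<Omega> \<Longrightarrow> x \<notin> K \<Longrightarrow> \<psi> x = 0"
  shows "(\<integral>x. indicator \<Omega> x *\<^sub>R (\<psi> x * partial_deriv i H x + H x * partial_deriv i \<psi> x) \<partial>lborel) = 0"
proof -
  define E where "E = (\<lambda>x. if x \<in> \<Omega> then \<psi> x * H x else 0)"
  have C: "C1_on UNIV E" unfolding E_def
    by (rule C1_on_extend_by_zero[OF C1_on_mult[OF \<psi> H] \<Omega> compact_imp_closed[OF K(1)] K(2)]) (use supp in auto)
  have dE: "E differentiable (at x)" for x using C by (simp add: C1_on_def)
  obtain R where R: "\<And>x. x \<in> K \<Longrightarrow> norm x \<le> R"
    using compact_imp_bounded[OF K(1)] by (auto simp: bounded_iff)
  have "(\<integral>x. frechet_derivative E (at x) (axis i 1) \<partial>lborel) = 0"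
  proof (rule integral_directional_derivative_eq_0[of E _ R])
    show "continuous_on UNIV (\<lambda>x. frechet_derivative E (at x) (axis i 1))"
      using continuous_on_component[OF C1_onD(2)[OF C], of i] by (simp add: grad_def partial_deriv_def)
    show "E x = 0" if "R < norm x" for x using R[of x] supp that by (force simp: E_def)
  qed (rule dE)
  also have "(\<lambda>x. frechet_derivative E (at x) (axis i 1))
      = (\<lambda>x. indicator \<Omega> x *\<^sub>R (\<psi> x * partial_deriv i H x + H x * partial_deriv i \<psi> x))"
  proof
    fix x
    show "frechet_derivative E (at x) (axis i 1)
      = indicator \<Omega> x *\<^sub>R (\<psi> x * partial_deriv i H x + H x * partial_deriv i \<psi> x)"
    proof (cases "x \<in> \<Omega>")
      case True
      have d: "\<psi> differentiable (at x)" "H differentiable (at x)" using \<psi> H True by (auto simp: C1_on_def)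
      have "grad E x = grad (\<lambda>x. \<psi> x * H x) x"
        by (rule grad_cong[OF \<Omega> True]) (use d in \<open>auto simp: E_def\<close>)
      also have "\<dots> = \<psi> x *\<^sub>R grad H x + H x *\<^sub>R grad \<psi> x" by (rule grad_mult[OF d])
      finally have "grad E x $ i = (\<psi> x *\<^sub>R grad H x + H x *\<^sub>R grad \<psi> x) $ i" by simp
      then show ?thesis using True by (simp add: grad_def partial_deriv_def)
    next
      case False
      have "grad E x = grad (\<lambda>_. 0) x"
        by (rule grad_cong[of "- K"]) (use False K supp in \<open>auto simp: E_def compact_imp_closed\<close>)
      also have "\<dots> = 0" by (rule grad_unique) simp
      finally have "grad E x $ i = 0" by simp
      then show ?thesis using False by (simp add: grad_def partial_deriv_def)
    qed
  qed
  finally show ?thesis .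
qed

section \<open>Integrals over squares in the plane\<close>

text \<open>A linear isometry from pairs to plane vectors, which carries iterated integrals over to
  \<open>real^2\<close>.\<close>

definition pair_vec :: "real \<times> real \<Rightarrow> real^2" where
  "pair_vec p = fst p *\<^sub>R axis 1 1 + snd p *\<^sub>R axis 2 1"

lemma pair_vec_component [simp]: "pair_vec p $ 1 = fst p" "pair_vec p $ 2 = snd p"
  by (simp_all add: pair_vec_def axis_def)

lemma continuous_on_pair_vec: "continuous_on S pair_vec"
  unfolding pair_vec_def by (intro continuous_intros)

lemma pair_vec_vimage_cbox: "pair_vec -` cbox a b = cbox (a$1, a$2) (b$1, b$2)"
  by (auto simp: mem_box_cart forall_2 cbox_Pair_eq)

lemma lborel_eq_distr_pair_vec: "(lborel :: (real^2) measure) = distr lborel borel pair_vec"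
proof (rule lborel_eqI)
  fix l u :: "real^2" assume lu: "\<And>b. b \<in> Basis \<Longrightarrow> l \<bullet> b \<le> u \<bullet> b"
  have lu': "l $ i \<le> u $ i" for i using lu[of "axis i 1"] by (simp add: inner_axis)
  have m: "pair_vec \<in> borel_measurable lborel"
    using borel_measurable_continuous_onI[OF continuous_on_pair_vec] by simp
  have pre: "pair_vec -` box l u = box (l$1, l$2) (u$1, u$2)"
    by (auto simp: mem_box_cart forall_2 mem_box Basis_prod_def)
  have "emeasure (distr lborel borel pair_vec) (box l u) = emeasure lborel (box (l$1, l$2) (u$1, u$2))"
    using m by (subst emeasure_distr) (auto simp: pre)
  also have "\<dots> = ennreal (\<Prod>b\<in>Basis. ((u$1, u$2) - (l$1, l$2)) \<bullet> b)"
    by (rule emeasure_lborel_box) (use lu' in \<open>auto simp: Basis_prod_def\<close>)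
  also have "(\<Prod>b\<in>Basis. ((u$1, u$2) - (l$1, l$2)) \<bullet> b) = (u$1 - l$1) * (u$2 - l$2)"
  proof -
    have B: "(Basis :: (real \<times> real) set) = {(1, 0), (0, 1)}" by (auto simp: Basis_prod_def)
    show ?thesis by (simp add: B)
  qed
  also have "(u$1 - l$1) * (u$2 - l$2) = (\<Prod>b\<in>Basis. (u - l) \<bullet> b)"
  proof -
    have B: "(Basis :: (real^2) set) = {axis 1 1, axis 2 1}" by (auto simp: Basis_vec_def UNIV_2)
    have "axis 1 1 \<noteq> (axis 2 1 :: real^2)" by (simp add: axis_eq_axis)
    then show ?thesis by (simp add: B inner_axis)
  qed
  finally show "emeasure (distr lborel borel pair_vec) (box l u) = ennreal (\<Prod>b\<in>Basis. (u - l) \<bullet> b)" .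
qed simp

lemma set_integral_cbox_real2:
  fixes f :: "real^2 \<Rightarrow> real"
  assumes "continuous_on (cbox a b) f"
  shows "(LINT x:cbox a b|lborel. f x) = integral (cbox (a$1, a$2) (b$1, b$2)) (\<lambda>p. f (pair_vec p))"
proof -
  have m: "pair_vec \<in> borel_measurable lborel"
    using borel_measurable_continuous_onI[OF continuous_on_pair_vec] by simp
  have mf: "(\<lambda>x. indicator (cbox a b) x *\<^sub>R f x) \<in> borel_measurable borel"
    using assms by (intro borel_measurable_continuous_on_indicator) auto
  have "(LINT x:cbox a b|lborel. f x) = (\<integral>x. indicator (cbox a b) x *\<^sub>R f x \<partial>(distr lborel borel pair_vec))"
    unfolding set_lebesgue_integral_def by (subst lborel_eq_distr_pair_vec) rule
  also have "\<dots> = (\<integral>p. indicator (cbox a b) (pair_vec p) *\<^sub>R f (pair_vec p) \<partial>lborel)"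
    using m mf by (subst integral_distr) auto
  also have "\<dots> = (LINT p:cbox (a$1, a$2) (b$1, b$2)|lborel. f (pair_vec p))"
    unfolding set_lebesgue_integral_def pair_vec_vimage_cbox[symmetric] by (simp add: indicator_vimage)
  also have "\<dots> = integral (cbox (a$1, a$2) (b$1, b$2)) (\<lambda>p. f (pair_vec p))"
  proof (rule set_borel_integral_eq_integral)
    have "continuous_on (cbox (a$1, a$2) (b$1, b$2)) (\<lambda>p. f (pair_vec p))"
      by (rule continuous_on_compose2[OF assms continuous_on_pair_vec]) (auto simp: pair_vec_vimage_cbox[symmetric])
    then show "set_integrable lborel (cbox (a$1, a$2) (b$1, b$2)) (\<lambda>p. f (pair_vec p))"
      unfolding set_integrable_def by (intro borel_integrable_compact) auto
  qed
  finally show ?thesis .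
qed

lemma poincare_square:
  fixes w :: "real^2 \<Rightarrow> real" and a :: "real^2"
  assumes h: "0 < h" and Q: "Q = cbox a (a + (\<chi> i. h))"
    and C: "C1_on Q w" and mean: "(LINT x:Q|lborel. w x) = 0"
  shows "(LINT x:Q|lborel. (w x)\<^sup>2) \<le> h\<^sup>2 * (LINT x:Q|lborel. (norm (grad w x))\<^sup>2)"
proof -
  define P where "P = cbox (a$1, a$2) (a$1 + h, a$2 + h)"
  have tr: "(LINT x:Q|lborel. f x) = integral P (\<lambda>p. f (pair_vec p))" if "continuous_on Q f" for f :: "real^2 \<Rightarrow> real"
    using set_integral_cbox_real2[of a "a + (\<chi> i. h)" f] that by (simp add: Q P_def)
  have PQ: "p \<in> P \<Longrightarrow> pair_vec p \<in> Q" for p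
    using pair_vec_vimage_cbox[of a "a + (\<chi> i. h)"] by (auto simp: P_def Q)
  have comp: "continuous_on P (\<lambda>p. f (pair_vec p))" if "continuous_on Q f" for f :: "real^2 \<Rightarrow> real"
    by (rule continuous_on_compose2[OF that continuous_on_pair_vec]) (use PQ in auto)
  note cw = C1_onD(3)[OF C] and cg = C1_onD(2)[OF C]
  have "integral P (\<lambda>p. (w (pair_vec p))\<^sup>2) \<le> h\<^sup>2 * integral P (\<lambda>p. (grad w (pair_vec p) $ 1)\<^sup>2 + (grad w (pair_vec p) $ 2)\<^sup>2)"
  proof (rule poincare_square_prod[OF h P_def])
    fix x y assume xy: "x \<in> {a$1..a$1 + h}" "y \<in> {a$2..a$2 + h}"
    then have "pair_vec (x, y) \<in> Q" by (intro PQ) (auto simp: P_def cbox_Pair_eq)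
    note d = C1_onD(1)[OF C this]
    have "((\<lambda>s. w (pair_vec (s, y))) has_derivative (\<lambda>k. grad w (pair_vec (x, y)) \<bullet> (k *\<^sub>R axis 1 1))) (at x)"
      by (rule has_derivative_compose[of "\<lambda>s. pair_vec (s, y)", OF _ d]) (auto simp: pair_vec_def intro!: derivative_eq_intros)
    then show "((\<lambda>s. w (pair_vec (s, y))) has_real_derivative grad w (pair_vec (x, y)) $ 1) (at x)"
      by (simp add: has_field_derivative_def inner_axis mult_commute_abs)
    have "((\<lambda>s. w (pair_vec (x, s))) has_derivative (\<lambda>k. grad w (pair_vec (x, y)) \<bullet> (k *\<^sub>R axis 2 1))) (at y)"
      by (rule has_derivative_compose[of "\<lambda>s. pair_vec (x, s)", OF _ d]) (auto simp: pair_vec_def intro!: derivative_eq_intros)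
    then show "((\<lambda>s. w (pair_vec (x, s))) has_real_derivative grad w (pair_vec (x, y)) $ 2) (at y)"
      by (simp add: has_field_derivative_def inner_axis mult_commute_abs)
  next
    show "integral P (\<lambda>p. w (pair_vec p)) = 0" using tr[OF cw] mean by simp
  qed (intro comp cw continuous_on_component cg)+
  moreover have "(LINT x:Q|lborel. (w x)\<^sup>2) = integral P (\<lambda>p. (w (pair_vec p))\<^sup>2)"
    by (rule tr) (intro continuous_intros cw)
  moreover have "(LINT x:Q|lborel. (norm (grad w x))\<^sup>2) = integral P (\<lambda>p. (norm (grad w (pair_vec p)))\<^sup>2)"
    by (rule tr) (intro continuous_intros cg)
  moreover have "(norm v)\<^sup>2 = (v$1)\<^sup>2 + (v$2)\<^sup>2" for v :: "real^2"
    unfolding power2_norm_eq_inner by (simp add: inner_vec_def sum_2 power2_eq_square)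
  ultimately show ?thesis by simp
qed

section \<open>Charts and the area measure\<close>

text \<open>For nonnegative integrands either both sides are integrable with equal integrals or both
  are infinite, so the formula for absolutely integrable functions covers all cases.\<close>

lemma nn_integral_change_of_variables:
  fixes f :: "real^'n::{finite,wellorder} \<Rightarrow> real" and g :: "real^'n::_ \<Rightarrow> real^'n::_"
  assumes S: "S \<in> sets borel"
    and der: "\<And>x. x \<in> S \<Longrightarrow> (g has_derivative g' x) (at x)"
    and inj: "inj_on g S" and nonneg: "\<And>y. y \<in> g ` S \<Longrightarrow> 0 \<le> f y"
    and mS: "(\<lambda>x. indicator S x * (\<bar>det (matrix (g' x))\<bar> * f (g x))) \<in> borel_measurable borel"
    and mT: "(\<lambda>y. indicator (g ` S) y * f y) \<in> borel_measurable borel"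
  shows "(\<integral>\<^sup>+x. ennreal (indicator S x * (\<bar>det (matrix (g' x))\<bar> * f (g x))) \<partial>lborel)
     = (\<integral>\<^sup>+y. ennreal (indicator (g ` S) y * f y) \<partial>lborel)"
proof -
  let ?D = "\<lambda>x. \<bar>det (matrix (g' x))\<bar> * f (g x)"
  have cv: "?D absolutely_integrable_on S \<and> integral S ?D = b \<longleftrightarrow>
      f absolutely_integrable_on (g ` S) \<and> integral (g ` S) f = b" for b
  proof -
    \<comment> \<open>The change of variables theorem is about vector-valued integrands, hence the
      detour through \<open>real^1\<close>.\<close>
    have "(\<lambda>x. \<bar>det (matrix (g' x))\<bar> *\<^sub>R (vec (f (g x)) :: real^1)) absolutely_integrable_on S \<and>
        integral S (\<lambda>x. \<bar>det (matrix (g' x))\<bar> *\<^sub>R (vec (f (g x)) :: real^1)) = vec b \<longleftrightarrow>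
      (\<lambda>y. vec (f y) :: real^1) absolutely_integrable_on (g ` S) \<and> integral (g ` S) (\<lambda>y. vec (f y) :: real^1) = vec b"
    proof (rule has_absolute_integral_change_of_variables[OF _ _ inj])
      show "S \<in> sets lebesgue" using S by auto
      show "(g has_derivative g' x) (at x within S)" if "x \<in> S" for x
        using der[OF that] by (rule has_derivative_at_withinI)
    qed
    then show ?thesis
      unfolding absolutely_integrable_on_1_iff integral_on_1_eq by (simp add: vec_eq_iff)
  qed
  have D0: "0 \<le> indicator S x * ?D x" for x using nonneg by (auto simp: indicator_def)
  have f0: "0 \<le> indicator (g ` S) y * f y" for y using nonneg by (auto simp: indicator_def)
  have aiD: "?D absolutely_integrable_on S \<longleftrightarrow> integrable lborel (\<lambda>x. indicator S x * ?D x)"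
    using mS by (simp add: set_integrable_def integrable_completion)
  have aif: "f absolutely_integrable_on (g ` S) \<longleftrightarrow> integrable lborel (\<lambda>y. indicator (g ` S) y * f y)"
    using mT by (simp add: set_integrable_def integrable_completion)
  show ?thesis
  proof (cases "?D absolutely_integrable_on S")
    case True
    then have T: "f absolutely_integrable_on (g ` S)" "integral (g ` S) f = integral S ?D"
      using cv by blast+
    have "(\<integral>x. indicator S x * ?D x \<partial>lborel) = integral S ?D"
      using set_lebesgue_integral_eq_integral(2)[OF True] mS
      by (simp add: set_lebesgue_integral_def integral_completion)
    moreover have "(\<integral>y. indicator (g ` S) y * f y \<partial>lborel) = integral (g ` S) f"
      using set_lebesgue_integral_eq_integral(2)[OF T(1)] mT
      by (simp add: set_lebesgue_integral_def integral_completion)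
    ultimately show ?thesis
      using True T aiD aif D0 f0 by (simp add: nn_integral_eq_integral)
  next
    case False
    then have F: "\<not> f absolutely_integrable_on (g ` S)" using cv by blast
    have "(\<integral>\<^sup>+x. ennreal (indicator S x * ?D x) \<partial>lborel) = \<infinity>"
    proof (rule ccontr)
      assume "\<not> ?thesis"
      then have "integrable lborel (\<lambda>x. indicator S x * ?D x)"
        using mS D0 by (intro integrableI_nonneg) (auto simp: top.not_eq_extremum)
      then show False using False aiD by simp
    qed
    moreover have "(\<integral>\<^sup>+y. ennreal (indicator (g ` S) y * f y) \<partial>lborel) = \<infinity>"
    proof (rule ccontr)
      assume "\<not> ?thesis"
      then have "integrable lborel (\<lambda>y. indicator (g ` S) y * f y)"
        using mT f0 by (intro integrableI_nonneg) (auto simp: top.not_eq_extremum)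
      then show False using F aif by simp
    qed
    ultimately show ?thesis by simp
  qed
qed

section \<open>Open, compact and Borel sets in a chart\<close>

abbreviation chart_image :: "'a chart \<Rightarrow> (real^2) set" where
  "chart_image c \<equiv> snd c ` fst c"

definition borel_sigma :: "'a topology \<Rightarrow> 'a measure" where
  "borel_sigma X = sigma (topspace X) {U. openin X U}"

lemma space_borel_sigma [simp]: "space (borel_sigma X) = topspace X"
  by (simp add: borel_sigma_def space_measure_of_conv)

lemma sets_borel_sigma: "sets (borel_sigma X) = sigma_sets (topspace X) {U. openin X U}"
  unfolding borel_sigma_def by (rule sets_measure_of) (auto dest: openin_subset)

lemma openin_borel_sigma: "openin X U \<Longrightarrow> U \<in> sets (borel_sigma X)"
  unfolding sets_borel_sigma by auto

lemma closedin_borel_sigma: "closedin X U \<Longrightarrow> U \<in> sets (borel_sigma X)"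
proof -
  assume "closedin X U"
  then have "topspace X - (topspace X - U) \<in> sets (borel_sigma X)"
    using sets.compl_sets[OF openin_borel_sigma[of X "topspace X - U"]] by auto
  then show ?thesis using \<open>closedin X U\<close> by (simp add: Diff_Diff_Int closedin_subset inf.absorb2)
qed

lemma continuous_map_borel_measurable:
  assumes "continuous_map X euclidean u"
  shows "u \<in> borel_measurable (borel_sigma X)"
proof (rule borel_measurableI)
  fix S :: "'b set" assume "open S"
  then have "openin X {p \<in> topspace X. u p \<in> S}"
    using assms by (auto simp: continuous_map_def)
  then show "u -` S \<inter> space (borel_sigma X) \<in> sets (borel_sigma X)"
    by (intro openin_borel_sigma) (simp add: vimage_def Int_def conj_commute)
qed

context
  fixes X :: "'a topology" and c :: "'a chart"
  assumes c: "is_chart X c"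
begin

lemma chart_topspace: "topspace (subtopology X (fst c)) = fst c"
  using c by (auto simp: is_chart_def dest: openin_subset)

lemma chart_openin: "openin X (fst c)" and chart_open: "open (chart_image c)"
  using c by (auto simp: is_chart_def)

lemma chart_subset: "fst c \<subseteq> topspace X"
  using chart_openin by (rule openin_subset)

lemma chart_inj: "inj_on (snd c) (fst c)"
proof -
  have "inj_on (snd c) (topspace (subtopology X (fst c)))"
    using c unfolding is_chart_def by (intro homeomorphic_imp_injective_map) auto
  then show ?thesis unfolding chart_topspace .
qed

lemma coord_inv_left: "p \<in> fst c \<Longrightarrow> coord_inv c (snd c p) = p"
  unfolding coord_inv_def by (rule inv_into_f_f[OF chart_inj])

lemma coord_inv_right: "x \<in> chart_image c \<Longrightarrow> snd c (coord_inv c x) = x"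
  unfolding coord_inv_def by (rule f_inv_into_f)

lemma coord_inv_mem: "x \<in> chart_image c \<Longrightarrow> coord_inv c x \<in> fst c"
  unfolding coord_inv_def by (rule inv_into_into)

lemma chart_open_iff:
  assumes "U \<subseteq> fst c"
  shows "open (snd c ` U) \<longleftrightarrow> openin X U"
proof -
  have "openin (top_of_set (chart_image c)) (snd c ` U) \<longleftrightarrow> openin (subtopology X (fst c)) U"
    using c assms chart_topspace unfolding is_chart_def by (intro homeomorphic_map_openness) auto
  moreover have "openin (top_of_set (chart_image c)) (snd c ` U) \<longleftrightarrow> open (snd c ` U)"
    using assms chart_open by (auto simp: openin_open_eq)
  moreover have "openin (subtopology X (fst c)) U \<longleftrightarrow> openin X U"
    using assms openin_open_subtopology[OF chart_openin] by auto
  ultimately show ?thesis by simp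
qed

lemma chart_image_inter: "snd c ` (E \<inter> fst c) = coord_inv c -` E \<inter> chart_image c"
  using coord_inv_left coord_inv_right coord_inv_mem by force

lemma coord_inv_image: "V \<subseteq> chart_image c \<Longrightarrow> snd c ` (coord_inv c ` V) = V"
  using coord_inv_right by force

lemma openin_coord_inv_image: "V \<subseteq> chart_image c \<Longrightarrow> open V \<Longrightarrow> openin X (coord_inv c ` V)"
  using chart_open_iff[of "coord_inv c ` V"] coord_inv_image[of V] coord_inv_mem by auto

lemma coord_inv_continuous: "continuous_map (top_of_set (chart_image c)) X (coord_inv c)"
  unfolding continuous_map_def
proof (intro conjI allI impI)
  show "coord_inv c \<in> topspace (top_of_set (chart_image c)) \<rightarrow> topspace X"
    using coord_inv_mem chart_subset by auto
  fix U assume "openin X U"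
  then have "openin X (U \<inter> fst c)" using chart_openin by blast
  then have "open (snd c ` (U \<inter> fst c))" using chart_open_iff[of "U \<inter> fst c"] by simp
  then have "open (coord_inv c -` U \<inter> chart_image c)" by (simp only: chart_image_inter)
  moreover have "{x \<in> topspace (top_of_set (chart_image c)). coord_inv c x \<in> U} = chart_image c \<inter> (coord_inv c -` U \<inter> chart_image c)"
    by auto
  ultimately show "openin (top_of_set (chart_image c)) {x \<in> topspace (top_of_set (chart_image c)). coord_inv c x \<in> U}"
    by (simp only: openin_open_Int)
qed

lemma coord_inv_measurable: "coord_inv c \<in> measurable (restrict_space lborel (chart_image c)) (borel_sigma X)"
  unfolding borel_sigma_def
proof (rule measurable_measure_of)
  show "{U. openin X U} \<subseteq> Pow (topspace X)" by (auto dest: openin_subset)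
  show "coord_inv c \<in> space (restrict_space lborel (chart_image c)) \<rightarrow> topspace X"
    using coord_inv_mem chart_subset by (auto simp: space_restrict_space)
  fix U assume "U \<in> {U. openin X U}"
  then have "openin X (U \<inter> fst c)" using chart_openin by blast
  then have "open (snd c ` (U \<inter> fst c))" using chart_open_iff[of "U \<inter> fst c"] by simp
  then have "open (coord_inv c -` U \<inter> chart_image c)" by (simp only: chart_image_inter)
  then show "coord_inv c -` U \<inter> space (restrict_space lborel (chart_image c)) \<in> sets (restrict_space lborel (chart_image c))"
    using chart_open by (subst sets_restrict_space_iff) (auto simp: space_restrict_space)
qed

lemma chart_image_borel:
  assumes "E \<in> sets (borel_sigma X)"
  shows "snd c ` (E \<inter> fst c) \<in> sets borel"
  using measurable_sets[OF coord_inv_measurable assms] chart_open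
  by (subst (asm) sets_restrict_space_iff) (auto simp: space_restrict_space chart_image_inter)

lemma compactin_coord_inv_image:
  assumes "K \<subseteq> chart_image c" "compact K"
  shows "compactin X (coord_inv c ` K)"
proof -
  have "compactin (top_of_set (chart_image c)) K" using assms by (simp add: compactin_subtopology)
  then show ?thesis using coord_inv_continuous by (rule image_compactin)
qed

end

section \<open>The area within one chart\<close>

text \<open>The area on the chart domain, regarded as a measure on all of X. The indicator in the
  density removes the arbitrary values of \<open>coord_inv\<close> off the chart image, so that
  measurability can be asked for on the whole plane.\<close>

definition chart_measure :: "'a topology \<Rightarrow> 'a metric_tensor \<Rightarrow> 'a chart \<Rightarrow> 'a measure" where
  "chart_measure X g c = distr (restrict_space (density lborel
       (\<lambda>x. ennreal (indicator (chart_image c) x * area_density g c (coord_inv c x)))) (chart_image c))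
     (borel_sigma X) (coord_inv c)"

lemma sets_chart_measure [simp]: "sets (chart_measure X g c) = sets (borel_sigma X)"
  by (simp add: chart_measure_def)

lemma space_chart_measure [simp]: "space (chart_measure X g c) = topspace X"
  by (simp add: chart_measure_def)

context
  fixes X :: "'a topology" and c :: "'a chart" and g :: "'a metric_tensor"
  assumes c: "is_chart X c"
    and dens: "(\<lambda>x. indicator (chart_image c) x * area_density g c (coord_inv c x)) \<in> borel_measurable borel"
begin

lemma coord_inv_measurable_density:
  "coord_inv c \<in> measurable (restrict_space (density lborel h) (chart_image c)) (borel_sigma X)"
proof -
  have "sets (restrict_space (density lborel h) (chart_image c)) = sets (restrict_space lborel (chart_image c))"
    by (rule sets_restrict_space_cong) simp
  then show ?thesis using coord_inv_measurable[OF c] measurable_cong_sets by blast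
qed

lemma nn_integral_chart_measure:
  assumes "F \<in> borel_measurable (borel_sigma X)"
  shows "(\<integral>\<^sup>+p. F p \<partial>chart_measure X g c) =
    (\<integral>\<^sup>+x. ennreal (indicator (chart_image c) x * area_density g c (coord_inv c x))
        * (F (coord_inv c x) * indicator (chart_image c) x) \<partial>lborel)"
proof -
  have m: "(\<lambda>x. F (coord_inv c x) * indicator (chart_image c) x) \<in> borel_measurable borel"
    using measurable_compose[OF coord_inv_measurable[OF c] assms] chart_open[OF c]
    by (subst (asm) borel_measurable_restrict_space_iff_ennreal) (auto simp: mult.commute)
  have "(\<integral>\<^sup>+p. F p \<partial>chart_measure X g c) =
     (\<integral>\<^sup>+x. F (coord_inv c x) * indicator (chart_image c) x \<partial>density lborel
       (\<lambda>x. ennreal (indicator (chart_image c) x * area_density g c (coord_inv c x))))"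
    unfolding chart_measure_def using coord_inv_measurable_density assms chart_open[OF c]
    by (subst nn_integral_distr) (auto simp: nn_integral_restrict_space)
  also have "\<dots> = (\<integral>\<^sup>+x. ennreal (indicator (chart_image c) x * area_density g c (coord_inv c x))
        * (F (coord_inv c x) * indicator (chart_image c) x) \<partial>lborel)"
    using m dens by (subst nn_integral_density) auto
  finally show ?thesis .
qed

lemma emeasure_chart_measure:
  assumes "E \<in> sets (borel_sigma X)"
  shows "emeasure (chart_measure X g c) E =
    (\<integral>\<^sup>+x\<in>snd c ` (E \<inter> fst c). ennreal (area_density g c (coord_inv c x)) \<partial>lborel)"
proof -
  have "emeasure (chart_measure X g c) E = (\<integral>\<^sup>+p. indicator E p \<partial>chart_measure X g c)"
    using assms by simp
  also have "\<dots> = (\<integral>\<^sup>+x. ennreal (indicator (chart_image c) x * area_density g c (coord_inv c x))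
        * (indicator E (coord_inv c x) * indicator (chart_image c) x) \<partial>lborel)"
    using assms by (intro nn_integral_chart_measure) auto
  also have "\<dots> = (\<integral>\<^sup>+x\<in>snd c ` (E \<inter> fst c). ennreal (area_density g c (coord_inv c x)) \<partial>lborel)"
    unfolding chart_image_inter[OF c] by (intro nn_integral_cong) (auto simp: indicator_def)
  finally show ?thesis .
qed

lemma integral_chart_measure:
  fixes F :: "'a \<Rightarrow> real"
  assumes F: "F \<in> borel_measurable (borel_sigma X)"
    and nonneg: "\<And>p. p \<in> fst c \<Longrightarrow> 0 \<le> area_density g c p"
  shows "(\<integral>p. F p \<partial>chart_measure X g c) =
    (\<integral>x. indicator (chart_image c) x *\<^sub>R (area_density g c (coord_inv c x) * F (coord_inv c x)) \<partial>lborel)"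
proof -
  have m: "(\<lambda>x. indicator (chart_image c) x *\<^sub>R F (coord_inv c x)) \<in> borel_measurable borel"
    using measurable_compose[OF coord_inv_measurable[OF c] F] chart_open[OF c]
    by (subst (asm) borel_measurable_restrict_space_iff) auto
  have "(\<integral>p. F p \<partial>chart_measure X g c) =
     (\<integral>x. indicator (chart_image c) x *\<^sub>R F (coord_inv c x) \<partial>density lborel
       (\<lambda>x. ennreal (indicator (chart_image c) x * area_density g c (coord_inv c x))))"
    unfolding chart_measure_def using coord_inv_measurable_density F chart_open[OF c]
    by (subst integral_distr) (auto simp: integral_restrict_space)
  also have "\<dots> = (\<integral>x. (indicator (chart_image c) x * area_density g c (coord_inv c x)) *\<^sub>R (indicator (chart_image c) x *\<^sub>R F (coord_inv c x)) \<partial>lborel)"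
    using m dens nonneg coord_inv_mem[OF c] by (subst integral_density) (auto simp: indicator_def)
  also have "\<dots> = (\<integral>x. indicator (chart_image c) x *\<^sub>R (area_density g c (coord_inv c x) * F (coord_inv c x)) \<partial>lborel)"
    by (intro Bochner_Integration.integral_cong) (auto simp: indicator_def)
  finally show ?thesis .
qed

end

section \<open>Uniqueness of the area measure\<close>

text \<open>The description inside \<open>THE\<close> of \<open>area_measure\<close>, named because
  its existence and uniqueness must be shown before that definition yields anything.\<close>

definition is_area_measure :: "'a topology \<Rightarrow> 'a chart set \<Rightarrow> 'a metric_tensor \<Rightarrow> 'a measure \<Rightarrow> bool" where
  "is_area_measure X A g M \<longleftrightarrow>
     space M = topspace X \<and>
     sets M = sigma_sets (topspace X) {U. openin X U} \<and>
     (\<forall>c\<in>A. \<forall>E\<in>sets M. E \<subseteq> fst c \<longrightarrow>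
        emeasure M E =
          (\<integral>\<^sup>+ x\<in>snd c ` E. ennreal (area_density g c (coord_inv c x)) \<partial>lborel))"

lemma area_measure_eq_THE: "area_measure X A g = (THE M. is_area_measure X A g M)"
  unfolding area_measure_def is_area_measure_def ..

lemma finite_chart_cover:
  assumes "closed_surface X A"
  shows "\<exists>n cs. (\<forall>i<n::nat. cs i \<in> A) \<and> topspace X = (\<Union>i<n. fst (cs i))"
proof -
  have A: "compactin X (topspace X)" "\<And>U. U \<in> fst ` A \<Longrightarrow> openin X U" "(\<Union>c\<in>A. fst c) = topspace X"
    using assms unfolding closed_surface_def compact_space_def smooth_atlas_def is_chart_def by blast+
  have "topspace X \<subseteq> \<Union>(fst ` A)" using A(3) by blast
  then obtain \<F> where F: "finite \<F>" "\<F> \<subseteq> fst ` A" "topspace X \<subseteq> \<Union>\<F>"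
    using compactinD[OF A(1,2)] by meson
  obtain C where C: "C \<subseteq> A" "finite C" "\<F> = fst ` C" using finite_subset_image[OF F(1,2)] by blast
  obtain n cs where cs: "C = cs ` {i::nat. i < n}" using finite_imp_nat_seg_image_inj_on[OF C(2)] by blast
  have "\<forall>i<n. cs i \<in> A" using C cs by blast
  moreover have "(\<Union>i<n. fst (cs i)) = \<Union>\<F>" unfolding C(3) cs by auto
  moreover have "\<Union>\<F> = topspace X" using F A(3) by blast
  ultimately show ?thesis by metis
qed

text \<open>The area is prescribed on subsets of chart domains only; a general Borel set is cut
  along this partition into such subsets.\<close>

lemma chart_partition:
  assumes "closed_surface X A"
  shows "\<exists>n cs P. (\<forall>i<n::nat. cs i \<in> A \<and> P i \<subseteq> fst (cs i)) \<and> (\<forall>i. P i \<in> sets (borel_sigma X)) \<and>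
    disjoint_family P \<and> (\<Union>i<n. P i) = topspace X"
proof -
  obtain n :: nat and cs where cs: "\<forall>i<n. cs i \<in> A" and U: "topspace X = (\<Union>i<n. fst (cs i))"
    using finite_chart_cover[OF assms] by blast
  define P where "P = disjointed (\<lambda>i. if i < n then fst (cs i) else {})"
  have "fst (cs i) \<in> sets (borel_sigma X)" if "i < n" for i
    using cs that assms by (intro openin_borel_sigma) (auto simp: closed_surface_def smooth_atlas_def is_chart_def)
  then have "range (\<lambda>i. if i < n then fst (cs i) else {}) \<subseteq> sets (borel_sigma X)" by auto
  then have "\<forall>i. P i \<in> sets (borel_sigma X)"
    unfolding P_def using sets.range_disjointed_sets by blast
  moreover have Psub: "P i \<subseteq> (if i < n then fst (cs i) else {})" for i
    unfolding P_def by (rule disjointed_subset)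
  moreover have "disjoint_family P" unfolding P_def by (rule disjoint_family_disjointed)
  moreover have "(\<Union>i<n. P i) = topspace X"
  proof -
    have "(\<Union>i. P i) = topspace X" unfolding P_def UN_disjointed_eq U by auto
    moreover have "P i = {}" if "\<not> i < n" for i using Psub[of i] that by simp
    then have "(\<Union>i. P i) = (\<Union>i<n. P i)" by blast
    ultimately show ?thesis by simp
  qed
  moreover have "cs i \<in> A \<and> P i \<subseteq> fst (cs i)" if "i < n" for i using cs Psub[of i] that by simp
  ultimately show ?thesis by blast
qed

lemma is_area_measure_unique:
  assumes S: "closed_surface X A" and M: "is_area_measure X A g M" and M': "is_area_measure X A g M'"
  shows "M = M'"
proof (rule measure_eqI)
  show ss: "sets M = sets M'" using M M' by (simp add: is_area_measure_def)
  have sM: "sets M = sets (borel_sigma X)" using M by (simp add: is_area_measure_def sets_borel_sigma)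
  fix E assume E: "E \<in> sets M"
  obtain n :: nat and cs P where cs: "\<And>i. i < n \<Longrightarrow> cs i \<in> A \<and> P i \<subseteq> fst (cs i)"
    and Ps: "\<And>i. P i \<in> sets (borel_sigma X)" and disj: "disjoint_family P" and PU: "(\<Union>i<n. P i) = topspace X"
    using chart_partition[OF S] by blast
  have EU: "(\<Union>i<n. E \<inter> P i) = E"
  proof -
    have "E \<subseteq> topspace X" using sets.sets_into_space[OF E] M by (simp add: is_area_measure_def)
    then show ?thesis using PU by blast
  qed
  have sum: "emeasure N E = (\<Sum>i<n. emeasure N (E \<inter> P i))" if "sets N = sets M" for N
  proof -
    have "(\<Sum>i<n. emeasure N (E \<inter> P i)) = emeasure N (\<Union>i<n. E \<inter> P i)"
      using disj E Ps that sM by (intro sum_emeasure) (auto simp: disjoint_family_on_def)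
    then show ?thesis using EU by simp
  qed
  have "emeasure M (E \<inter> P i) = emeasure M' (E \<inter> P i)" if "i < n" for i
  proof -
    have "E \<inter> P i \<subseteq> fst (cs i)" "E \<inter> P i \<in> sets M"
      using cs[OF that] E Ps sM by auto
    moreover have "cs i \<in> A" using cs[OF that] by blast
    ultimately show ?thesis using M M' ss unfolding is_area_measure_def by simp
  qed
  then show "emeasure M E = emeasure M' E" using sum[of M] sum[of M'] ss by simp
qed

lemma area_measure_eqI:
  assumes "closed_surface X A" "is_area_measure X A g M"
  shows "area_measure X A g = M"
  unfolding area_measure_eq_THE using assms by (blast intro: the_equality is_area_measure_unique)

section \<open>Metric coefficients, transition maps and existence of the area measure\<close>

locale closed_riemannian_surface =
  fixes X :: "'a topology" and A :: "'a chart set" and g :: "'a metric_tensor"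
  assumes surf: "closed_surface X A" and met: "riemannian_metric A g"
begin

lemma chart: "c \<in> A \<Longrightarrow> is_chart X c"
  using surf by (simp add: closed_surface_def smooth_atlas_def)

lemma ex_chart: "p \<in> topspace X \<Longrightarrow> \<exists>c\<in>A. p \<in> fst c"
  using surf by (auto simp: closed_surface_def smooth_atlas_def)

lemma chart_in_space: "c \<in> A \<Longrightarrow> p \<in> fst c \<Longrightarrow> p \<in> topspace X"
  using chart_subset[OF chart] by blast

lemma Hausdorff: "Hausdorff_space X" and compact: "compact_space X"
  using surf by (auto simp: closed_surface_def)

lemma metric_sym: "c \<in> A \<Longrightarrow> p \<in> fst c \<Longrightarrow> transpose (g c p) = g c p"
  and metric_pos: "c \<in> A \<Longrightarrow> p \<in> fst c \<Longrightarrow> v \<noteq> 0 \<Longrightarrow> v \<bullet> (g c p *v v) > 0"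
  using met unfolding riemannian_metric_def by blast+

lemma metric_det: "c \<in> A \<Longrightarrow> p \<in> fst c \<Longrightarrow> 0 < det (g c p)"
  using posdef_2x2_det metric_sym metric_pos by blast

lemma area_density_pos: "c \<in> A \<Longrightarrow> p \<in> fst c \<Longrightarrow> 0 < area_density g c p"
  using metric_det by (simp add: area_density_def)

lemma metric_transform:
  "c \<in> A \<Longrightarrow> d \<in> A \<Longrightarrow> p \<in> fst c \<inter> fst d \<Longrightarrow>
    g c p = transpose (jacobian c d p) ** g d p ** jacobian c d p"
  using met unfolding riemannian_metric_def by blast

lemma area_density_transform:
  assumes "c \<in> A" "d \<in> A" "p \<in> fst c \<inter> fst d"
  shows "area_density g c p = \<bar>det (jacobian c d p)\<bar> * area_density g d p"
proof -
  have "det (g c p) = (det (jacobian c d p))\<^sup>2 * det (g d p)"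
    by (subst metric_transform[OF assms]) (simp add: det_mul power2_eq_square)
  then show ?thesis by (simp add: area_density_def real_sqrt_mult)
qed

lemma metric_C1: "c \<in> A \<Longrightarrow> C1_on (chart_image c) (\<lambda>x. g c (coord_inv c x) $ i $ j)"
proof -
  assume "c \<in> A"
  then have "Ck_on 1 (chart_image c) (\<lambda>x. g c (coord_inv c x))"
    using met unfolding riemannian_metric_def smooth_on_def o_def by blast
  moreover have "bounded_linear (\<lambda>m::real^2^2. m $ i $ j)"
    using bounded_linear_compose[OF bounded_linear_vec_nth bounded_linear_vec_nth] .
  ultimately show ?thesis by (rule Ck_on_1_bounded_linear[rotated])
qed

lemma metric_det_C1: "c \<in> A \<Longrightarrow> C1_on (chart_image c) (\<lambda>x. det (g c (coord_inv c x)))"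
proof -
  assume c: "c \<in> A"
  have "C1_on (chart_image c) (\<lambda>x. g c (coord_inv c x) $ 1 $ 1 * g c (coord_inv c x) $ 2 $ 2 +
      (- 1) * (g c (coord_inv c x) $ 1 $ 2 * g c (coord_inv c x) $ 2 $ 1))"
    by (intro C1_on_add C1_on_mult C1_on_const metric_C1 c)
  then show ?thesis by (simp add: det_2)
qed

lemma area_density_C1: "c \<in> A \<Longrightarrow> C1_on (chart_image c) (\<lambda>x. area_density g c (coord_inv c x))"
  unfolding area_density_def
  by (intro C1_on_sqrt metric_det_C1 metric_det coord_inv_mem[OF chart])

lemma cometric_C1: "c \<in> A \<Longrightarrow> C1_on (chart_image c) (\<lambda>x. matrix_inv (g c (coord_inv c x)) $ i $ j)"
proof -
  assume c: "c \<in> A"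
  let ?k = "if i = j then (3 - i, 3 - j) else (i, j)"
  let ?s = "if i = j then 1 else - 1 :: real"
  have "C1_on (chart_image c) (\<lambda>x. ?s * (g c (coord_inv c x) $ fst ?k $ snd ?k / det (g c (coord_inv c x))))"
    using metric_det[OF c coord_inv_mem[OF chart[OF c]]]
    by (intro C1_on_mult C1_on_const C1_on_divide metric_C1 metric_det_C1 c) force
  then show ?thesis
  proof (rule C1_on_cong[rotated -1])
    show "?s * (g c (coord_inv c x) $ fst ?k $ snd ?k / det (g c (coord_inv c x))) = matrix_inv (g c (coord_inv c x)) $ i $ j"
      if "x \<in> chart_image c" for x
      using metric_det[OF c coord_inv_mem[OF chart[OF c] that]] by (simp add: matrix_inv_2x2)
  qed (rule chart_open[OF chart[OF c]])
qed

lemma area_density_measurable: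
  "c \<in> A \<Longrightarrow> (\<lambda>x. indicator (chart_image c) x * area_density g c (coord_inv c x)) \<in> borel_measurable borel"
  using borel_measurable_continuous_on_indicator[OF _ C1_onD(3)[OF area_density_C1], of c] chart_open[OF chart]
  by simp

definition overlap :: "'a chart \<Rightarrow> 'a chart \<Rightarrow> (real^2) set" where
  "overlap c d = snd c ` (fst c \<inter> fst d)"

lemma overlap_open: "c \<in> A \<Longrightarrow> d \<in> A \<Longrightarrow> open (overlap c d)"
  unfolding overlap_def using chart_open_iff[OF chart, of c "fst c \<inter> fst d"] chart_openin[OF chart] by blast

lemma overlap_subset: "overlap c d \<subseteq> chart_image c"
  by (auto simp: overlap_def)

lemma overlap_coord_inv:
  assumes "c \<in> A" "x \<in> overlap c d"
  shows "coord_inv c x \<in> fst c \<inter> fst d" "snd c (coord_inv c x) = x"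
  using assms(2) coord_inv_left[OF chart[OF assms(1)]] by (auto simp: overlap_def)

lemma transition_Ck: "c \<in> A \<Longrightarrow> d \<in> A \<Longrightarrow> Ck_on k (overlap c d) (transition c d)"
  using surf unfolding closed_surface_def smooth_atlas_def smooth_on_def overlap_def by blast

lemma transition_apply: "transition c d x = snd d (coord_inv c x)"
  by (simp add: transition_def)

lemma coord_inv_transition:
  "c \<in> A \<Longrightarrow> d \<in> A \<Longrightarrow> x \<in> overlap c d \<Longrightarrow> coord_inv d (transition c d x) = coord_inv c x"
  using overlap_coord_inv[of c x d] coord_inv_left[OF chart, of d] by (simp add: transition_apply)

lemma transition_image: "c \<in> A \<Longrightarrow> E \<subseteq> fst c \<inter> fst d \<Longrightarrow> transition c d ` (snd c ` E) = snd d ` E"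
  using coord_inv_left[OF chart, of c] by (force simp: transition_apply image_image)

lemma transition_derivative:
  assumes "c \<in> A" "d \<in> A" "x \<in> overlap c d"
  shows "(transition c d has_derivative frechet_derivative (transition c d) (at x)) (at x)"
proof -
  have "Ck_on (Suc 0) (overlap c d) (transition c d)" using assms transition_Ck by blast
  then show ?thesis using assms(3) by (simp add: frechet_derivative_works)
qed

lemma transition_inj: "c \<in> A \<Longrightarrow> d \<in> A \<Longrightarrow> inj_on (transition c d) (overlap c d)"
proof (rule inj_onI)
  fix x y assume cd: "c \<in> A" "d \<in> A" and xy: "x \<in> overlap c d" "y \<in> overlap c d" "transition c d x = transition c d y"
  then have "coord_inv c x = coord_inv c y" using coord_inv_transition by metis
  then show "x = y" using overlap_coord_inv(2)[OF cd(1)] xy by metis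
qed

text \<open>Change of variables along the transition map: the factor |det J| is exactly the ratio of
  the two area densities.\<close>

lemma chart_measure_agree:
  assumes cd: "c \<in> A" "d \<in> A" and E: "E \<in> sets (borel_sigma X)" "E \<subseteq> fst c \<inter> fst d"
  shows "emeasure (chart_measure X g c) E = emeasure (chart_measure X g d) E"
proof -
  define S where "S = snd c ` E"
  have SE: "snd c ` (E \<inter> fst c) = S" "snd d ` (E \<inter> fst d) = transition c d ` S"
    using E transition_image[OF cd(1) E(2)] by (auto simp: S_def Int_absorb2)
  have Sb: "S \<in> sets borel" "transition c d ` S \<in> sets borel"
    using chart_image_borel[OF chart E(1)] cd SE by metis+
  have So: "S \<subseteq> overlap c d" using E by (auto simp: S_def overlap_def)
  let ?dc = "\<lambda>x. area_density g c (coord_inv c x)"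
  let ?dd = "\<lambda>x. area_density g d (coord_inv d x)"
  let ?g' = "\<lambda>x. frechet_derivative (transition c d) (at x)"
  have dc: "indicator S x * (\<bar>det (matrix (?g' x))\<bar> * ?dd (transition c d x)) = indicator S x * ?dc x" for x
  proof (cases "x \<in> S")
    case True
    then have x: "x \<in> overlap c d" using So by blast
    show ?thesis
      using area_density_transform[OF cd overlap_coord_inv(1)[OF cd(1) x]] overlap_coord_inv(2)[OF cd(1) x]
        coord_inv_transition[OF cd x] by (simp add: jacobian_def)
  qed simp
  have mc: "(\<lambda>x. indicator S x * ?dc x) \<in> borel_measurable borel"
  proof -
    have "(\<lambda>x. indicator S x * (indicator (chart_image c) x * ?dc x)) \<in> borel_measurable borel"
      by (rule borel_measurable_times[OF borel_measurable_indicator[OF Sb(1)] area_density_measurable[OF cd(1)]])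
    moreover have "indicator S x * (indicator (chart_image c) x * ?dc x) = indicator S x * ?dc x" for x
      using So overlap_subset[of c d] by (auto simp: indicator_def)
    ultimately show ?thesis by simp
  qed
  have md: "(\<lambda>x. indicator (transition c d ` S) x * ?dd x) \<in> borel_measurable borel"
  proof -
    have "(\<lambda>x. indicator (transition c d ` S) x * (indicator (chart_image d) x * ?dd x)) \<in> borel_measurable borel"
      by (rule borel_measurable_times[OF borel_measurable_indicator[OF Sb(2)] area_density_measurable[OF cd(2)]])
    moreover have "indicator (transition c d ` S) x * (indicator (chart_image d) x * ?dd x) = indicator (transition c d ` S) x * ?dd x" for x
      using SE(2) by (auto simp: indicator_def)
    ultimately show ?thesis by simp
  qed
  have "(\<integral>\<^sup>+x. ennreal (indicator S x * ?dc x) \<partial>lborel) = (\<integral>\<^sup>+y. ennreal (indicator (transition c d ` S) y * ?dd y) \<partial>lborel)"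
    unfolding dc[symmetric]
  proof (rule nn_integral_change_of_variables[OF Sb(1)])
    show "(transition c d has_derivative ?g' x) (at x)" if "x \<in> S" for x
      using transition_derivative[OF cd] So that by blast
    show "inj_on (transition c d) S" using transition_inj[OF cd] So by (rule inj_on_subset)
    show "0 \<le> ?dd y" if "y \<in> transition c d ` S" for y
    proof -
      have "y \<in> chart_image d" using that SE(2) by blast
      then show ?thesis using area_density_pos[OF cd(2) coord_inv_mem[OF chart[OF cd(2)]]] by (simp add: less_imp_le)
    qed
    show "(\<lambda>x. indicator S x * (\<bar>det (matrix (?g' x))\<bar> * ?dd (transition c d x))) \<in> borel_measurable borel"
      unfolding dc by (rule mc)
    show "(\<lambda>x. indicator (transition c d ` S) x * ?dd x) \<in> borel_measurable borel" by (rule md)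
  qed
  moreover have "emeasure (chart_measure X g c) E = (\<integral>\<^sup>+x. ennreal (indicator S x * ?dc x) \<partial>lborel)"
    unfolding emeasure_chart_measure[OF chart[OF cd(1)] area_density_measurable[OF cd(1)] E(1)] SE
    by (intro nn_integral_cong) (auto simp: indicator_def)
  moreover have "emeasure (chart_measure X g d) E = (\<integral>\<^sup>+y. ennreal (indicator (transition c d ` S) y * ?dd y) \<partial>lborel)"
    unfolding emeasure_chart_measure[OF chart[OF cd(2)] area_density_measurable[OF cd(2)] E(1)] SE
    by (intro nn_integral_cong) (auto simp: indicator_def)
  ultimately show ?thesis by simp
qed

text \<open>The chart measures are glued along a partition. For a set inside some other chart,
  agreement on overlaps allows the measure of that chart to replace each summand.\<close>

lemma ex_area_measure: "\<exists>M. is_area_measure X A g M"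
proof -
  obtain n :: nat and cs P where cs: "\<And>i. i < n \<Longrightarrow> cs i \<in> A \<and> P i \<subseteq> fst (cs i)"
    and Ps: "\<And>i. P i \<in> sets (borel_sigma X)" and disj: "disjoint_family P" and PU: "(\<Union>i<n. P i) = topspace X"
    using chart_partition[OF surf] by blast
  define \<mu> where "\<mu> = (\<lambda>E. \<Sum>i<n. emeasure (chart_measure X g (cs i)) (E \<inter> P i))"
  define M where "M = measure_of (topspace X) {U. openin X U} \<mu>"
  have sM: "sets M = sets (borel_sigma X)"
    unfolding M_def sets_borel_sigma by (rule sets_measure_of) (auto dest: openin_subset)
  have "countably_additive (sets M) \<mu>"
  proof (rule countably_additiveI)
    fix F :: "nat \<Rightarrow> 'a set" assume F: "range F \<subseteq> sets M" "disjoint_family F"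
    have "(\<Sum>k. \<mu> (F k)) = (\<Sum>i<n. \<Sum>k. emeasure (chart_measure X g (cs i)) (F k \<inter> P i))"
      unfolding \<mu>_def by (rule suminf_sum) simp
    also have "\<dots> = (\<Sum>i<n. emeasure (chart_measure X g (cs i)) (\<Union>k. F k \<inter> P i))"
    proof (intro sum.cong refl suminf_emeasure)
      fix i
      show "range (\<lambda>k. F k \<inter> P i) \<subseteq> sets (chart_measure X g (cs i))"
        using F(1) Ps[of i] sM by (auto intro!: sets.Int)
      show "disjoint_family (\<lambda>k. F k \<inter> P i)"
        using F(2) by (auto simp: disjoint_family_on_def)
    qed
    also have "\<dots> = \<mu> (\<Union>k. F k)" by (simp add: \<mu>_def)
    finally show "(\<Sum>k. \<mu> (F k)) = \<mu> (\<Union>k. F k)" .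
  qed
  then have eM: "emeasure M E = \<mu> E" if "E \<in> sets M" for E
    using that by (intro emeasure_measure_of[OF M_def]) (auto simp: positive_def \<mu>_def dest: openin_subset)
  have "is_area_measure X A g M"
    unfolding is_area_measure_def
  proof (intro conjI ballI impI)
    show "space M = topspace X" by (simp add: M_def space_measure_of_conv)
    show "sets M = sigma_sets (topspace X) {U. openin X U}" using sM sets_borel_sigma by metis
    fix c E assume c: "c \<in> A" and E: "E \<in> sets M" "E \<subseteq> fst c"
    have Eb: "E \<in> sets (borel_sigma X)" using E sM by simp
    have "emeasure M E = (\<Sum>i<n. emeasure (chart_measure X g c) (E \<inter> P i))"
      unfolding eM[OF E(1)] \<mu>_def
    proof (intro sum.cong refl chart_measure_agree)
      fix i assume "i \<in> {..<n}"
      then show "cs i \<in> A" "E \<inter> P i \<subseteq> fst (cs i) \<inter> fst c" using cs[of i] E(2) by auto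
    qed (use c Eb Ps in auto)
    also have "\<dots> = emeasure (chart_measure X g c) (\<Union>i<n. E \<inter> P i)"
      using Eb Ps disj by (intro sum_emeasure) (auto simp: disjoint_family_on_def)
    also have "(\<Union>i<n. E \<inter> P i) = E" using PU E(2) chart_subset[OF chart[OF c]] by blast
    also have "emeasure (chart_measure X g c) E = (\<integral>\<^sup>+ x\<in>snd c ` E. ennreal (area_density g c (coord_inv c x)) \<partial>lborel)"
      using emeasure_chart_measure[OF chart[OF c] area_density_measurable[OF c] Eb] E(2) by (simp add: Int_absorb2)
    finally show "emeasure M E = (\<integral>\<^sup>+ x\<in>snd c ` E. ennreal (area_density g c (coord_inv c x)) \<partial>lborel)" .
  qed
  then show ?thesis by blast
qed

section \<open>Integration against the area measure\<close>

definition dx :: "'a measure" where "dx = area_measure X A g"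

lemma is_area_measure_dx: "is_area_measure X A g dx"
  using ex_area_measure area_measure_eqI[OF surf] unfolding dx_def by metis

lemma space_dx [simp]: "space dx = topspace X"
  and sets_dx [simp]: "sets dx = sets (borel_sigma X)"
  using is_area_measure_dx by (simp_all add: is_area_measure_def sets_borel_sigma)

lemma emeasure_dx:
  assumes "c \<in> A" "E \<in> sets (borel_sigma X)" "E \<subseteq> fst c"
  shows "emeasure dx E = (\<integral>\<^sup>+ x\<in>snd c ` E. ennreal (area_density g c (coord_inv c x)) \<partial>lborel)"
  using is_area_measure_dx assms unfolding is_area_measure_def sets_borel_sigma[symmetric] by blast

lemma measurable_dx [simp]: "borel_measurable dx = borel_measurable (borel_sigma X)"
  by (rule measurable_cong_sets) simp_all

lemma chart_measure_eq_density:
  assumes c: "c \<in> A"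
  shows "chart_measure X g c = density dx (indicator (fst c))"
proof (rule measure_eqI)
  fix E assume "E \<in> sets (chart_measure X g c)"
  then have E: "E \<in> sets (borel_sigma X)" by simp
  have op: "fst c \<in> sets (borel_sigma X)" using chart_openin[OF chart[OF c]] by (rule openin_borel_sigma)
  have "emeasure (density dx (indicator (fst c))) E = (\<integral>\<^sup>+p. indicator (E \<inter> fst c) p \<partial>dx)"
  proof -
    have "emeasure (density dx (indicator (fst c))) E = (\<integral>\<^sup>+p. indicator (fst c) p * indicator E p \<partial>dx)"
      using E op by (intro emeasure_density) auto
    also have "\<dots> = (\<integral>\<^sup>+p. indicator (E \<inter> fst c) p \<partial>dx)"
      by (intro nn_integral_cong) (simp add: indicator_inter_arith mult.commute)
    finally show ?thesis .
  qed
  also have "\<dots> = emeasure dx (E \<inter> fst c)" using E op by simp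
  also have "\<dots> = (\<integral>\<^sup>+ x\<in>snd c ` (E \<inter> fst c). ennreal (area_density g c (coord_inv c x)) \<partial>lborel)"
    using E op c by (intro emeasure_dx) auto
  also have "\<dots> = emeasure (chart_measure X g c) E"
    using emeasure_chart_measure[OF chart[OF c] area_density_measurable[OF c] E] by simp
  finally show "emeasure (chart_measure X g c) E = emeasure (density dx (indicator (fst c))) E" by simp
qed simp

lemma nn_integral_chart:
  assumes c: "c \<in> A" and F: "F \<in> borel_measurable (borel_sigma X)"
  shows "(\<integral>\<^sup>+p. indicator (fst c) p * F p \<partial>dx) =
    (\<integral>\<^sup>+x. ennreal (indicator (chart_image c) x * area_density g c (coord_inv c x))
        * (F (coord_inv c x) * indicator (chart_image c) x) \<partial>lborel)"
proof -
  have op: "fst c \<in> sets (borel_sigma X)" using chart_openin[OF chart[OF c]] by (rule openin_borel_sigma)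
  have "(\<integral>\<^sup>+p. indicator (fst c) p * F p \<partial>dx) = (\<integral>\<^sup>+p. F p \<partial>chart_measure X g c)"
    unfolding chart_measure_eq_density[OF c] using op F by (subst nn_integral_density) auto
  then show ?thesis using nn_integral_chart_measure[OF chart[OF c] area_density_measurable[OF c] F] by simp
qed

lemma integral_chart:
  fixes F :: "'a \<Rightarrow> real"
  assumes c: "c \<in> A" and F: "F \<in> borel_measurable (borel_sigma X)"
  shows "(\<integral>p. indicator (fst c) p * F p \<partial>dx) =
    (\<integral>x. indicator (chart_image c) x *\<^sub>R (area_density g c (coord_inv c x) * F (coord_inv c x)) \<partial>lborel)"
proof -
  have op: "fst c \<in> sets (borel_sigma X)" using chart_openin[OF chart[OF c]] by (rule openin_borel_sigma)
  have "density dx (indicator (fst c)) = density dx (\<lambda>p. ennreal (indicator (fst c) p))"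
    by (rule arg_cong[of _ _ "density dx"]) (auto simp: indicator_def)
  then have "(\<integral>p. F p \<partial>chart_measure X g c) = (\<integral>p. F p \<partial>density dx (\<lambda>p. ennreal (indicator (fst c) p)))"
    unfolding chart_measure_eq_density[OF c] by simp
  also have "\<dots> = (\<integral>p. indicator (fst c) p *\<^sub>R F p \<partial>dx)"
    using op F by (intro integral_density) auto
  finally have "(\<integral>p. indicator (fst c) p * F p \<partial>dx) = (\<integral>p. F p \<partial>chart_measure X g c)" by simp
  then show ?thesis
    using integral_chart_measure[OF chart[OF c] area_density_measurable[OF c] F] area_density_pos[OF c] by (simp add: less_imp_le)
qed

lemma chart_local_openin:
  assumes c: "c \<in> A" and h: "continuous_on (chart_image c) (\<lambda>x. h (coord_inv c x))" and V: "open V"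
  shows "openin X {p \<in> fst c. h p \<in> V}"
proof -
  have "snd c ` {p \<in> fst c. h p \<in> V} = chart_image c \<inter> (\<lambda>x. h (coord_inv c x)) -` V"
    using coord_inv_left[OF chart[OF c]] by force
  moreover have "open (chart_image c \<inter> (\<lambda>x. h (coord_inv c x)) -` V)"
    using h V chart_open[OF chart[OF c]] by (simp add: continuous_on_open_vimage Int_commute)
  ultimately show ?thesis using chart_open_iff[OF chart[OF c], of "{p \<in> fst c. h p \<in> V}"] by auto
qed

lemma continuous_mapI_charts:
  assumes "\<And>c. c \<in> A \<Longrightarrow> continuous_on (chart_image c) (\<lambda>x. h (coord_inv c x))"
  shows "continuous_map X euclidean h"
  unfolding continuous_map_def
proof (intro conjI allI impI)
  fix V :: "'b set" assume "openin euclidean V"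
  then have V: "open V" by simp
  have "{p \<in> topspace X. h p \<in> V} = (\<Union>c\<in>A. {p \<in> fst c. h p \<in> V})"
    using ex_chart chart_in_space by blast
  moreover have "openin X (\<Union>c\<in>A. {p \<in> fst c. h p \<in> V})"
    using chart_local_openin[OF _ assms V] by blast
  ultimately show "openin X {p \<in> topspace X. h p \<in> V}" by simp
qed auto

text \<open>Meant for expressions such as \<open>gamma c\<close> or
  \<open>laplace_in_chart g c\<close>, which make sense in a single chart.\<close>

lemma chart_local_measurable:
  assumes c: "c \<in> A" and h: "continuous_on (chart_image c) (\<lambda>x. h (coord_inv c x))"
  shows "(\<lambda>p. indicator (fst c) p * h p :: real) \<in> borel_measurable (borel_sigma X)"
proof -
  have op: "fst c \<in> sets (borel_sigma X)" using chart_openin[OF chart[OF c]] by (rule openin_borel_sigma)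
  have sub: "fst c \<inter> topspace X = fst c" using chart_subset[OF chart[OF c]] by blast
  have "h \<in> borel_measurable (restrict_space (borel_sigma X) (fst c))"
  proof (rule borel_measurableI)
    fix S :: "real set" assume "open S"
    then have "openin X {p \<in> fst c. h p \<in> S}" by (rule chart_local_openin[OF c h])
    then have "{p \<in> fst c. h p \<in> S} \<in> sets (borel_sigma X)" by (rule openin_borel_sigma)
    moreover have "h -` S \<inter> space (restrict_space (borel_sigma X) (fst c)) = {p \<in> fst c. h p \<in> S}"
      using sub by (auto simp: space_restrict_space)
    ultimately show "h -` S \<inter> space (restrict_space (borel_sigma X) (fst c)) \<in> sets (restrict_space (borel_sigma X) (fst c))"
      using op sub by (subst sets_restrict_space_iff) auto
  qed
  then show ?thesis using op sub by (subst (asm) borel_measurable_restrict_space_iff) auto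
qed

text \<open>The doubled radius leaves room: the square of side 2 r around the ball of radius r still
  lies in the chart image.\<close>

lemma finite_ball_cover:
  "\<exists>n cs a r. (\<forall>i<n::nat. cs i \<in> A \<and> 0 < (r i :: real) \<and> cball (a i) (2 * r i) \<subseteq> chart_image (cs i)) \<and>
     topspace X = (\<Union>i<n. coord_inv (cs i) ` ball (a i) (r i))"
proof -
  define \<U> where "\<U> = {(c, x, r). c \<in> A \<and> 0 < (r::real) \<and> cball x (2 * r) \<subseteq> chart_image c}"
  define S where "S = (\<lambda>(c, x, r). coord_inv c ` ball x r :: 'a set)"
  have op: "openin X U" if U: "U \<in> S ` \<U>" for U
  proof -
    obtain c x r where "c \<in> A" "0 < r" "cball x (2 * r) \<subseteq> chart_image c" "U = coord_inv c ` ball x r"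
      using U by (auto simp: \<U>_def S_def)
    moreover have "ball x r \<subseteq> cball x (2 * r)" using \<open>0 < r\<close> by auto
    ultimately show ?thesis using openin_coord_inv_image[OF chart] by (metis open_ball subset_trans)
  qed
  have cov: "topspace X \<subseteq> \<Union>(S ` \<U>)"
  proof
    fix p assume "p \<in> topspace X"
    then obtain c where c: "c \<in> A" "p \<in> fst c" using ex_chart by blast
    then obtain e where e: "0 < e" "cball (snd c p) e \<subseteq> chart_image c"
      using chart_open[OF chart] open_contains_cball by blast
    have "(c, snd c p, e / 2) \<in> \<U>" using c e by (simp add: \<U>_def)
    moreover have "p \<in> S (c, snd c p, e / 2)"
    proof -
      have "snd c p \<in> ball (snd c p) (e / 2)" using e by simp
      from imageI[OF this, of "coord_inv c"] show ?thesis
        using coord_inv_left[OF chart[OF c(1)] c(2)] by (simp add: S_def)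
    qed
    ultimately show "p \<in> \<Union>(S ` \<U>)" by blast
  qed
  have "compactin X (topspace X)" using compact by (simp add: compact_space_def)
  then obtain \<F> where F: "finite \<F>" "\<F> \<subseteq> S ` \<U>" "topspace X \<subseteq> \<Union>\<F>"
    using compactinD[OF _ op cov] by meson
  obtain C where C: "C \<subseteq> \<U>" "finite C" "\<F> = S ` C" using finite_subset_image[OF F(1,2)] by blast
  obtain n t where t: "C = t ` {i::nat. i < n}" using finite_imp_nat_seg_image_inj_on[OF C(2)] by blast
  have ti: "t i \<in> \<U>" if "i < n" for i using C t that by blast
  have "topspace X = (\<Union>i<n. S (t i))"
  proof
    show "topspace X \<subseteq> (\<Union>i<n. S (t i))" using F(3) unfolding C(3) t by auto
    have "S (t i) \<subseteq> topspace X" if "i < n" for i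
      using openin_subset[OF op[OF imageI[OF ti[OF that]]]] .
    then show "(\<Union>i<n. S (t i)) \<subseteq> topspace X" by blast
  qed
  moreover have "S (t i) = coord_inv (fst (t i)) ` ball (fst (snd (t i))) (snd (snd (t i)))" for i
    by (simp add: S_def case_prod_beta)
  moreover have "fst (t i) \<in> A \<and> 0 < snd (snd (t i)) \<and> cball (fst (snd (t i))) (2 * snd (snd (t i))) \<subseteq> chart_image (fst (t i))"
    if "i < n" for i using ti[OF that] by (auto simp: \<U>_def)
  ultimately show ?thesis
    by (intro exI[of _ n] exI[of _ "\<lambda>i. fst (t i)"] exI[of _ "\<lambda>i. fst (snd (t i))"] exI[of _ "\<lambda>i. snd (snd (t i))"]) auto
qed

lemma coord_inv_compact_measurable:
  assumes "c \<in> A" "K \<subseteq> chart_image c" "compact K"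
  shows "coord_inv c ` K \<in> sets (borel_sigma X)" "closedin X (coord_inv c ` K)"
proof -
  show "closedin X (coord_inv c ` K)"
    using compactin_coord_inv_image[OF chart[OF assms(1)] assms(2,3)] Hausdorff compactin_imp_closedin by blast
  then show "coord_inv c ` K \<in> sets (borel_sigma X)" by (rule closedin_borel_sigma)
qed

lemma finite_measure_dx: "finite_measure dx"
proof
  obtain n cs a r where c: "\<And>i. i < (n::nat) \<Longrightarrow> cs i \<in> A \<and> 0 < (r i :: real) \<and> cball (a i) (2 * r i) \<subseteq> chart_image (cs i)"
    and cov: "topspace X = (\<Union>i<n. coord_inv (cs i) ` ball (a i) (r i))"
    using finite_ball_cover by blast
  define K where "K = (\<lambda>i. coord_inv (cs i) ` cball (a i) (2 * r i))"
  have Ks: "K i \<in> sets dx" if "i < n" for i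
    using coord_inv_compact_measurable(1)[of "cs i" "cball (a i) (2 * r i)"] c[OF that] by (simp add: K_def)
  have fin: "emeasure dx (K i) < \<infinity>" if i: "i < n" for i
  proof -
    note ci = c[OF i]
    have sub: "K i \<subseteq> fst (cs i)" using ci coord_inv_mem[OF chart] unfolding K_def by blast
    have im: "snd (cs i) ` K i = cball (a i) (2 * r i)"
      unfolding K_def using ci coord_inv_image[OF chart] by blast
    let ?d = "\<lambda>x. area_density g (cs i) (coord_inv (cs i) x)"
    have cd: "continuous_on (cball (a i) (2 * r i)) ?d"
      using ci by (blast intro: continuous_on_subset C1_onD(3)[OF area_density_C1])
    have "emeasure dx (K i) = (\<integral>\<^sup>+x\<in>cball (a i) (2 * r i). ennreal (?d x) \<partial>lborel)"
      using emeasure_dx[of "cs i" "K i"] Ks[OF i] sub ci im by simp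
    also have "\<dots> = (\<integral>\<^sup>+x. ennreal (indicator (cball (a i) (2 * r i)) x *\<^sub>R ?d x) \<partial>lborel)"
      by (intro nn_integral_cong) (auto simp: indicator_def)
    also have "\<dots> < \<infinity>"
    proof -
      have "integrable lborel (\<lambda>x. indicator (cball (a i) (2 * r i)) x *\<^sub>R ?d x)"
        by (rule borel_integrable_compact[OF _ cd]) auto
      then have "(\<integral>\<^sup>+x. ennreal (indicator (cball (a i) (2 * r i)) x *\<^sub>R ?d x) \<partial>lborel) \<noteq> \<infinity>"
        unfolding real_integrable_def by blast
      then show ?thesis by (simp add: less_top)
    qed
    finally show ?thesis .
  qed
  have "emeasure dx (space dx) \<le> emeasure dx (\<Union>i<n. K i)"
  proof (rule emeasure_mono)
    show "space dx \<subseteq> (\<Union>i<n. K i)" unfolding space_dx cov K_def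
    proof (intro UN_mono image_mono order_refl)
      show "ball (a i) (r i) \<subseteq> cball (a i) (2 * r i)" if "i \<in> {..<n}" for i
        using c[of i] that by auto
    qed
    show "(\<Union>i<n. K i) \<in> sets dx" using Ks by blast
  qed
  also have "\<dots> \<le> (\<Sum>i<n. emeasure dx (K i))"
    using Ks by (intro emeasure_subadditive_finite) auto
  also have "\<dots> < \<infinity>" using fin by (simp add: less_top[symmetric])
  finally show "emeasure dx (space dx) \<noteq> \<infinity>" by simp
qed

lemma continuous_bounded:
  fixes h :: "'a \<Rightarrow> real"
  assumes "continuous_map X euclidean h"
  shows "\<exists>B. \<forall>p\<in>topspace X. \<bar>h p\<bar> \<le> B"
proof -
  have "compactin euclidean (h ` topspace X)"
    using assms compact image_compactin unfolding compact_space_def by blast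
  then have "bounded (h ` topspace X)" by (simp add: compact_imp_bounded)
  then show ?thesis by (auto simp: bounded_iff)
qed

lemma continuous_integrable:
  fixes h :: "'a \<Rightarrow> real"
  assumes "continuous_map X euclidean h"
  shows "integrable dx h"
proof -
  interpret finite_measure dx by (rule finite_measure_dx)
  obtain B where "\<forall>p\<in>topspace X. \<bar>h p\<bar> \<le> B" using continuous_bounded[OF assms] by blast
  then show ?thesis
    using continuous_map_borel_measurable[OF assms] by (intro integrable_const_bound[of _ B]) auto
qed

end

section \<open>Green's formula\<close>

lemma max_0_square_derivative:
  "((\<lambda>s::real. (max 0 s)\<^sup>2) has_real_derivative 2 * max 0 s) (at s)"
proof -
  consider "s < 0" | "s > 0" | "s = 0" by linarith
  then show ?thesis
  proof cases
    case 1
    have "((\<lambda>_. 0::real) has_real_derivative 2 * max 0 s) (at s)" using 1 by simp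
    then show ?thesis
      by (rule has_field_derivative_transform_within_open[of _ _ _ "{..<0}"]) (use 1 in auto)
  next
    case 2
    have "((\<lambda>s. s\<^sup>2) has_real_derivative 2 * max 0 s) (at s)" using 2 by (auto intro!: derivative_eq_intros)
    then show ?thesis
      by (rule has_field_derivative_transform_within_open[of _ _ _ "{0<..}"]) (use 2 in auto)
  next
    case 3
    have "((\<lambda>h::real. (max 0 h)\<^sup>2 / h) \<longlongrightarrow> 0) (at 0)"
    proof (rule Lim_null_comparison)
      show "\<forall>\<^sub>F h in at 0. norm ((max 0 h)\<^sup>2 / h) \<le> \<bar>h::real\<bar>"
        by (intro always_eventually allI) (auto simp: max_def power2_eq_square)
      show "((\<lambda>h::real. \<bar>h\<bar>) \<longlongrightarrow> 0) (at 0)" using tendsto_rabs[OF tendsto_ident_at, of 0 UNIV] by simp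
    qed
    then show ?thesis using 3 by (simp add: DERIV_def)
  qed
qed

text \<open>Squaring the positive part gives one continuous derivative across the sphere, which is
  as much as a test function in Green's formula has to have.\<close>

definition bump :: "'b::real_inner \<Rightarrow> real \<Rightarrow> 'b \<Rightarrow> real" where
  "bump a r x = (max 0 (r\<^sup>2 - (norm (x - a))\<^sup>2))\<^sup>2"

lemma bump_nonneg: "0 \<le> bump a r x"
  by (simp add: bump_def)

lemma bump_pos: "x \<in> ball a r \<Longrightarrow> 0 < bump a r x"
proof -
  assume "x \<in> ball a r"
  then have "norm (x - a) < r" by (simp add: dist_norm norm_minus_commute)
  then have "(norm (x - a))\<^sup>2 < r\<^sup>2" by (intro power_strict_mono) auto
  then show ?thesis by (simp add: bump_def)
qed

lemma bump_zero: "0 < r \<Longrightarrow> x \<notin> ball a r \<Longrightarrow> bump a r x = 0"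
proof -
  assume "0 < r" "x \<notin> ball a r"
  then have "r \<le> norm (x - a)" by (simp add: dist_norm norm_minus_commute)
  then have "r\<^sup>2 \<le> (norm (x - a))\<^sup>2" using \<open>0 < r\<close> by (intro power_mono) auto
  then show ?thesis by (simp add: bump_def max_def)
qed

lemma bump_C1: "C1_on S (bump a r)"
proof -
  have "C1_on S (\<lambda>x. r\<^sup>2 - (norm (x - a))\<^sup>2)"
  proof (rule C1_onI)
    show "((\<lambda>x. r\<^sup>2 - (norm (x - a))\<^sup>2) has_derivative (\<lambda>v. (- 2 *\<^sub>R (x - a)) \<bullet> v)) (at x)" for x
      unfolding power2_norm_eq_inner
      by (auto intro!: derivative_eq_intros simp: inner_commute algebra_simps)
  qed (intro continuous_intros)
  then show ?thesis unfolding bump_def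
    by (rule C1_on_chain[where p' = "\<lambda>s. 2 * max 0 s"]) (auto intro!: max_0_square_derivative continuous_intros)
qed

lemma integrable_indicator_compact_support:
  fixes k :: "'b::euclidean_space \<Rightarrow> real"
  assumes "continuous_on \<Omega> k" "compact K" "K \<subseteq> \<Omega>" "\<And>x. x \<in> \<Omega> \<Longrightarrow> x \<notin> K \<Longrightarrow> k x = 0"
  shows "integrable lborel (\<lambda>x. indicator \<Omega> x *\<^sub>R k x)"
proof -
  have "(\<lambda>x. indicator \<Omega> x *\<^sub>R k x) = (\<lambda>x. indicator K x *\<^sub>R k x)"
    using assms by (auto simp: fun_eq_iff indicator_def)
  then show ?thesis
    using borel_integrable_compact[OF assms(2) continuous_on_subset[OF assms(1,3)]] by simp
qed

context closed_riemannian_surface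
begin

lemma coord_inv_image_subset:
  assumes "c \<in> A" "K \<subseteq> chart_image c"
  shows "coord_inv c ` K \<subseteq> fst c"
proof
  fix p assume "p \<in> coord_inv c ` K"
  then obtain x where "x \<in> K" "p = coord_inv c x" by (rule imageE)
  then show "p \<in> fst c" using coord_inv_mem[OF chart[OF assms(1)] subsetD[OF assms(2)]] by simp
qed

lemma mem_coord_inv_image:
  assumes "c \<in> A" "K \<subseteq> chart_image c" "x \<in> chart_image c" "coord_inv c x \<in> coord_inv c ` K"
  shows "x \<in> K"
proof -
  obtain y where y: "coord_inv c x = coord_inv c y" "y \<in> K" using assms(4) by (rule imageE)
  have "snd c (coord_inv c x) = x" by (rule coord_inv_right[OF chart[OF assms(1)] assms(3)])
  moreover have "snd c (coord_inv c y) = y"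
    by (rule coord_inv_right[OF chart[OF assms(1)] subsetD[OF assms(2) y(2)]])
  ultimately have "x = y" using y(1) by metis
  then show ?thesis using y(2) by simp
qed

lemma transition_subset:
  assumes "c \<in> A"
  shows "transition c d ` overlap c d \<subseteq> chart_image d"
proof (rule image_subsetI)
  fix x assume "x \<in> overlap c d"
  then have "coord_inv c x \<in> fst d" using overlap_coord_inv(1)[OF assms] by blast
  then show "transition c d x \<in> chart_image d" by (simp add: transition_apply)
qed

section \<open>Functions on the surface and the Dirichlet form\<close>

definition C1_fun :: "('a \<Rightarrow> real) \<Rightarrow> bool" where
  "C1_fun u \<longleftrightarrow> (\<forall>c\<in>A. C1_on (chart_image c) (\<lambda>x. u (coord_inv c x)))"

definition C2_fun :: "('a \<Rightarrow> real) \<Rightarrow> bool" where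
  "C2_fun v \<longleftrightarrow> C1_fun v \<and> (\<forall>c\<in>A. \<forall>j. C1_on (chart_image c) (partial_deriv j (\<lambda>x. v (coord_inv c x))))"

lemma C1_funD: "C1_fun u \<Longrightarrow> c \<in> A \<Longrightarrow> C1_on (chart_image c) (\<lambda>x. u (coord_inv c x))"
  by (simp add: C1_fun_def)

lemma C1_fun_continuous: "C1_fun u \<Longrightarrow> continuous_map X euclidean u"
  by (intro continuous_mapI_charts C1_onD(3) C1_funD)

lemma C1_fun_const: "C1_fun (\<lambda>_. k)"
  by (simp add: C1_fun_def C1_on_const)

lemma C1_fun_add: "C1_fun u \<Longrightarrow> C1_fun v \<Longrightarrow> C1_fun (\<lambda>p. u p + v p)"
  by (simp add: C1_fun_def C1_on_add)

lemma C1_fun_mult: "C1_fun u \<Longrightarrow> C1_fun v \<Longrightarrow> C1_fun (\<lambda>p. u p * v p)"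
  by (simp add: C1_fun_def C1_on_mult)

lemma C1_fun_sum: "(\<And>i. i \<in> I \<Longrightarrow> C1_fun (u i)) \<Longrightarrow> C1_fun (\<lambda>p. \<Sum>i\<in>I. u i p)"
  by (simp add: C1_fun_def C1_on_sum)

lemma C1_fun_divide:
  assumes "C1_fun u" "C1_fun v" "\<And>p. p \<in> topspace X \<Longrightarrow> v p \<noteq> 0"
  shows "C1_fun (\<lambda>p. u p / v p)"
  unfolding C1_fun_def
  by (intro ballI C1_on_divide C1_funD assms) (auto intro: chart_in_space coord_inv_mem[OF chart])

definition grad_chart :: "'a chart \<Rightarrow> ('a \<Rightarrow> real) \<Rightarrow> 'a \<Rightarrow> real^2" where
  "grad_chart c u p = grad (\<lambda>x. u (coord_inv c x)) (snd c p)"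

lemma chart_differentiable:
  "C1_fun u \<Longrightarrow> c \<in> A \<Longrightarrow> p \<in> fst c \<Longrightarrow> (\<lambda>x. u (coord_inv c x)) differentiable (at (snd c p))"
  using C1_funD[of u c] by (auto simp: C1_on_def)

lemma grad_chart_transform:
  assumes u: "C1_fun u" and cd: "c \<in> A" "d \<in> A" and p: "p \<in> fst c \<inter> fst d"
  shows "grad_chart c u p = transpose (jacobian c d p) *v grad_chart d u p"
proof -
  have x: "snd c p \<in> overlap c d" using p by (auto simp: overlap_def)
  have dp: "transition c d (snd c p) = snd d p"
    using coord_inv_left[OF chart[OF cd(1)]] p by (simp add: transition_apply)
  have "grad (\<lambda>x. u (coord_inv d (transition c d x))) (snd c p) = grad (\<lambda>x. u (coord_inv c x)) (snd c p)"
    by (rule grad_cong[OF overlap_open[OF cd] x])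
      (use coord_inv_transition[OF cd] chart_differentiable[OF u cd(1)] p in auto)
  moreover have "grad (\<lambda>x. u (coord_inv d (transition c d x))) (snd c p)
     = transpose (jacobian c d p) *v grad (\<lambda>x. u (coord_inv d x)) (transition c d (snd c p))"
    unfolding jacobian_def
    by (rule grad_compose[OF transition_derivative[OF cd x]])
      (use chart_differentiable[OF u cd(2)] p dp in auto)
  ultimately show ?thesis by (simp add: grad_chart_def dp)
qed

text \<open>The inner product of the differentials of u and v, computed in the chart c with the
  inverse metric.\<close>

definition gamma :: "'a chart \<Rightarrow> ('a \<Rightarrow> real) \<Rightarrow> ('a \<Rightarrow> real) \<Rightarrow> 'a \<Rightarrow> real" where
  "gamma c u v p = grad_chart c u p \<bullet> (matrix_inv (g c p) *v grad_chart c v p)"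

definition energy :: "('a \<Rightarrow> real) \<Rightarrow> ('a \<Rightarrow> real) \<Rightarrow> 'a \<Rightarrow> real" where
  "energy u v p = gamma (SOME c. c \<in> A \<and> p \<in> fst c) u v p"

lemma gamma_indep:
  assumes "C1_fun u" "C1_fun v" "c \<in> A" "d \<in> A" "p \<in> fst c" "p \<in> fst d"
  shows "gamma c u v p = gamma d u v p"
proof -
  have p: "p \<in> fst c \<inter> fst d" using assms by simp
  have "det (g c p) \<noteq> 0" using metric_det[OF assms(3,5)] by simp
  from cometric_transform[OF metric_transform[OF assms(3,4) p] this] show ?thesis
    unfolding gamma_def grad_chart_transform[OF assms(1,3,4) p] grad_chart_transform[OF assms(2,3,4) p] .
qed

lemma energy_eq:
  assumes "C1_fun u" "C1_fun v" "c \<in> A" "p \<in> fst c"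
  shows "energy u v p = gamma c u v p"
proof -
  let ?d = "SOME c. c \<in> A \<and> p \<in> fst c"
  have "?d \<in> A \<and> p \<in> fst ?d" by (rule someI[of _ c]) (use assms in auto)
  then show ?thesis unfolding energy_def using gamma_indep assms by blast
qed

lemma gamma_sum:
  "gamma c u v p = (\<Sum>i\<in>UNIV. \<Sum>j\<in>UNIV. grad_chart c u p $ i * (matrix_inv (g c p) $ i $ j * grad_chart c v p $ j))"
  by (simp add: gamma_def inner_vec_def matrix_vector_mult_def sum_distrib_left)

lemma grad_chart_continuous:
  assumes "C1_fun u" "c \<in> A"
  shows "continuous_on (chart_image c) (\<lambda>x. grad_chart c u (coord_inv c x))"
  using C1_onD(2)[OF C1_funD[OF assms]] coord_inv_right[OF chart[OF assms(2)]]
  by (simp add: grad_chart_def cong: continuous_on_cong)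

lemma gamma_continuous:
  assumes "C1_fun u" "C1_fun v" "c \<in> A"
  shows "continuous_on (chart_image c) (\<lambda>x. gamma c u v (coord_inv c x))"
  unfolding gamma_sum
  by (intro continuous_on_sum continuous_on_mult continuous_on_component grad_chart_continuous assms
      C1_onD(3)[OF cometric_C1])

lemma energy_continuous:
  assumes "C1_fun u" "C1_fun v"
  shows "continuous_map X euclidean (energy u v)"
proof (rule continuous_mapI_charts)
  fix c assume c: "c \<in> A"
  have "energy u v (coord_inv c x) = gamma c u v (coord_inv c x)" if "x \<in> chart_image c" for x
    by (rule energy_eq[OF assms c coord_inv_mem[OF chart[OF c] that]])
  then show "continuous_on (chart_image c) (\<lambda>x. energy u v (coord_inv c x))"
    using gamma_continuous[OF assms c] by (simp cong: continuous_on_cong)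
qed

lemma energy_add:
  assumes "C1_fun u" "C1_fun v" "C1_fun w" "p \<in> topspace X"
  shows "energy (\<lambda>p. u p + v p) w p = energy u w p + energy v w p"
proof -
  obtain c where c: "c \<in> A" "p \<in> fst c" using ex_chart assms by blast
  have "grad_chart c (\<lambda>p. u p + v p) p = grad_chart c u p + grad_chart c v p"
    unfolding grad_chart_def by (intro grad_add chart_differentiable assms c)
  then show ?thesis
    using assms c by (simp add: energy_eq[of _ _ c] C1_fun_add gamma_def inner_add_left)
qed

lemma energy_cmul:
  assumes "C1_fun u" "C1_fun w" "p \<in> topspace X"
  shows "energy (\<lambda>p. k * u p) w p = k * energy u w p"
proof -
  obtain c where c: "c \<in> A" "p \<in> fst c" using ex_chart assms by blast
  have "grad_chart c (\<lambda>p. k * u p) p = k *\<^sub>R grad_chart c u p"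
    unfolding grad_chart_def by (intro grad_cmul chart_differentiable assms c)
  moreover have "C1_fun (\<lambda>p. k * u p)" using C1_fun_mult[OF C1_fun_const assms(1)] .
  ultimately show ?thesis
    using assms c by (simp add: energy_eq[of _ _ c] gamma_def)
qed

lemma energy_sum:
  assumes "\<And>i. i \<in> I \<Longrightarrow> C1_fun (u i)" "C1_fun w" "p \<in> topspace X" "finite I"
  shows "energy (\<lambda>p. \<Sum>i\<in>I. u i p) w p = (\<Sum>i\<in>I. energy (u i) w p)"
  using assms(4,1)
proof (induction I rule: finite_induct)
  case empty
  then show ?case using energy_cmul[OF C1_fun_const assms(2,3), of 0 0] by simp
next
  case (insert i I)
  then show ?case using assms by (simp add: energy_add C1_fun_sum)
qed

lemma energy_sym:
  assumes "C1_fun u" "C1_fun v" "p \<in> topspace X"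
  shows "energy u v p = energy v u p"
proof -
  obtain c where c: "c \<in> A" "p \<in> fst c" using ex_chart assms by blast
  have "matrix_inv (g c p) $ 1 $ 2 = matrix_inv (g c p) $ 2 $ 1"
    using posdef_2x2(4) metric_sym[OF c] metric_pos[OF c] by blast
  then have "gamma c u v p = gamma c v u p" by (simp add: gamma_sum sum_2 algebra_simps)
  then show ?thesis using assms c by (simp add: energy_eq[of _ _ c])
qed

text \<open>Compares the Riemannian energy with the Euclidean gradient in a chart, for which the
  Poincare inequality is available.\<close>

lemma energy_lower_bound:
  assumes "C1_fun u" "c \<in> A" "p \<in> fst c"
  shows "(norm (grad_chart c u p))\<^sup>2 \<le> (g c p $ 1 $ 1 + g c p $ 2 $ 2) * energy u u p"
    "0 < g c p $ 1 $ 1 + g c p $ 2 $ 2"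
proof -
  show "(norm (grad_chart c u p))\<^sup>2 \<le> (g c p $ 1 $ 1 + g c p $ 2 $ 2) * energy u u p"
    unfolding energy_eq[OF assms(1,1,2,3)] gamma_def
    using posdef_2x2_inv metric_sym[OF assms(2,3)] metric_pos[OF assms(2,3)] by blast
  show "0 < g c p $ 1 $ 1 + g c p $ 2 $ 2"
    using posdef_2x2_trace metric_sym[OF assms(2,3)] metric_pos[OF assms(2,3)] by blast
qed

lemma energy_nonneg:
  assumes "C1_fun u" "p \<in> topspace X"
  shows "0 \<le> energy u u p"
proof -
  obtain c where c: "c \<in> A" "p \<in> fst c" using ex_chart assms by blast
  have "0 \<le> (norm (grad_chart c u p))\<^sup>2" by simp
  also note energy_lower_bound(1)[OF assms(1) c]
  finally show ?thesis using energy_lower_bound(2)[OF assms(1) c] by (simp add: zero_le_mult_iff)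
qed

lemma grad_chart_zero:
  assumes d: "d \<in> A" "p \<in> fst d" and U: "openin X U" "p \<in> U" "\<And>q. q \<in> U \<Longrightarrow> \<psi> q = 0"
  shows "grad_chart d \<psi> p = 0"
proof -
  define W where "W = snd d ` (U \<inter> fst d)"
  have "openin X (U \<inter> fst d)" using U(1) chart_openin[OF chart[OF d(1)]] by blast
  then have "open W" unfolding W_def using chart_open_iff[OF chart[OF d(1)], of "U \<inter> fst d"] by simp
  have "grad (\<lambda>x. \<psi> (coord_inv d x)) (snd d p) = grad (\<lambda>_. 0) (snd d p)"
  proof (rule grad_cong(1)[OF \<open>open W\<close>])
    show "snd d p \<in> W" using U d by (auto simp: W_def)
    show "0 = \<psi> (coord_inv d y)" if "y \<in> W" for y
      using that U(3) coord_inv_left[OF chart[OF d(1)]] by (auto simp: W_def)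
  qed auto
  also have "\<dots> = 0" by (rule grad_unique) simp
  finally show ?thesis by (simp add: grad_chart_def)
qed

lemma energy_zero:
  assumes \<psi>: "C1_fun \<psi>" and v: "C1_fun v" and cl: "closedin X C" and p: "p \<in> topspace X" "p \<notin> C"
    and zero: "\<And>q. q \<in> topspace X \<Longrightarrow> q \<notin> C \<Longrightarrow> \<psi> q = 0"
  shows "energy \<psi> v p = 0"
proof -
  obtain d where d: "d \<in> A" "p \<in> fst d" using ex_chart p by blast
  have "grad_chart d \<psi> p = 0"
    by (rule grad_chart_zero[OF d, of "topspace X - C"]) (use cl p zero in auto)
  then show ?thesis using energy_eq[OF \<psi> v d] by (simp add: gamma_def)
qed

section \<open>Green's formula in one chart\<close>

text \<open>One term of the vector field whose divergence gives the Laplacian; with i and j kept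
  apart, integration by parts acts on each term separately.\<close>

definition flux :: "'a chart \<Rightarrow> ('a \<Rightarrow> real) \<Rightarrow> 2 \<Rightarrow> 2 \<Rightarrow> real^2 \<Rightarrow> real" where
  "flux c v i j x = area_density g c (coord_inv c x) * matrix_inv (g c (coord_inv c x)) $ i $ j *
     partial_deriv j (\<lambda>x. v (coord_inv c x)) x"

lemma flux_C1: "c \<in> A \<Longrightarrow> C2_fun v \<Longrightarrow> C1_on (chart_image c) (flux c v i j)"
  unfolding flux_def
  by (intro C1_on_mult area_density_C1 cometric_C1) (auto simp: C2_fun_def)

lemma laplace_in_chart_flux:
  "laplace_in_chart g c v p =
    - (1 / area_density g c p) * (\<Sum>i\<in>UNIV. \<Sum>j\<in>UNIV. partial_deriv i (flux c v i j) (snd c p))"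
  by (simp add: laplace_in_chart_def flux_def[abs_def] o_def)

lemma laplace_continuous:
  assumes "c \<in> A" "C2_fun v"
  shows "continuous_on (chart_image c) (\<lambda>x. laplace_in_chart g c v (coord_inv c x))"
proof -
  have "continuous_on (chart_image c) (\<lambda>x. - (1 / area_density g c (coord_inv c x)) *
      (\<Sum>i\<in>UNIV. \<Sum>j\<in>UNIV. grad (flux c v i j) x $ i))"
    using area_density_pos[OF assms(1) coord_inv_mem[OF chart[OF assms(1)]]]
    by (intro continuous_on_mult continuous_on_minus continuous_on_divide continuous_on_const continuous_on_sum
        continuous_on_component C1_onD(2)[OF flux_C1[OF assms]] C1_onD(3)[OF area_density_C1[OF assms(1)]]) force
  moreover have "- (1 / area_density g c (coord_inv c x)) *
      (\<Sum>i\<in>UNIV. \<Sum>j\<in>UNIV. grad (flux c v i j) x $ i) = laplace_in_chart g c v (coord_inv c x)"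
    if "x \<in> chart_image c" for x
    unfolding laplace_in_chart_flux coord_inv_right[OF chart[OF assms(1)] that] by (simp add: grad_def)
  ultimately show ?thesis by (simp cong: continuous_on_cong)
qed

text \<open>Multiplied by the area density, the integrand is the sum over i and j of the i-th
  derivatives of \<psi> times \<open>flux c v i j\<close>; each has compact support and integrates
  to zero. The statement uses the local expression in c, whose independence of the chart will be
  derived from it.\<close>

lemma
  assumes c: "c \<in> A" and \<psi>: "C1_fun \<psi>" and v: "C2_fun v" and K: "compact K" "K \<subseteq> chart_image c"
    and supp: "\<And>p. p \<in> topspace X \<Longrightarrow> p \<notin> coord_inv c ` K \<Longrightarrow> \<psi> p = 0"
  defines "T \<equiv> \<lambda>p. indicator (fst c) p * (gamma c \<psi> v p - \<psi> p * laplace_in_chart g c v p)"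
  shows local_green_integrable: "integrable dx T" and local_green: "(\<integral>p. T p \<partial>dx) = 0"
proof -
  define h where "h = (\<lambda>p. gamma c \<psi> v p - \<psi> p * laplace_in_chart g c v p)"
  have v1: "C1_fun v" using v by (simp add: C2_fun_def)
  have hc: "continuous_on (chart_image c) (\<lambda>x. h (coord_inv c x))"
    unfolding h_def
    by (intro continuous_on_diff continuous_on_mult gamma_continuous laplace_continuous C1_onD(3)[OF C1_funD] c \<psi> v v1)
  have T: "T = (\<lambda>p. indicator (fst c) p * h p)" by (simp add: T_def h_def)
  have Tm: "T \<in> borel_measurable (borel_sigma X)" unfolding T by (rule chart_local_measurable[OF c hc])
  have KX: "closedin X (coord_inv c ` K)" using coord_inv_compact_measurable(2)[OF c K(2,1)] .
  have g0: "grad_chart c \<psi> p = 0" if "p \<in> fst c" "p \<notin> coord_inv c ` K" for p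
    by (rule grad_chart_zero[OF c that(1), of "topspace X - coord_inv c ` K"])
      (use KX that supp chart_in_space[OF c] in auto)
  have T0: "T p = 0" if "p \<in> topspace X" "p \<notin> coord_inv c ` K" for p
    using g0[of p] supp[OF that] that by (auto simp: T h_def gamma_def indicator_def)
  have "compact ((\<lambda>x. h (coord_inv c x)) ` K)"
    by (rule compact_continuous_image[OF continuous_on_subset[OF hc K(2)] K(1)])
  then have "bounded ((\<lambda>x. h (coord_inv c x)) ` K)" by (rule compact_imp_bounded)
  then obtain B where B: "\<forall>x\<in>K. \<bar>h (coord_inv c x)\<bar> \<le> B" by (auto simp: bounded_iff)
  have TB: "\<bar>T p\<bar> \<le> max B 0" if p: "p \<in> topspace X" for p
  proof (cases "p \<in> coord_inv c ` K")
    case True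
    then have "\<bar>h p\<bar> \<le> B" using B by blast
    then show ?thesis by (auto simp: T indicator_def)
  qed (use T0 p in auto)
  interpret finite_measure dx by (rule finite_measure_dx)
  show "integrable dx T"
    by (rule integrable_const_bound[of _ "max B 0"]) (use TB Tm in auto)
  define \<psi>' where "\<psi>' = (\<lambda>x. \<psi> (coord_inv c x))"
  have \<psi>': "C1_on (chart_image c) \<psi>'" unfolding \<psi>'_def by (rule C1_funD[OF \<psi> c])
  have \<psi>'0: "\<psi>' x = 0" "grad \<psi>' x = 0" if "x \<in> chart_image c" "x \<notin> K" for x
  proof -
    have n: "coord_inv c x \<in> fst c" "coord_inv c x \<notin> coord_inv c ` K"
      using mem_coord_inv_image[OF c K(2)] that coord_inv_mem[OF chart[OF c]] by auto
    then show "\<psi>' x = 0" unfolding \<psi>'_def using supp chart_in_space[OF c] by blast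
    show "grad \<psi>' x = 0"
      using g0[OF n] coord_inv_right[OF chart[OF c] that(1)] by (simp add: grad_chart_def \<psi>'_def)
  qed
  define k where "k = (\<lambda>i j x. \<psi>' x * partial_deriv i (flux c v i j) x + flux c v i j x * partial_deriv i \<psi>' x)"
  have kc: "continuous_on (chart_image c) (k i j)" for i j
  proof -
    have "continuous_on (chart_image c) (\<lambda>x. \<psi>' x * grad (flux c v i j) x $ i + flux c v i j x * grad \<psi>' x $ i)"
      by (intro continuous_on_add continuous_on_mult continuous_on_component C1_onD[OF \<psi>'] C1_onD[OF flux_C1[OF c v]])
    then show ?thesis by (simp add: k_def grad_def)
  qed
  have ki: "integrable lborel (\<lambda>x. indicator (chart_image c) x *\<^sub>R k i j x)" for i j
  proof (rule integrable_indicator_compact_support[OF kc K])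
    fix x assume x: "x \<in> chart_image c" "x \<notin> K"
    have "partial_deriv i \<psi>' x = grad \<psi>' x $ i" by (simp add: grad_def)
    then show "k i j x = 0" using \<psi>'0[OF x] by (simp add: k_def)
  qed
  have kz: "(\<integral>x. indicator (chart_image c) x *\<^sub>R k i j x \<partial>lborel) = 0" for i j
    unfolding k_def
    by (rule integral_partial_deriv_product_eq_0[OF \<psi>' flux_C1[OF c v] chart_open[OF chart[OF c]] K]) (rule \<psi>'0)
  have "(\<integral>p. T p \<partial>dx) = (\<integral>p. indicator (fst c) p * T p \<partial>dx)"
    by (intro Bochner_Integration.integral_cong) (auto simp: T indicator_def)
  also have "\<dots> = (\<integral>x. indicator (chart_image c) x *\<^sub>R (area_density g c (coord_inv c x) * T (coord_inv c x)) \<partial>lborel)"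
    by (rule integral_chart[OF c Tm])
  also have "\<dots> = (\<integral>x. (\<Sum>i\<in>UNIV. \<Sum>j\<in>UNIV. indicator (chart_image c) x *\<^sub>R k i j x) \<partial>lborel)"
  proof (intro Bochner_Integration.integral_cong refl)
    fix x
    show "indicator (chart_image c) x *\<^sub>R (area_density g c (coord_inv c x) * T (coord_inv c x)) =
       (\<Sum>i\<in>UNIV. \<Sum>j\<in>UNIV. indicator (chart_image c) x *\<^sub>R k i j x)"
    proof (cases "x \<in> chart_image c")
      case True
      let ?p = "coord_inv c x"
      have p: "?p \<in> fst c" "snd c ?p = x"
        using coord_inv_mem[OF chart[OF c] True] coord_inv_right[OF chart[OF c] True] by auto
      have \<rho>: "area_density g c ?p \<noteq> 0" using area_density_pos[OF c p(1)] by simp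
      have 1: "area_density g c ?p * gamma c \<psi> v ?p = (\<Sum>i\<in>UNIV. \<Sum>j\<in>UNIV. flux c v i j x * partial_deriv i \<psi>' x)"
        unfolding gamma_sum grad_chart_def p(2) flux_def sum_distrib_left
        by (intro sum.cong refl) (simp add: grad_def \<psi>'_def mult_ac)
      have 2: "area_density g c ?p * (\<psi> ?p * laplace_in_chart g c v ?p)
          = - (\<Sum>i\<in>UNIV. \<Sum>j\<in>UNIV. \<psi>' x * partial_deriv i (flux c v i j) x)"
        unfolding laplace_in_chart_flux p(2) sum_distrib_left[symmetric] using \<rho> by (simp add: \<psi>'_def)
      have "area_density g c ?p * h ?p = (\<Sum>i\<in>UNIV. \<Sum>j\<in>UNIV. k i j x)"
        unfolding h_def right_diff_distrib 1 2 k_def by (simp add: sum.distrib)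
      then show ?thesis using True p by (simp add: T)
    qed simp
  qed
  also have "\<dots> = (\<Sum>i\<in>UNIV. \<Sum>j\<in>UNIV. \<integral>x. indicator (chart_image c) x *\<^sub>R k i j x \<partial>lborel)"
    using ki by (simp only: Bochner_Integration.integral_sum Bochner_Integration.integrable_sum)
  also have "\<dots> = 0" by (simp only: kz sum.neutral_const)
  finally show "(\<integral>p. T p \<partial>dx) = 0" .
qed

section \<open>Cut-off functions on the surface and independence of the chart\<close>

definition chart_bump :: "'a chart \<Rightarrow> real^2 \<Rightarrow> real \<Rightarrow> 'a \<Rightarrow> real" where
  "chart_bump c a r p = (if p \<in> fst c then bump a r (snd c p) else 0)"

lemma chart_bump_nonneg: "0 \<le> chart_bump c a r p"
  by (simp add: chart_bump_def bump_nonneg)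

lemma chart_bump_zero:
  assumes "c \<in> A" "0 < r" "p \<notin> coord_inv c ` cball a r"
  shows "chart_bump c a r p = 0"
proof (cases "p \<in> fst c")
  case True
  have "snd c p \<notin> cball a r"
    using assms(3) coord_inv_left[OF chart[OF assms(1)] True] imageI[of "snd c p" "cball a r" "coord_inv c"] by auto
  then have "snd c p \<notin> ball a r" by auto
  from bump_zero[OF assms(2) this] show ?thesis by (simp add: chart_bump_def)
qed (simp add: chart_bump_def)

lemma chart_bump_pos:
  assumes "c \<in> A" "ball a r \<subseteq> chart_image c" "p \<in> coord_inv c ` ball a r"
  shows "0 < chart_bump c a r p"
proof -
  obtain x where x: "x \<in> ball a r" "p = coord_inv c x" using assms(3) by blast
  then have "x \<in> chart_image c" using assms(2) by blast
  then show ?thesis using x bump_pos coord_inv_mem[OF chart[OF assms(1)]] coord_inv_right[OF chart[OF assms(1)]]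
    by (simp add: chart_bump_def)
qed

text \<open>Seen from another chart d there are two cases. Over the domain of c the function is
  \<open>bump\<close> composed with the transition map. Elsewhere it vanishes nearby, since the
  image of the closed ball is compact and therefore closed in the Hausdorff space X.\<close>

lemma chart_bump_C1:
  assumes c: "c \<in> A" "0 < r" "cball a r \<subseteq> chart_image c"
  shows "C1_fun (chart_bump c a r)"
  unfolding C1_fun_def
proof (intro ballI C1_on_local)
  fix d y assume d: "d \<in> A" "y \<in> chart_image d"
  show "\<exists>U. open U \<and> y \<in> U \<and> C1_on U (\<lambda>x. chart_bump c a r (coord_inv d x))"
  proof (cases "coord_inv d y \<in> fst c")
    case True
    have y: "y \<in> overlap d c"
      using True d coord_inv_mem[OF chart[OF d(1)] d(2)] coord_inv_right[OF chart[OF d(1)] d(2)]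
      unfolding overlap_def by (intro image_eqI[of _ _ "coord_inv d y"]) auto
    have "C1_on (overlap d c) (\<lambda>x. bump a r (transition d c x))"
      by (rule C1_on_compose[OF bump_C1[of UNIV] transition_Ck[OF d(1) c(1)]]) auto
    then have "C1_on (overlap d c) (\<lambda>x. chart_bump c a r (coord_inv d x))"
      by (rule C1_on_cong[OF overlap_open[OF d(1) c(1)], rotated])
        (use overlap_coord_inv[OF d(1)] in \<open>auto simp: chart_bump_def transition_apply\<close>)
    then show ?thesis using y overlap_open[OF d(1) c(1)] by blast
  next
    case False
    define C where "C = coord_inv c ` cball a r"
    have cl: "closedin X C"
      unfolding C_def using coord_inv_compact_measurable(2)[OF c(1,3)] by simp
    define W where "W = snd d ` (fst d - C)"
    have "openin X (fst d - C)" using cl chart_openin[OF chart[OF d(1)]] by blast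
    then have W: "open W" unfolding W_def using chart_open_iff[OF chart[OF d(1)], of "fst d - C"] by auto
    have "coord_inv d y \<notin> C" using False coord_inv_image_subset[OF c(1,3)] unfolding C_def by blast
    then have "y \<in> W" unfolding W_def using coord_inv_mem[OF chart[OF d(1)] d(2)] coord_inv_right[OF chart[OF d(1)] d(2)]
      by (intro image_eqI[of _ _ "coord_inv d y"]) auto
    moreover have "C1_on W (\<lambda>x. chart_bump c a r (coord_inv d x))"
    proof (rule C1_on_cong[OF W _ C1_on_const[of _ 0]])
      fix z assume "z \<in> W"
      then have "coord_inv d z \<notin> C" unfolding W_def using coord_inv_left[OF chart[OF d(1)]] by auto
      then show "0 = chart_bump c a r (coord_inv d z)"
        using chart_bump_zero[OF c(1,2)] unfolding C_def by simp
    qed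
    ultimately show ?thesis using W by blast
  qed
qed

text \<open>The area density is positive, so zero area would make a Euclidean ball
  negligible.\<close>

lemma dx_chart_ball_pos:
  assumes c: "c \<in> A" "0 < r" "ball x r \<subseteq> chart_image c"
  shows "emeasure dx (coord_inv c ` ball x r) \<noteq> 0"
proof
  assume z: "emeasure dx (coord_inv c ` ball x r) = 0"
  have s: "coord_inv c ` ball x r \<in> sets (borel_sigma X)"
    using openin_coord_inv_image[OF chart[OF c(1)] c(3)] by (intro openin_borel_sigma) auto
  have "coord_inv c ` ball x r \<subseteq> fst c" by (rule coord_inv_image_subset[OF c(1,3)])
  then have i0: "(\<integral>\<^sup>+ y\<in>ball x r. ennreal (area_density g c (coord_inv c y)) \<partial>lborel) = 0"
    using emeasure_dx[OF c(1) s] z coord_inv_image[OF chart[OF c(1)] c(3)] by simp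
  have m: "(\<lambda>y. ennreal (area_density g c (coord_inv c y)) * indicator (ball x r) y) \<in> borel_measurable lborel"
  proof -
    have "(\<lambda>y. indicator (ball x r) y *\<^sub>R area_density g c (coord_inv c y)) \<in> borel_measurable borel"
      by (rule borel_measurable_continuous_on_indicator[OF _ continuous_on_subset[OF C1_onD(3)[OF area_density_C1[OF c(1)]] c(3)]]) simp
    then have "(\<lambda>y. ennreal (indicator (ball x r) y *\<^sub>R area_density g c (coord_inv c y))) \<in> borel_measurable lborel" by simp
    moreover have "ennreal (indicator (ball x r) y *\<^sub>R area_density g c (coord_inv c y)) =
        ennreal (area_density g c (coord_inv c y)) * indicator (ball x r) y" for y
      by (auto simp: indicator_def)
    ultimately show ?thesis by simp
  qed
  have "AE y in lborel. ennreal (area_density g c (coord_inv c y)) * indicator (ball x r) y = 0"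
    using i0 nn_integral_0_iff_AE[OF m] by simp
  then have "AE y in lborel. y \<notin> ball x r"
  proof eventually_elim
    fix y assume "ennreal (area_density g c (coord_inv c y)) * indicator (ball x r) y = 0"
    moreover have "0 < area_density g c (coord_inv c y)" if "y \<in> ball x r"
      using area_density_pos[OF c(1) coord_inv_mem[OF chart[OF c(1)] subsetD[OF c(3) that]]] .
    ultimately show "y \<notin> ball x r" by (force simp: indicator_def)
  qed
  then have "ball x r \<in> null_sets lborel" by (simp add: AE_iff_null_sets)
  then have "negligible (ball x r)" using null_sets_completionI negligible_iff_null_sets by blast
  then show False using open_not_negligible[of "ball x r"] c(2) by simp
qed

text \<open>Both local expressions represent the same weak Laplacian: they are compared by testing Green's
  formula in the two charts against a bump function supported where they differ.\<close>

lemma laplace_in_chart_le: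
  assumes v: "C2_fun v" and cd: "c \<in> A" "d \<in> A" and p0: "p0 \<in> fst c" "p0 \<in> fst d"
  shows "laplace_in_chart g c v p0 \<le> laplace_in_chart g d v p0"
\<comment> \<open>One inequality suffices, since exchanging the charts gives the other.\<close>
proof (rule ccontr)
  assume neg: "\<not> ?thesis"
  have v1: "C1_fun v" using v by (simp add: C2_fun_def)
  define k where "k = (\<lambda>p. laplace_in_chart g c v p - laplace_in_chart g d v p)"
  have kc: "continuous_on (overlap c d) (\<lambda>x. k (coord_inv c x))"
  proof -
    have tc: "continuous_on (overlap c d) (transition c d)"
      by (intro continuous_at_imp_continuous_on ballI has_derivative_continuous[OF transition_derivative[OF cd]])
    have "continuous_on (overlap c d) (\<lambda>x. laplace_in_chart g d v (coord_inv d (transition c d x)))"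
    proof (rule continuous_on_compose2[OF laplace_continuous[OF cd(2) v] tc])
      show "transition c d ` overlap c d \<subseteq> chart_image d" by (rule transition_subset[OF cd(1)])
    qed
    then have "continuous_on (overlap c d) (\<lambda>x. laplace_in_chart g d v (coord_inv c x))"
      using coord_inv_transition[OF cd] by (simp cong: continuous_on_cong)
    then show ?thesis unfolding k_def
      using continuous_on_subset[OF laplace_continuous[OF cd(1) v] overlap_subset]
      by (intro continuous_on_diff) auto
  qed
  define x0 where "x0 = snd c p0"
  define W where "W = overlap c d \<inter> (\<lambda>x. k (coord_inv c x)) -` {0<..}"
  have "open W" unfolding W_def
    using kc overlap_open[OF cd] by (simp add: continuous_on_open_vimage Int_commute)
  moreover have "x0 \<in> W"
    using p0 neg coord_inv_left[OF chart[OF cd(1)] p0(1)] by (auto simp: W_def x0_def overlap_def k_def)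
  ultimately obtain r where r: "0 < r" "cball x0 r \<subseteq> W" using open_contains_cball by blast
  define K where "K = cball x0 r"
  have Kov: "K \<subseteq> overlap c d" using r by (auto simp: K_def W_def)
  have Kc: "K \<subseteq> chart_image c" using Kov overlap_subset by blast
  define K' where "K' = transition c d ` K"
  have K': "compact K'" unfolding K'_def
  proof (rule compact_continuous_image)
    show "continuous_on K (transition c d)"
      using Kov by (intro continuous_at_imp_continuous_on ballI has_derivative_continuous[OF transition_derivative[OF cd]]) auto
  qed (simp add: K_def)
  have K'd: "K' \<subseteq> chart_image d"
    using transition_subset[OF cd(1)] Kov unfolding K'_def by blast
  have KK: "coord_inv d ` K' = coord_inv c ` K"
    unfolding K'_def image_image using Kov coord_inv_transition[OF cd] by (intro image_cong) auto
  define \<psi> where "\<psi> = chart_bump c x0 r"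
  have \<psi>: "C1_fun \<psi>" unfolding \<psi>_def using Kc by (intro chart_bump_C1 cd r) (simp add: K_def)
  have \<psi>0: "\<psi> p = 0" if "p \<notin> coord_inv c ` K" for p
    using that chart_bump_zero[OF cd(1) r(1)] unfolding \<psi>_def K_def by blast
  define Tc where "Tc = (\<lambda>p. indicator (fst c) p * (gamma c \<psi> v p - \<psi> p * laplace_in_chart g c v p))"
  define Td where "Td = (\<lambda>p. indicator (fst d) p * (gamma d \<psi> v p - \<psi> p * laplace_in_chart g d v p))"
  have cK: "compact K" by (simp add: K_def)
  have Tc: "integrable dx Tc" "(\<integral>p. Tc p \<partial>dx) = 0"
    unfolding Tc_def using \<psi>0 by (intro local_green_integrable[OF cd(1) \<psi> v cK Kc] local_green[OF cd(1) \<psi> v cK Kc]; blast)+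
  have Td: "integrable dx Td" "(\<integral>p. Td p \<partial>dx) = 0"
    unfolding Td_def using \<psi>0 KK by (intro local_green_integrable[OF cd(2) \<psi> v K' K'd] local_green[OF cd(2) \<psi> v K' K'd]; simp)+
  have KX: "closedin X (coord_inv c ` K)" using coord_inv_compact_measurable(2)[OF cd(1) Kc cK] .
  \<comment> \<open>The two Green integrands share their energy term, so only \<psi> times the
    difference of the local Laplacians survives.\<close>
  have val: "Td p - Tc p = (if p \<in> coord_inv c ` K then \<psi> p * k p else 0)" if p: "p \<in> topspace X" for p
  proof (cases "p \<in> coord_inv c ` K")
    case True
    then have "p \<in> fst c" "p \<in> fst d" using Kov overlap_coord_inv(1)[OF cd(1)] by blast+
    then show ?thesis
      using True gamma_indep[OF \<psi> v1 cd] by (simp add: Tc_def Td_def k_def algebra_simps)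
  next
    case False
    then have "energy \<psi> v p = 0" using energy_zero[OF \<psi> v1 KX p] \<psi>0 by blast
    then have "Tc p = 0" "Td p = 0"
      using energy_eq[OF \<psi> v1 cd(1)] energy_eq[OF \<psi> v1 cd(2)] \<psi>0[OF False]
      by (auto simp: Tc_def Td_def indicator_def)
    then show ?thesis using False by simp
  qed
  have kpos: "0 < k p" if "p \<in> coord_inv c ` K" for p
    using that r(2) by (auto simp: K_def W_def)
  have nn: "AE p in dx. 0 \<le> Td p - Tc p"
    by (intro AE_I2) (auto simp: val \<psi>_def chart_bump_nonneg intro!: mult_nonneg_nonneg less_imp_le[OF kpos])
  have "(\<integral>p. Td p - Tc p \<partial>dx) = 0" using Tc Td by simp
  then have "AE p in dx. Td p - Tc p = 0"
    using integral_nonneg_eq_0_iff_AE[OF _ nn] Tc Td by simp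
  then have ae: "AE p in dx. p \<notin> coord_inv c ` ball x0 r"
  proof (rule AE_mp, intro AE_I2 impI)
    fix p assume p: "p \<in> space dx" "Td p - Tc p = 0"
    show "p \<notin> coord_inv c ` ball x0 r"
    proof
      assume b: "p \<in> coord_inv c ` ball x0 r"
      then have "p \<in> coord_inv c ` K" unfolding K_def by (rule subsetD[OF image_mono[OF ball_subset_cball]])
      moreover have "0 < \<psi> p" unfolding \<psi>_def
        using chart_bump_pos[OF cd(1) _ b] Kc ball_subset_cball unfolding K_def by blast
      ultimately have "0 < Td p - Tc p" using val[of p] p kpos[of p] by simp
      then show False using p by simp
    qed
  qed
  have bs: "ball x0 r \<subseteq> chart_image c" using Kc ball_subset_cball unfolding K_def by blast
  have "coord_inv c ` ball x0 r \<in> sets dx"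
    using openin_coord_inv_image[OF chart[OF cd(1)] bs] by (simp add: openin_borel_sigma)
  then have "emeasure dx (coord_inv c ` ball x0 r) = 0"
    using ae AE_iff_null_sets by blast
  then show False using dx_chart_ball_pos[OF cd(1) r(1) bs] by simp
qed

lemma laplace_in_chart_indep:
  assumes "C2_fun v" "c \<in> A" "d \<in> A" "p \<in> fst c" "p \<in> fst d"
  shows "laplace_in_chart g c v p = laplace_in_chart g d v p"
  using laplace_in_chart_le[OF assms] laplace_in_chart_le[OF assms(1,3,2,5,4)] by simp

lemma laplacian_eq:
  assumes "C2_fun v" "c \<in> A" "p \<in> fst c"
  shows "laplacian A g v p = laplace_in_chart g c v p"
proof -
  let ?d = "SOME c. c \<in> A \<and> p \<in> fst c"
  have "?d \<in> A \<and> p \<in> fst ?d" by (rule someI[of _ c]) (use assms in auto)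
  then show ?thesis unfolding laplacian_def using laplace_in_chart_indep assms by blast
qed

lemma laplacian_continuous:
  assumes "C2_fun v"
  shows "continuous_map X euclidean (laplacian A g v)"
proof (rule continuous_mapI_charts)
  fix c assume c: "c \<in> A"
  show "continuous_on (chart_image c) (\<lambda>x. laplacian A g v (coord_inv c x))"
    using laplace_continuous[OF c assms] laplacian_eq[OF assms c coord_inv_mem[OF chart[OF c]]]
    by (simp cong: continuous_on_cong)
qed

text \<open>A partition of unity reduces this to test functions supported in one chart. It has to be
  of class C1 only, so bumps divided by their sum serve.\<close>

lemma green:
  assumes u: "C1_fun u" and v: "C2_fun v"
  shows "(\<integral>p. energy u v p \<partial>dx) = (\<integral>p. u p * laplacian A g v p \<partial>dx)"
proof -
  have v1: "C1_fun v" using v by (simp add: C2_fun_def)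
  obtain n cs a r where c: "\<forall>i<n::nat. cs i \<in> A \<and> 0 < (r i :: real) \<and> cball (a i) (2 * r i) \<subseteq> chart_image (cs i)"
    and cov: "topspace X = (\<Union>i<n. coord_inv (cs i) ` ball (a i) (r i))"
    using finite_ball_cover by blast
  have ci: "cs i \<in> A" "0 < r i" "cball (a i) (r i) \<subseteq> chart_image (cs i)" if "i < n" for i
    using c that by (auto dest!: spec[of _ i])
  define \<beta> where "\<beta> = (\<lambda>i. chart_bump (cs i) (a i) (r i))"
  have \<beta>: "C1_fun (\<beta> i)" if "i < n" for i unfolding \<beta>_def using ci[OF that] by (intro chart_bump_C1)
  define S where "S = (\<lambda>p. \<Sum>i<n. \<beta> i p)"
  have S: "C1_fun S" unfolding S_def using \<beta> by (intro C1_fun_sum) auto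
  have Spos: "S p \<noteq> 0" if p: "p \<in> topspace X" for p
  proof -
    obtain i where i: "i < n" "p \<in> coord_inv (cs i) ` ball (a i) (r i)" using p cov by auto
    have "0 < \<beta> i p" unfolding \<beta>_def
      using ci[OF i(1)] ball_subset_cball by (intro chart_bump_pos i(2)) blast+
    also have "\<beta> i p \<le> S p" unfolding S_def
      by (rule member_le_sum) (use i in \<open>auto simp: \<beta>_def chart_bump_nonneg\<close>)
    finally show ?thesis by simp
  qed
  \<comment> \<open>Dividing u by the sum of the bumps makes the pieces
    \<open>\<beta> i p * w p\<close> add up to u.\<close>
  define w where "w = (\<lambda>p. u p / S p)"
  have w: "C1_fun w" unfolding w_def by (intro C1_fun_divide u S Spos)
  define \<psi> where "\<psi> = (\<lambda>i p. \<beta> i p * w p)"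
  have \<psi>: "C1_fun (\<psi> i)" if "i < n" for i unfolding \<psi>_def by (intro C1_fun_mult \<beta> that w)
  have usum: "(\<Sum>i<n. \<psi> i p) = u p" if "p \<in> topspace X" for p
  proof -
    have "(\<Sum>i<n. \<psi> i p) = S p * w p" by (simp add: \<psi>_def S_def sum_distrib_right)
    then show ?thesis using Spos[OF that] by (simp add: w_def)
  qed
  define L where "L = laplacian A g v"
  have Lc: "continuous_map X euclidean L" unfolding L_def by (rule laplacian_continuous[OF v])
  have each: "(\<integral>p. energy (\<psi> i) v p \<partial>dx) = (\<integral>p. \<psi> i p * L p \<partial>dx)" if i: "i < n" for i
  proof -
    let ?K = "cball (a i) (r i)"
    note ci = ci[OF i]
    have z: "\<psi> i p = 0" if "p \<notin> coord_inv (cs i) ` ?K" for p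
      using chart_bump_zero[OF ci(1,2) that] by (simp add: \<psi>_def \<beta>_def)
    have KX: "closedin X (coord_inv (cs i) ` ?K)" using coord_inv_compact_measurable(2)[OF ci(1,3)] by simp
    have "(\<integral>p. energy (\<psi> i) v p - \<psi> i p * L p \<partial>dx) =
       (\<integral>p. indicator (fst (cs i)) p * (gamma (cs i) (\<psi> i) v p - \<psi> i p * laplace_in_chart g (cs i) v p) \<partial>dx)"
    proof (intro Bochner_Integration.integral_cong refl)
      fix p assume "p \<in> space dx"
      then have p: "p \<in> topspace X" by simp
      show "energy (\<psi> i) v p - \<psi> i p * L p = indicator (fst (cs i)) p * (gamma (cs i) (\<psi> i) v p - \<psi> i p * laplace_in_chart g (cs i) v p)"
      proof (cases "p \<in> fst (cs i)")
        case True
        then show ?thesis using energy_eq[OF \<psi>[OF i] v1 ci(1) True] laplacian_eq[OF v ci(1) True] by (simp add: L_def)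
      next
        case False
        then have "p \<notin> coord_inv (cs i) ` ?K" using coord_inv_image_subset[OF ci(1,3)] by blast
        then show ?thesis using False energy_zero[OF \<psi>[OF i] v1 KX p] z by simp
      qed
    qed
    also have "\<dots> = 0" by (rule local_green[OF ci(1) \<psi>[OF i] v _ ci(3)]) (use z in auto)
    finally have "(\<integral>p. energy (\<psi> i) v p - \<psi> i p * L p \<partial>dx) = 0" .
    moreover have "integrable dx (energy (\<psi> i) v)" by (intro continuous_integrable energy_continuous \<psi> i v1)
    moreover have "integrable dx (\<lambda>p. \<psi> i p * L p)"
      by (intro continuous_integrable continuous_map_real_mult C1_fun_continuous \<psi> i Lc)
    ultimately show ?thesis by simp
  qed
  \<comment> \<open>The pieces sum to u on the surface, not as functions on the whole type, so the
    gradients are compared inside a chart.\<close>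
  have eu: "energy u v p = (\<Sum>i<n. energy (\<psi> i) v p)" if p: "p \<in> topspace X" for p
  proof -
    obtain d where d: "d \<in> A" "p \<in> fst d" using ex_chart p by blast
    have su: "C1_fun (\<lambda>p. \<Sum>i<n. \<psi> i p)" by (intro C1_fun_sum) (use \<psi> in auto)
    have "grad_chart d (\<lambda>p. \<Sum>i<n. \<psi> i p) p = grad_chart d u p"
      unfolding grad_chart_def
    proof (rule grad_cong(1)[OF chart_open[OF chart[OF d(1)]]])
      show "snd d p \<in> chart_image d" using d by simp
      show "u (coord_inv d y) = (\<Sum>i<n. \<psi> i (coord_inv d y))" if "y \<in> chart_image d" for y
        using usum chart_in_space[OF d(1)] coord_inv_mem[OF chart[OF d(1)] that] by simp
    qed (rule chart_differentiable[OF u d])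
    then have "energy u v p = energy (\<lambda>p. \<Sum>i<n. \<psi> i p) v p"
      using energy_eq[OF u v1 d] energy_eq[OF su v1 d] by (simp add: gamma_def)
    also have "\<dots> = (\<Sum>i<n. energy (\<psi> i) v p)" using \<psi> v1 p by (intro energy_sum) auto
    finally show ?thesis .
  qed
  have "(\<integral>p. energy u v p \<partial>dx) = (\<integral>p. (\<Sum>i<n. energy (\<psi> i) v p) \<partial>dx)"
    by (intro Bochner_Integration.integral_cong) (auto simp: eu)
  also have "\<dots> = (\<Sum>i<n. \<integral>p. energy (\<psi> i) v p \<partial>dx)"
    by (intro Bochner_Integration.integral_sum continuous_integrable energy_continuous \<psi> v1) auto
  also have "\<dots> = (\<Sum>i<n. \<integral>p. \<psi> i p * L p \<partial>dx)" using each by simp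
  also have "\<dots> = (\<integral>p. (\<Sum>i<n. \<psi> i p * L p) \<partial>dx)"
    by (intro Bochner_Integration.integral_sum[symmetric] continuous_integrable continuous_map_real_mult C1_fun_continuous \<psi> Lc) auto
  also have "\<dots> = (\<integral>p. u p * L p \<partial>dx)"
    by (intro Bochner_Integration.integral_cong) (auto simp: sum_distrib_right[symmetric] usum)
  finally show ?thesis by (simp add: L_def)
qed

end

section \<open>The upper half of Weyl's law\<close>

text \<open>Neighbouring closed squares share edges; the overlap is handled by counting
  multiplicities instead of discarding null sets.\<close>

definition subsquare :: "real^2 \<Rightarrow> real \<Rightarrow> nat \<times> nat \<Rightarrow> (real^2) set" where
  "subsquare a h j = cbox (a + (\<chi> i. h * real (if i = 1 then fst j else snd j)))
     (a + (\<chi> i. h * real (if i = 1 then fst j else snd j)) + (\<chi> i. h))"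

lemma mem_subsquare:
  "x \<in> subsquare a h (j, k) \<longleftrightarrow>
     a$1 + h * real j \<le> x$1 \<and> x$1 \<le> a$1 + h * (real j + 1) \<and>
     a$2 + h * real k \<le> x$2 \<and> x$2 \<le> a$2 + h * (real k + 1)"
  by (auto simp: subsquare_def mem_box_cart forall_2 algebra_simps)

text \<open>A point on a grid line belongs to the two closed intervals that meet there.\<close>

lemma grid_count:
  fixes y :: real
  assumes "0 < h"
  shows "card {j. j < N \<and> b + h * real j \<le> y \<and> y \<le> b + h * (real j + 1)} \<le> 2"
proof -
  let ?S = "{j. j < N \<and> b + h * real j \<le> y \<and> y \<le> b + h * (real j + 1)}"
  define m where "m = \<lfloor>(y - b) / h\<rfloor>"
  have "int j \<in> {m - 1, m}" if "j \<in> ?S" for j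
  proof -
    have "real j \<le> (y - b) / h" "(y - b) / h \<le> real j + 1"
      using that assms by (auto simp: field_simps)
    then have "int j \<le> m" "m \<le> int j + 1" unfolding m_def by linarith+
    then show ?thesis by auto
  qed
  then have "int ` ?S \<subseteq> {m - 1, m}" by blast
  then have "card (int ` ?S) \<le> card {m - 1, m}" by (intro card_mono) auto
  also have "\<dots> \<le> 2" by simp
  finally show ?thesis by (simp add: card_image)
qed

lemma grid_cover:
  fixes y :: real
  assumes "0 < h" "b \<le> y" "y \<le> b + h * real N" "0 < N"
  obtains j where "j < N" "b + h * real j \<le> y" "y \<le> b + h * (real j + 1)"
proof -
  define m where "m = nat \<lfloor>(y - b) / h\<rfloor>"
  define z where "z = (y - b) / h"
  have y: "y = b + h * z" using assms by (simp add: z_def)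
  have z: "0 \<le> z" "z \<le> real N" using assms by (auto simp: z_def field_simps)
  have m: "real m \<le> z" "z < real m + 1" unfolding m_def z_def[symmetric] using z by linarith+
  show thesis
  proof (cases "m < N")
    case True
    show thesis by (rule that[OF True]) (use m assms y in auto)
  next
    case False
    \<comment> \<open>The right end of the grid lies in the last interval, where rounding down would
      give the index N.\<close>
    then have "z = real N" using m z by linarith
    then show thesis using assms y by (intro that[of "N - 1"]) (auto simp: of_nat_diff)
  qed
qed

text \<open>The inequality on each small square, summed up. The factor 4 bounds the number of closed
  subsquares through one point.\<close>

lemma poincare_grid:
  fixes w :: "real^2 \<Rightarrow> real"
  assumes L: "0 < L" and N: "0 < N" and Q: "Q = cbox a (a + (\<chi> i. L))"
    and C: "C1_on Q w"
    and mean: "\<And>j. j \<in> {..<N} \<times> {..<N} \<Longrightarrow> (LINT x:subsquare a (L / real N) j|lborel. w x) = 0"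
  shows "(LINT x:Q|lborel. (w x)\<^sup>2) \<le> 4 * (L / real N)\<^sup>2 * (LINT x:Q|lborel. (norm (grad w x))\<^sup>2)"
proof -
  define h where "h = L / real N"
  have h: "0 < h" "h * real N = L" using L N by (auto simp: h_def)
  define J where "J = {..<N} \<times> {..<N}"
  define q where "q = subsquare a h"
  have sub: "q j \<subseteq> Q" if jJ: "j \<in> J" for j
  proof
    fix x assume x: "x \<in> q j"
    obtain j1 j2 where j: "j = (j1, j2)" "j1 < N" "j2 < N" using jJ by (auto simp: J_def)
    have "h * (real j1 + 1) \<le> h * real N" "h * (real j2 + 1) \<le> h * real N" "0 \<le> h * real j1" "0 \<le> h * real j2"
      using j h(1) by (intro mult_left_mono mult_nonneg_nonneg; simp)+
    then show "x \<in> Q" using x unfolding q_def j(1) mem_subsquare Q h(2)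
      by (auto simp: mem_box_cart forall_2)
  qed
  have cmp: "compact (q j)" for j by (simp add: q_def subsquare_def)
  have cQ: "compact Q" by (simp add: Q)
  have low: "indicator Q x \<le> (\<Sum>j\<in>J. indicator (q j) x :: real)" for x
  proof (cases "x \<in> Q")
    case True
    then have x: "a$1 \<le> x$1" "x$1 \<le> a$1 + h * real N" "a$2 \<le> x$2" "x$2 \<le> a$2 + h * real N"
      unfolding Q h(2) by (auto simp: mem_box_cart forall_2)
    obtain j1 where j1: "j1 < N" "a$1 + h * real j1 \<le> x$1" "x$1 \<le> a$1 + h * (real j1 + 1)"
      using grid_cover[OF h(1) x(1,2) N] .
    obtain j2 where j2: "j2 < N" "a$2 + h * real j2 \<le> x$2" "x$2 \<le> a$2 + h * (real j2 + 1)"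
      using grid_cover[OF h(1) x(3,4) N] .
    have "x \<in> q (j1, j2)" unfolding q_def mem_subsquare using j1 j2 by simp
    then have "indicator Q x \<le> (indicator (q (j1, j2)) x :: real)" using True by simp
    also have "\<dots> \<le> (\<Sum>j\<in>J. indicator (q j) x)"
      by (rule member_le_sum) (use j1 j2 in \<open>auto simp: J_def\<close>)
    finally show ?thesis .
  qed (auto intro: sum_nonneg)
  have up: "(\<Sum>j\<in>J. indicator (q j) x :: real) \<le> 4 * indicator Q x" for x
  proof (cases "x \<in> Q")
    case True
    let ?S1 = "{j. j < N \<and> a$1 + h * real j \<le> x$1 \<and> x$1 \<le> a$1 + h * (real j + 1)}"
    let ?S2 = "{j. j < N \<and> a$2 + h * real j \<le> x$2 \<and> x$2 \<le> a$2 + h * (real j + 1)}"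
    have "(\<Sum>j\<in>J. indicator (q j) x :: real) = (\<Sum>j\<in>J. if j \<in> ?S1 \<times> ?S2 then 1 else 0)"
      by (intro sum.cong refl) (auto simp: J_def q_def mem_subsquare indicator_def)
    also have "\<dots> = real (card (J \<inter> ?S1 \<times> ?S2))"
      by (simp add: J_def sum.If_cases)
    finally have 1: "(\<Sum>j\<in>J. indicator (q j) x :: real) = real (card (J \<inter> ?S1 \<times> ?S2))" .
    have 2: "J \<inter> ?S1 \<times> ?S2 = ?S1 \<times> ?S2" by (auto simp: J_def)
    have "card (?S1 \<times> ?S2) \<le> 2 * 2"
      unfolding card_cartesian_product by (intro mult_le_mono grid_count h)
    then have 3: "real (card (?S1 \<times> ?S2)) \<le> 4" by linarith
    show ?thesis unfolding 1 2 indicator_simps(1)[OF True] mult_1_right by (rule 3)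
  next
    case False
    then have "x \<notin> q j" if "j \<in> J" for j using sub[OF that] by blast
    then show ?thesis by (simp add: sum_nonneg)
  qed
  note cw = C1_onD(3)[OF C] and cg = C1_onD(2)[OF C]
  have ci: "integrable lborel (\<lambda>x. indicator S x *\<^sub>R f x)" if "compact S" "S \<subseteq> Q" "continuous_on Q f" for S and f :: "real^2 \<Rightarrow> real"
    by (rule borel_integrable_compact[OF that(1) continuous_on_subset[OF that(3,2)]])
  have c1: "continuous_on Q (\<lambda>x. (w x)\<^sup>2)" "continuous_on Q (\<lambda>x. (norm (grad w x))\<^sup>2)"
    by (intro continuous_intros cw cg)+
  have sum_int: "(\<Sum>j\<in>J. LINT x:q j|lborel. f x) = (\<integral>x. (\<Sum>j\<in>J. indicator (q j) x) * f x \<partial>lborel)"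
    "integrable lborel (\<lambda>x. (\<Sum>j\<in>J. indicator (q j) x) * f x)" if "continuous_on Q f" for f :: "real^2 \<Rightarrow> real"
  proof -
    have i: "integrable lborel (\<lambda>x. indicator (q j) x *\<^sub>R f x)" if "j \<in> J" for j
      using ci[OF cmp sub[OF that] \<open>continuous_on Q f\<close>] .
    then show "(\<Sum>j\<in>J. LINT x:q j|lborel. f x) = (\<integral>x. (\<Sum>j\<in>J. indicator (q j) x) * f x \<partial>lborel)"
      unfolding set_lebesgue_integral_def
      by (subst Bochner_Integration.integral_sum[symmetric]) (auto simp: sum_distrib_right)
    have "integrable lborel (\<lambda>x. \<Sum>j\<in>J. indicator (q j) x *\<^sub>R f x)" using i by (rule Bochner_Integration.integrable_sum)
    then show "integrable lborel (\<lambda>x. (\<Sum>j\<in>J. indicator (q j) x) * f x)" by (simp add: sum_distrib_right)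
  qed
  have "(LINT x:Q|lborel. (w x)\<^sup>2) \<le> (\<integral>x. (\<Sum>j\<in>J. indicator (q j) x) * (w x)\<^sup>2 \<partial>lborel)"
    unfolding set_lebesgue_integral_def
  proof (rule integral_mono)
    show "integrable lborel (\<lambda>x. indicator Q x *\<^sub>R (w x)\<^sup>2)" by (rule ci[OF cQ order_refl c1(1)])
    show "indicator Q x *\<^sub>R (w x)\<^sup>2 \<le> (\<Sum>j\<in>J. indicator (q j) x) * (w x)\<^sup>2" for x
      using mult_right_mono[OF low[of x], of "(w x)\<^sup>2"] by simp
  qed (rule sum_int[OF c1(1)])
  also have "\<dots> = (\<Sum>j\<in>J. LINT x:q j|lborel. (w x)\<^sup>2)" by (rule sum_int(1)[OF c1(1), symmetric])
  also have "\<dots> \<le> (\<Sum>j\<in>J. h\<^sup>2 * (LINT x:q j|lborel. (norm (grad w x))\<^sup>2))"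
  proof (rule sum_mono)
    fix j assume j: "j \<in> J"
    show "(LINT x:q j|lborel. (w x)\<^sup>2) \<le> h\<^sup>2 * (LINT x:q j|lborel. (norm (grad w x))\<^sup>2)"
    proof (rule poincare_square[OF h(1)])
      show "q j = cbox (a + (\<chi> i. h * real (if i = 1 then fst j else snd j)))
         (a + (\<chi> i. h * real (if i = 1 then fst j else snd j)) + (\<chi> i. h))" by (simp add: q_def subsquare_def)
      show "C1_on (q j) w" by (rule C1_on_subset[OF C sub[OF j]])
      show "(LINT x:q j|lborel. w x) = 0" using mean j by (simp add: q_def h_def J_def)
    qed
  qed
  also have "\<dots> = h\<^sup>2 * (\<integral>x. (\<Sum>j\<in>J. indicator (q j) x) * (norm (grad w x))\<^sup>2 \<partial>lborel)"
    by (simp add: sum_distrib_left[symmetric] sum_int(1)[OF c1(2)])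
  also have "\<dots> \<le> h\<^sup>2 * (\<integral>x. 4 * (indicator Q x *\<^sub>R (norm (grad w x))\<^sup>2) \<partial>lborel)"
  proof (intro mult_left_mono integral_mono)
    show "integrable lborel (\<lambda>x. 4 * (indicator Q x *\<^sub>R (norm (grad w x))\<^sup>2))"
      by (intro integrable_mult_right ci[OF cQ order_refl c1(2)])
    show "(\<Sum>j\<in>J. indicator (q j) x) * (norm (grad w x))\<^sup>2 \<le> 4 * (indicator Q x *\<^sub>R (norm (grad w x))\<^sup>2)" for x
      using mult_right_mono[OF up[of x], of "(norm (grad w x))\<^sup>2"] by simp
  qed (auto intro: sum_int[OF c1(2)])
  also have "\<dots> = 4 * (L / real N)\<^sup>2 * (LINT x:Q|lborel. (norm (grad w x))\<^sup>2)"
    by (simp add: set_lebesgue_integral_def h_def)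
  finally show ?thesis .
qed

context closed_riemannian_surface
begin

lemma integral_chart_compact:
  fixes F :: "'a \<Rightarrow> real"
  assumes c: "c \<in> A" and K: "K \<subseteq> chart_image c" "compact K" and F: "F \<in> borel_measurable (borel_sigma X)"
  shows "(\<integral>p. indicator (coord_inv c ` K) p * F p \<partial>dx) =
    (LINT x:K|lborel. area_density g c (coord_inv c x) * F (coord_inv c x))"
proof -
  let ?F = "\<lambda>p. indicator (coord_inv c ` K) p * F p"
  have sub: "coord_inv c ` K \<subseteq> fst c" by (rule coord_inv_image_subset[OF c K(1)])
  have m: "?F \<in> borel_measurable (borel_sigma X)"
    using coord_inv_compact_measurable(1)[OF c K] F by measurable
  have "(\<integral>p. ?F p \<partial>dx) = (\<integral>p. indicator (fst c) p * ?F p \<partial>dx)"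
    using sub by (intro Bochner_Integration.integral_cong) (auto simp: indicator_def)
  also have "\<dots> = (\<integral>x. indicator (chart_image c) x *\<^sub>R (area_density g c (coord_inv c x) * ?F (coord_inv c x)) \<partial>lborel)"
    by (rule integral_chart[OF c m])
  also have "\<dots> = (LINT x:K|lborel. area_density g c (coord_inv c x) * F (coord_inv c x))"
    unfolding set_lebesgue_integral_def
  proof (intro Bochner_Integration.integral_cong refl)
    fix x
    show "indicator (chart_image c) x *\<^sub>R (area_density g c (coord_inv c x) * ?F (coord_inv c x))
      = indicator K x *\<^sub>R (area_density g c (coord_inv c x) * F (coord_inv c x))"
    proof (cases "x \<in> K")
      case True
      then show ?thesis using K(1) by auto
    next
      case False
      then show ?thesis using mem_coord_inv_image[OF c K(1), of x] by (auto simp: indicator_def)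
    qed
  qed
  finally show ?thesis .
qed

text \<open>On the compact square the area density is at most \<open>\<Lambda>\<close>, and its
  quotient by the trace of the metric is at least \<open>\<kappa>\<close>. These two constants turn
  the Euclidean estimate into one between area and energy; the factor 1 / N^2 comes from the mesh L
  / N.\<close>

lemma local_weyl:
  assumes c: "c \<in> A" and L: "0 < L" and Q: "Q = cbox a (a + (\<chi> i. L))" "Q \<subseteq> chart_image c"
  shows "\<exists>B\<ge>0. \<forall>N>0. \<forall>w. C1_fun w \<longrightarrow>
     (\<forall>j\<in>{..<N}\<times>{..<N}. (LINT x:subsquare a (L / real N) j|lborel. w (coord_inv c x)) = 0) \<longrightarrow>
     (\<integral>p. indicator (coord_inv c ` Q) p * (w p)\<^sup>2 \<partial>dx) \<le> B / (real N)\<^sup>2 * (\<integral>p. energy w w p \<partial>dx)"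
proof -
  let ?\<rho> = "\<lambda>x. area_density g c (coord_inv c x)"
  let ?tr = "\<lambda>x. g c (coord_inv c x) $ 1 $ 1 + g c (coord_inv c x) $ 2 $ 2"
  have cQ: "compact Q" by (simp add: Q(1))
  have "a \<in> Q" using L by (auto simp: Q(1) mem_box_cart)
  then have neQ: "Q \<noteq> {}" by blast
  have mem: "coord_inv c x \<in> fst c" if "x \<in> Q" for x using coord_inv_mem[OF chart[OF c] subsetD[OF Q(2) that]] .
  have c\<rho>: "continuous_on Q ?\<rho>" by (rule continuous_on_subset[OF C1_onD(3)[OF area_density_C1[OF c]] Q(2)])
  have ctr: "continuous_on Q ?tr"
    by (intro continuous_on_add continuous_on_subset[OF C1_onD(3)[OF metric_C1[OF c]] Q(2)])
  have pos: "0 < ?\<rho> x" "0 < ?tr x" if "x \<in> Q" for x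
    using area_density_pos[OF c mem[OF that]] energy_lower_bound(2)[OF C1_fun_const c mem[OF that]] by auto
  obtain x1 where x1: "x1 \<in> Q" "\<And>y. y \<in> Q \<Longrightarrow> ?\<rho> y \<le> ?\<rho> x1"
    using continuous_attains_sup[OF cQ neQ c\<rho>] by blast
  define \<Lambda> where "\<Lambda> = ?\<rho> x1"
  have ck: "continuous_on Q (\<lambda>x. ?\<rho> x / ?tr x)"
    by (rule continuous_on_divide[OF c\<rho> ctr]) (use pos in force)
  obtain x2 where x2: "x2 \<in> Q" "\<And>y. y \<in> Q \<Longrightarrow> ?\<rho> x2 / ?tr x2 \<le> ?\<rho> y / ?tr y"
    using continuous_attains_inf[OF cQ neQ ck] by blast
  define \<kappa> where "\<kappa> = ?\<rho> x2 / ?tr x2"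
  have \<Lambda>: "0 < \<Lambda>" and \<kappa>: "0 < \<kappa>" using pos[OF x1(1)] pos[OF x2(1)] by (auto simp: \<Lambda>_def \<kappa>_def)
  define B where "B = \<Lambda> * (4 * L\<^sup>2) / \<kappa>"
  have main: "(\<integral>p. indicator (coord_inv c ` Q) p * (w p)\<^sup>2 \<partial>dx) \<le> B / (real N)\<^sup>2 * (\<integral>p. energy w w p \<partial>dx)"
    if N: "0 < N" and w: "C1_fun w"
      and mean: "\<forall>j\<in>{..<N}\<times>{..<N}. (LINT x:subsquare a (L / real N) j|lborel. w (coord_inv c x)) = 0" for N w
  proof -
    let ?w = "\<lambda>x. w (coord_inv c x)"
    have Cw: "C1_on Q ?w" by (rule C1_on_subset[OF C1_funD[OF w c] Q(2)])
    note cw = C1_onD(3)[OF Cw] and cg = C1_onD(2)[OF Cw]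
    have ci: "integrable lborel (\<lambda>x. indicator Q x *\<^sub>R f x)" if "continuous_on Q f" for f :: "real^2 \<Rightarrow> real"
      using that by (intro borel_integrable_compact cQ)
    have mw: "(\<lambda>p. (w p)\<^sup>2) \<in> borel_measurable (borel_sigma X)"
      using continuous_map_borel_measurable[OF C1_fun_continuous[OF w]] by measurable
    have me: "energy w w \<in> borel_measurable (borel_sigma X)"
      using continuous_map_borel_measurable[OF energy_continuous[OF w w]] .
    have ce: "continuous_on Q (\<lambda>x. energy w w (coord_inv c x))"
    proof -
      have "continuous_on Q (\<lambda>x. gamma c w w (coord_inv c x))"
        by (rule continuous_on_subset[OF gamma_continuous[OF w w c] Q(2)])
      then show ?thesis using energy_eq[OF w w c mem] by (simp cong: continuous_on_cong)
    qed
    have "(\<integral>p. indicator (coord_inv c ` Q) p * (w p)\<^sup>2 \<partial>dx) = (LINT x:Q|lborel. ?\<rho> x * (?w x)\<^sup>2)"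
      by (rule integral_chart_compact[OF c Q(2) cQ mw])
    also have "\<dots> \<le> (LINT x:Q|lborel. \<Lambda> * (?w x)\<^sup>2)"
      unfolding set_lebesgue_integral_def
    proof (rule integral_mono)
      show "indicator Q x *\<^sub>R (?\<rho> x * (?w x)\<^sup>2) \<le> indicator Q x *\<^sub>R (\<Lambda> * (?w x)\<^sup>2)" for x
        using x1(2)[of x] by (auto simp: indicator_def \<Lambda>_def intro!: mult_right_mono)
    qed (intro ci continuous_on_mult continuous_on_power c\<rho> cw continuous_on_const)+
    also have "\<dots> = \<Lambda> * (LINT x:Q|lborel. (?w x)\<^sup>2)" by simp
    also have "\<dots> \<le> \<Lambda> * (4 * (L / real N)\<^sup>2 * (LINT x:Q|lborel. (norm (grad ?w x))\<^sup>2))"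
      using \<Lambda> mean by (intro mult_left_mono poincare_grid[OF L N Q(1) Cw]) auto
    also have "\<dots> = B / (real N)\<^sup>2 * (LINT x:Q|lborel. \<kappa> * (norm (grad ?w x))\<^sup>2)"
      using \<kappa> by (simp add: B_def field_simps)
    also have "\<dots> \<le> B / (real N)\<^sup>2 * (LINT x:Q|lborel. ?\<rho> x * energy w w (coord_inv c x))"
    proof (rule mult_left_mono)
      show "(LINT x:Q|lborel. \<kappa> * (norm (grad ?w x))\<^sup>2) \<le> (LINT x:Q|lborel. ?\<rho> x * energy w w (coord_inv c x))"
        unfolding set_lebesgue_integral_def
      proof (rule integral_mono)
        fix x
        show "indicator Q x *\<^sub>R (\<kappa> * (norm (grad ?w x))\<^sup>2) \<le> indicator Q x *\<^sub>R (?\<rho> x * energy w w (coord_inv c x))"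
        proof (cases "x \<in> Q")
          case True
          have eq: "grad ?w x = grad_chart c w (coord_inv c x)"
            using coord_inv_right[OF chart[OF c] subsetD[OF Q(2) True]] by (simp add: grad_chart_def)
          have "\<kappa> * (norm (grad ?w x))\<^sup>2 \<le> ?\<rho> x / ?tr x * (norm (grad ?w x))\<^sup>2"
            using x2(2)[OF True] by (intro mult_right_mono) (auto simp: \<kappa>_def)
          also have "\<dots> \<le> ?\<rho> x / ?tr x * (?tr x * energy w w (coord_inv c x))"
            unfolding eq using pos[OF True] by (intro mult_left_mono energy_lower_bound(1)[OF w c mem[OF True]]) auto
          also have "\<dots> = ?\<rho> x * energy w w (coord_inv c x)" using pos(2)[OF True] by simp
          finally show ?thesis using True by simp
        qed simp
      qed (intro ci continuous_on_mult continuous_on_power continuous_on_norm c\<rho> cg ce continuous_on_const)+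
      show "0 \<le> B / (real N)\<^sup>2" using \<Lambda> \<kappa> by (simp add: B_def)
    qed
    also have "(LINT x:Q|lborel. ?\<rho> x * energy w w (coord_inv c x)) = (\<integral>p. indicator (coord_inv c ` Q) p * energy w w p \<partial>dx)"
      by (rule integral_chart_compact[OF c Q(2) cQ me, symmetric])
    also have "B / (real N)\<^sup>2 * \<dots> \<le> B / (real N)\<^sup>2 * (\<integral>p. energy w w p \<partial>dx)"
    proof (rule mult_left_mono)
      have ie: "integrable dx (energy w w)" by (intro continuous_integrable energy_continuous w)
      have qs: "coord_inv c ` Q \<in> sets dx" using coord_inv_compact_measurable(1)[OF c Q(2) cQ] by simp
      show "(\<integral>p. indicator (coord_inv c ` Q) p * energy w w p \<partial>dx) \<le> (\<integral>p. energy w w p \<partial>dx)"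
      proof (rule integral_mono)
        show "integrable dx (\<lambda>p. indicator (coord_inv c ` Q) p * energy w w p)"
          using integrable_mult_indicator[OF qs ie] by simp
        show "indicator (coord_inv c ` Q) p * energy w w p \<le> energy w w p" if "p \<in> space dx" for p
          using energy_nonneg[OF w, of p] that by (auto simp: indicator_def)
      qed (rule ie)
      show "0 \<le> B / (real N)\<^sup>2" using \<Lambda> \<kappa> by (simp add: B_def)
    qed
    finally show ?thesis .
  qed
  have "0 \<le> B" using \<Lambda> \<kappa> by (simp add: B_def)
  then show ?thesis using main by blast
qed

text \<open>Vanishing means on all subsquares amount to n N^2 linear conditions. A family with more
  members has a nontrivial combination that satisfies them, and by Poincare its squared norm would
  be at most BB s / N^2 < 1 times itself. Choosing N of order sqrt(BB s) gives linear growth in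
  s.\<close>

lemma weyl_upper_bound:
  "\<exists>C\<ge>0. \<forall>s\<ge>0. \<forall>k u. (\<forall>i<k. C1_fun (u i)) \<longrightarrow>
     (\<forall>b. (\<exists>i<k. b i \<noteq> 0) \<longrightarrow>
        0 < (\<integral>p. (\<Sum>i<k. b i * u i p)\<^sup>2 \<partial>dx) \<and>
        (\<integral>p. energy (\<lambda>p. \<Sum>i<k. b i * u i p) (\<lambda>p. \<Sum>i<k. b i * u i p) p \<partial>dx)
          \<le> s * (\<integral>p. (\<Sum>i<k. b i * u i p)\<^sup>2 \<partial>dx)) \<longrightarrow>
     real k \<le> C * (1 + s)"
proof -
  obtain n cs a r where cc: "\<forall>i<n::nat. cs i \<in> A \<and> 0 < (r i :: real) \<and> cball (a i) (2 * r i) \<subseteq> chart_image (cs i)"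
    and cov: "topspace X = (\<Union>i<n. coord_inv (cs i) ` ball (a i) (r i))"
    using finite_ball_cover by blast
  have ci: "cs i \<in> A" "0 < r i" "cball (a i) (2 * r i) \<subseteq> chart_image (cs i)" if "i < n" for i
    using cc that by blast+
  \<comment> \<open>Lower left corner of the square of side 2 r centred at \<open>a i\<close>; it
    contains the ball of radius r and lies in the closed ball of radius 2 r.\<close>
  define a' where "a' = (\<lambda>i. a i - (\<chi> k. r i))"
  define L where "L = (\<lambda>i. 2 * r i)"
  define Q where "Q = (\<lambda>i. cbox (a' i) (a' i + (\<chi> k. L i)))"
  have QQ: "x \<in> Q i \<longleftrightarrow> \<bar>x$1 - a i$1\<bar> \<le> r i \<and> \<bar>x$2 - a i$2\<bar> \<le> r i" for x i
    by (auto simp: Q_def a'_def L_def mem_box_cart forall_2)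
  have Qsub: "Q i \<subseteq> chart_image (cs i)" if i: "i < n" for i
  proof -
    have "Q i \<subseteq> cball (a i) (2 * r i)"
    proof
      fix x assume "x \<in> Q i"
      then have "norm (x - a i) \<le> r i + r i"
        using norm_le_l1_cart[of "x - a i"] unfolding QQ by (simp add: sum_2)
      then show "x \<in> cball (a i) (2 * r i)" by (simp add: dist_norm norm_minus_commute)
    qed
    then show ?thesis using ci(3)[OF i] by blast
  qed
  have bQ: "ball (a i) (r i) \<subseteq> Q i" for i
  proof
    fix x assume "x \<in> ball (a i) (r i)"
    then have "norm (x - a i) < r i" by (simp add: dist_norm norm_minus_commute)
    then show "x \<in> Q i" unfolding QQ
      using component_le_norm_cart[of "x - a i" 1] component_le_norm_cart[of "x - a i" 2] by simp
  qed
  define R where "R = (\<lambda>i B. \<forall>N>0. \<forall>w. C1_fun w \<longrightarrow>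
     (\<forall>j\<in>{..<N}\<times>{..<N}. (LINT x:subsquare (a' i) (L i / real N) j|lborel. w (coord_inv (cs i) x)) = 0) \<longrightarrow>
     (\<integral>p. indicator (coord_inv (cs i) ` Q i) p * (w p)\<^sup>2 \<partial>dx) \<le> B / (real N)\<^sup>2 * (\<integral>p. energy w w p \<partial>dx))"
  have "\<exists>B\<ge>0. R i B" if i: "i < n" for i
    unfolding R_def
    by (rule local_weyl[OF ci(1)[OF i] _ _ Qsub[OF i]]) (use ci(2)[OF i] in \<open>auto simp: L_def Q_def\<close>)
  then have "\<forall>i. \<exists>B. i < n \<longrightarrow> 0 \<le> B \<and> R i B" by blast
  from choice[OF this] obtain B where BR: "\<forall>i. i < n \<longrightarrow> 0 \<le> B i \<and> R i (B i)" by (elim exE)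
  have B: "0 \<le> B i" if "i < n" for i using BR that by blast
  have Bw: "(\<integral>p. indicator (coord_inv (cs i) ` Q i) p * (w p)\<^sup>2 \<partial>dx) \<le> B i / (real N)\<^sup>2 * (\<integral>p. energy w w p \<partial>dx)"
    if "i < n" "0 < N" "C1_fun w"
      "\<forall>j\<in>{..<N}\<times>{..<N}. (LINT x:subsquare (a' i) (L i / real N) j|lborel. w (coord_inv (cs i) x)) = 0" for i N w
  proof -
    have "R i (B i)" using BR that(1) by blast
    from this[unfolded R_def, rule_format, OF that(2,3)] that(4) show ?thesis by blast
  qed
  define BB where "BB = (\<Sum>i<n. B i)"
  have BB: "0 \<le> BB" unfolding BB_def by (intro sum_nonneg) (use B in auto)
  have key: "k \<le> n * N\<^sup>2"
    if N: "0 < N" "BB * s < (real N)\<^sup>2" and u: "\<forall>i<k. C1_fun (u i)"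
      and ub: "\<And>b. \<exists>i<k. b i \<noteq> 0 \<Longrightarrow> 0 < (\<integral>p. (\<Sum>i<k. b i * u i p)\<^sup>2 \<partial>dx) \<and>
        (\<integral>p. energy (\<lambda>p. \<Sum>i<k. b i * u i p) (\<lambda>p. \<Sum>i<k. b i * u i p) p \<partial>dx)
          \<le> s * (\<integral>p. (\<Sum>i<k. b i * u i p)\<^sup>2 \<partial>dx)" for N k s and u :: "nat \<Rightarrow> 'a \<Rightarrow> real"
  proof (rule ccontr)
    assume "\<not> k \<le> n * N\<^sup>2"
    define J where "J = {..<n} \<times> ({..<N} \<times> {..<N})"
    have "card J < card {..<k}"
      using \<open>\<not> k \<le> n * N\<^sup>2\<close> by (simp add: J_def card_cartesian_product power2_eq_square)
    then obtain b where b: "\<exists>i\<in>{..<k}. b i \<noteq> 0"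
      and bz: "\<forall>j\<in>J. (\<Sum>i\<in>{..<k}. b i * (LINT x:subsquare (a' (fst j)) (L (fst j) / real N) (snd j)|lborel. u i (coord_inv (cs (fst j)) x))) = 0"
      using homogeneous_system_nontrivial[of J "{..<k}"
          "\<lambda>j i. LINT x:subsquare (a' (fst j)) (L (fst j) / real N) (snd j)|lborel. u i (coord_inv (cs (fst j)) x)"]
      by (auto simp: J_def)
    define w where "w = (\<lambda>p. \<Sum>i<k. b i * u i p)"
    have w: "C1_fun w" unfolding w_def by (intro C1_fun_sum C1_fun_mult C1_fun_const) (use u in auto)
    have wp: "0 < (\<integral>p. (w p)\<^sup>2 \<partial>dx)" "(\<integral>p. energy w w p \<partial>dx) \<le> s * (\<integral>p. (w p)\<^sup>2 \<partial>dx)"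
      using ub[of b] b by (auto simp: w_def)
    have mean: "(LINT x:subsquare (a' i) (L i / real N) j|lborel. w (coord_inv (cs i) x)) = 0"
      if i: "i < n" and j: "j \<in> {..<N} \<times> {..<N}" for i j
    proof -
      let ?q = "subsquare (a' i) (L i / real N) j"
      obtain j1 j2 where jj: "j = (j1, j2)" "j1 < N" "j2 < N" using j by auto
      have qQ: "?q \<subseteq> Q i"
      proof
        fix x assume x: "x \<in> ?q"
        define h where "h = L i / real N"
        have h: "0 < h" "h * real N = 2 * r i" using N ci(2)[OF i] by (auto simp: h_def L_def)
        have "h * (real j1 + 1) \<le> h * real N" "h * (real j2 + 1) \<le> h * real N" "0 \<le> h * real j1" "0 \<le> h * real j2"
          using jj h(1) by (intro mult_left_mono mult_nonneg_nonneg; simp)+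
        then show "x \<in> Q i"
          using x h(2) unfolding jj(1) mem_subsquare QQ h_def[symmetric] by (auto simp: a'_def)
      qed
      have int: "integrable lborel (\<lambda>x. indicator ?q x *\<^sub>R u l (coord_inv (cs i) x))" if "l < k" for l
      proof (rule borel_integrable_compact)
        show "continuous_on ?q (\<lambda>x. u l (coord_inv (cs i) x))"
          using qQ Qsub[OF i] u that
          by (intro continuous_on_subset[OF C1_onD(3)[OF C1_funD[OF _ ci(1)[OF i]]]]) auto
      qed (simp add: subsquare_def)
      have "(LINT x:?q|lborel. w (coord_inv (cs i) x)) = (\<integral>x. (\<Sum>l<k. b l * (indicator ?q x *\<^sub>R u l (coord_inv (cs i) x))) \<partial>lborel)"
        unfolding set_lebesgue_integral_def w_def
        by (intro Bochner_Integration.integral_cong refl) (simp add: sum_distrib_left mult_ac)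
      also have "\<dots> = (\<Sum>l<k. b l * (LINT x:?q|lborel. u l (coord_inv (cs i) x)))"
        unfolding set_lebesgue_integral_def using int
        by (subst Bochner_Integration.integral_sum) (auto intro!: integrable_mult_right)
      also have "\<dots> = 0" using bspec[OF bz, of "(i, j)"] i j by (simp add: J_def)
      finally show ?thesis .
    qed
    have iw: "integrable dx (\<lambda>p. (w p)\<^sup>2)"
    proof (rule continuous_integrable)
      show "continuous_map X euclidean (\<lambda>p. (w p)\<^sup>2)"
        unfolding power2_eq_square by (intro continuous_map_real_mult C1_fun_continuous w)
    qed
    have qs: "coord_inv (cs i) ` Q i \<in> sets dx" if "i < n" for i
      using coord_inv_compact_measurable(1)[OF ci(1)[OF that] Qsub[OF that]] by (simp add: Q_def)
    have iq: "integrable dx (\<lambda>p. indicator (coord_inv (cs i) ` Q i) p * (w p)\<^sup>2)" if "i < n" for i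
      using integrable_mult_indicator[OF qs[OF that] iw] by simp
    have "(\<integral>p. (w p)\<^sup>2 \<partial>dx) \<le> (\<integral>p. (\<Sum>i<n. indicator (coord_inv (cs i) ` Q i) p * (w p)\<^sup>2) \<partial>dx)"
    proof (rule integral_mono[OF iw])
      show "integrable dx (\<lambda>p. \<Sum>i<n. indicator (coord_inv (cs i) ` Q i) p * (w p)\<^sup>2)"
        by (intro Bochner_Integration.integrable_sum) (use iq in auto)
      fix p assume "p \<in> space dx"
      then obtain i where i: "i < n" "p \<in> coord_inv (cs i) ` ball (a i) (r i)" using cov by auto
      then have "p \<in> coord_inv (cs i) ` Q i" using bQ by blast
      then have "(w p)\<^sup>2 = indicator (coord_inv (cs i) ` Q i) p * (w p)\<^sup>2" by simp
      also have "\<dots> \<le> (\<Sum>i<n. indicator (coord_inv (cs i) ` Q i) p * (w p)\<^sup>2)"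
        by (rule member_le_sum) (use i in auto)
      finally show "(w p)\<^sup>2 \<le> (\<Sum>i<n. indicator (coord_inv (cs i) ` Q i) p * (w p)\<^sup>2)" .
    qed
    also have "\<dots> = (\<Sum>i<n. \<integral>p. indicator (coord_inv (cs i) ` Q i) p * (w p)\<^sup>2 \<partial>dx)"
      by (intro Bochner_Integration.integral_sum) (use iq in auto)
    also have "\<dots> \<le> (\<Sum>i<n. B i / (real N)\<^sup>2 * (\<integral>p. energy w w p \<partial>dx))"
      by (intro sum_mono Bw N w) (use mean in auto)
    also have "\<dots> = BB / (real N)\<^sup>2 * (\<integral>p. energy w w p \<partial>dx)"
      by (simp add: BB_def sum_distrib_right sum_divide_distrib)
    also have "\<dots> \<le> BB / (real N)\<^sup>2 * (s * (\<integral>p. (w p)\<^sup>2 \<partial>dx))"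
      using BB wp(2) by (intro mult_left_mono) auto
    finally have "1 * (\<integral>p. (w p)\<^sup>2 \<partial>dx) \<le> (BB * s / (real N)\<^sup>2) * (\<integral>p. (w p)\<^sup>2 \<partial>dx)" by simp
    then have "1 \<le> BB * s / (real N)\<^sup>2" using wp(1) by (rule mult_right_le_imp_le)
    then show False using N by (simp add: field_simps)
  qed
  have "real k \<le> real n * (2 * BB + 8) * (1 + s)"
    if s: "0 \<le> s" and u: "\<forall>i<k. C1_fun (u i)"
      and ub: "\<And>b. \<exists>i<k. b i \<noteq> 0 \<Longrightarrow> 0 < (\<integral>p. (\<Sum>i<k. b i * u i p)\<^sup>2 \<partial>dx) \<and>
        (\<integral>p. energy (\<lambda>p. \<Sum>i<k. b i * u i p) (\<lambda>p. \<Sum>i<k. b i * u i p) p \<partial>dx)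
          \<le> s * (\<integral>p. (\<Sum>i<k. b i * u i p)\<^sup>2 \<partial>dx)" for k s and u :: "nat \<Rightarrow> 'a \<Rightarrow> real"
  proof -
    define y where "y = sqrt (BB * s)"
    have y: "0 \<le> y" "y\<^sup>2 = BB * s" using BB s by (auto simp: y_def)
    \<comment> \<open>Just above sqrt(BB s) and positive: BB s < N^2, while N^2 \<le> (y + 2)^2
      \<le> 2 y^2 + 8 stays linear in s.\<close>
    define N where "N = Suc (nat \<lceil>y\<rceil>)"
    have N: "y < real N" "real N \<le> y + 2" using y(1) unfolding N_def by linarith+
    have "BB * s < (real N)\<^sup>2" using power_strict_mono[OF N(1) y(1), of 2] y(2) by simp
    then have "k \<le> n * N\<^sup>2" using key[of N s k u] u ub by (auto simp: N_def)
    then have "real k \<le> real (n * N\<^sup>2)" by (rule of_nat_mono)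
    also have "\<dots> = real n * (real N)\<^sup>2" by simp
    also have "\<dots> \<le> real n * (2 * (BB * s) + 8)"
    proof (rule mult_left_mono)
      have "(real N)\<^sup>2 \<le> (y + 2)\<^sup>2" using N(2) by (intro power_mono) auto
      also have "\<dots> \<le> 2 * y\<^sup>2 + 8" using zero_le_power2[of "y - 2"] by (simp add: power2_eq_square algebra_simps)
      finally show "(real N)\<^sup>2 \<le> 2 * (BB * s) + 8" using y by simp
    qed simp
    also have "\<dots> \<le> real n * ((2 * BB + 8) * (1 + s))"
      using BB s by (intro mult_left_mono) (auto simp: algebra_simps)
    finally show ?thesis by (simp add: mult.assoc)
  qed
  moreover have "0 \<le> real n * (2 * BB + 8)" using BB by simp
  ultimately show ?thesis by blast
qed

end

section \<open>Conformal changes of the metric\<close>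

lemma area_density_conformal:
  assumes "0 < h p"
  shows "area_density (conformal_metric h g) c p = h p * area_density g c p"
proof -
  have "det (h p *\<^sub>R g c p) = (h p)\<^sup>2 * det (g c p)"
    by (simp add: det_2 power2_eq_square algebra_simps)
  then show ?thesis using assms by (simp add: area_density_def conformal_metric_def real_sqrt_mult)
qed

text \<open>In dimension two the area density scales by h and the inverse metric by 1 / h. Their
  product is the coefficient matrix of the Dirichlet form, whence its conformal invariance.\<close>

lemma weighted_cometric_conformal:
  assumes "0 < h p"
  shows "area_density (conformal_metric h g) c p * matrix_inv (conformal_metric h g c p) $ i $ j =
    area_density g c p * matrix_inv (g c p) $ i $ j"
\<comment> \<open>A degenerate tensor has area density 0, which makes both sides 0 whatever
  \<open>matrix_inv\<close> returns.\<close>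
proof (cases "det (g c p) = 0")
  case True
  then have "area_density g c p = 0" by (simp add: area_density_def)
  then show ?thesis by (simp add: area_density_conformal[of h p g c] assms)
next
  case False
  have d: "det (h p *\<^sub>R g c p) = (h p)\<^sup>2 * det (g c p)"
    by (simp add: det_2 power2_eq_square algebra_simps)
  have "matrix_inv (h p *\<^sub>R g c p) $ i $ j = matrix_inv (g c p) $ i $ j / h p"
    using False assms by (simp add: matrix_inv_2x2 d power2_eq_square)
  then have "matrix_inv (conformal_metric h g c p) $ i $ j = matrix_inv (g c p) $ i $ j / h p"
    by (simp add: conformal_metric_def)
  then show ?thesis using assms by (simp add: area_density_conformal[of h p g c])
qed

text \<open>Only the outer factor, the inverse area density, feels h. Positivity is required on the
  whole type because the coefficients are compared on the whole plane, where
  \<open>coord_inv\<close> may take arbitrary values.\<close>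

lemma laplacian_conformal:
  assumes "\<And>q. 0 < h q"
  shows "laplacian A g u p = h p *\<^sub>R laplacian A (conformal_metric h g) u p"
proof -
  have "laplace_in_chart g c u p = h p *\<^sub>R laplace_in_chart (conformal_metric h g) c u p" for c
    using assms[of p] unfolding laplace_in_chart_def weighted_cometric_conformal[of h, OF assms] area_density_conformal[of h p, OF assms]
    by simp
  then show ?thesis by (simp add: laplacian_def)
qed

context closed_riemannian_surface
begin

section \<open>Complex eigenfunctions and the passage to the abstract pencil\<close>

lemma smooth_function_Ck: "smooth_function A u \<Longrightarrow> c \<in> A \<Longrightarrow> Ck_on k (chart_image c) (\<lambda>x. u (coord_inv c x))"
  by (simp add: smooth_function_def smooth_on_def o_def)

lemma smooth_function_partial_Ck:
  "smooth_function A u \<Longrightarrow> c \<in> A \<Longrightarrow> Ck_on 1 (chart_image c) (partial_deriv j (\<lambda>x. u (coord_inv c x)))"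
  using smooth_function_Ck[of u c "Suc (Suc 0)"] unfolding partial_deriv_def by auto

lemma smooth_function_differentiable:
  assumes "smooth_function A u" "c \<in> A" "x \<in> chart_image c"
  shows "(\<lambda>x. u (coord_inv c x)) differentiable (at x)"
    "partial_deriv j (\<lambda>x. u (coord_inv c x)) differentiable (at x)"
  using smooth_function_Ck[OF assms(1,2), of "Suc 0"] smooth_function_partial_Ck[OF assms(1,2), of j] assms(3) by auto

lemma smooth_function_C2:
  assumes u: "smooth_function A u" and L: "bounded_linear (L :: 'b::real_normed_vector \<Rightarrow> real)"
  shows "C2_fun (\<lambda>p. L (u p))"
  unfolding C2_fun_def C1_fun_def
proof (intro conjI ballI allI)
  fix c j assume c: "c \<in> A"
  show "C1_on (chart_image c) (\<lambda>x. L (u (coord_inv c x)))"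
    by (rule Ck_on_1_bounded_linear[OF L smooth_function_Ck[OF u c]])
  show "C1_on (chart_image c) (partial_deriv j (\<lambda>x. L (u (coord_inv c x))))"
  proof (rule C1_on_cong[OF chart_open[OF chart[OF c]]])
    show "C1_on (chart_image c) (\<lambda>x. L (partial_deriv j (\<lambda>x. u (coord_inv c x)) x))"
      by (rule Ck_on_1_bounded_linear[OF L smooth_function_partial_Ck[OF u c]])
    show "L (partial_deriv j (\<lambda>x. u (coord_inv c x)) y) = partial_deriv j (\<lambda>x. L (u (coord_inv c x))) y"
      if "y \<in> chart_image c" for y
      by (rule partial_deriv_bounded_linear[OF L smooth_function_differentiable(1)[OF u c that], symmetric])
  qed
qed

text \<open>Splits a complex eigenfunction into real functions: L will be \<open>Re\<close> or
  \<open>Im\<close>.\<close>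

lemma laplacian_bounded_linear:
  assumes u: "smooth_function A u" and L: "bounded_linear (L :: 'b::real_normed_vector \<Rightarrow> real)"
    and p: "p \<in> topspace X"
  shows "laplacian A g (\<lambda>p. L (u p)) p = L (laplacian A g u p)"
proof -
  have "laplace_in_chart g c (\<lambda>p. L (u p)) p = L (laplace_in_chart g c u p)" if c: "c \<in> A" "p \<in> fst c" for c
  proof -
    let ?k = "\<lambda>i j x. area_density g c (coord_inv c x) * matrix_inv (g c (coord_inv c x)) $ i $ j"
    let ?u = "\<lambda>x. u (coord_inv c x)"
    have x: "snd c p \<in> chart_image c" using c by simp
    have "partial_deriv i (\<lambda>x. ?k i j x *\<^sub>R partial_deriv j (\<lambda>x. L (?u x)) x) (snd c p)
       = L (partial_deriv i (\<lambda>x. ?k i j x *\<^sub>R partial_deriv j ?u x) (snd c p))" for i j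
    proof -
      have dk: "?k i j differentiable (at (snd c p))"
        using C1_on_mult[OF area_density_C1[OF c(1)] cometric_C1[OF c(1)]] x by (auto simp: C1_on_def)
      have d: "(\<lambda>x. ?k i j x *\<^sub>R partial_deriv j ?u x) differentiable (at (snd c p))"
        by (intro differentiable_scaleR dk smooth_function_differentiable(2)[OF u c(1) x])
      have "grad (\<lambda>x. ?k i j x *\<^sub>R partial_deriv j (\<lambda>x. L (?u x)) x) (snd c p)
          = grad (\<lambda>x. L (?k i j x *\<^sub>R partial_deriv j ?u x)) (snd c p)"
      proof (rule grad_cong(1)[OF chart_open[OF chart[OF c(1)]] x])
        show "L (?k i j y *\<^sub>R partial_deriv j ?u y) = ?k i j y *\<^sub>R partial_deriv j (\<lambda>x. L (?u x)) y"
          if "y \<in> chart_image c" for y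
          using partial_deriv_bounded_linear[OF L smooth_function_differentiable(1)[OF u c(1) that]]
          by (simp add: linear_cmul[OF bounded_linear.linear[OF L]])
      qed (rule differentiable_bounded_linear[OF L d])
      then have "partial_deriv i (\<lambda>x. ?k i j x *\<^sub>R partial_deriv j (\<lambda>x. L (?u x)) x) (snd c p)
          = partial_deriv i (\<lambda>x. L (?k i j x *\<^sub>R partial_deriv j ?u x)) (snd c p)"
        unfolding grad_def vec_eq_iff by simp
      then show ?thesis using partial_deriv_bounded_linear[OF L d] by simp
    qed
    then show ?thesis
      unfolding laplace_in_chart_def o_def
      using bounded_linear.linear[OF L] by (simp add: linear_neg linear_sum linear_cmul sum_divide_distrib)
  qed
  moreover have "(SOME c. c \<in> A \<and> p \<in> fst c) \<in> A \<and> p \<in> fst (SOME c. c \<in> A \<and> p \<in> fst c)"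
    by (rule someI_ex) (use ex_chart[OF p] in blast)
  ultimately show ?thesis unfolding laplacian_def by blast
qed

text \<open>By uniqueness it is enough that the weighted measure has the rescaled area density in
  every chart.\<close>

lemma area_measure_conformal:
  assumes h: "continuous_map X euclidean h" "\<And>p. 0 < h p"
  shows "area_measure X A (conformal_metric h g) = density dx (\<lambda>p. ennreal (h p))"
proof (rule area_measure_eqI[OF surf])
  have hm: "h \<in> borel_measurable (borel_sigma X)" by (rule continuous_map_borel_measurable[OF h(1)])
  show "is_area_measure X A (conformal_metric h g) (density dx (\<lambda>p. ennreal (h p)))"
    unfolding is_area_measure_def
  proof (intro conjI ballI impI)
    show "space (density dx (\<lambda>p. ennreal (h p))) = topspace X" by simp
    show "sets (density dx (\<lambda>p. ennreal (h p))) = sigma_sets (topspace X) {U. openin X U}"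
      by (simp add: sets_borel_sigma)
    fix c E assume c: "c \<in> A" and "E \<in> sets (density dx (\<lambda>p. ennreal (h p)))" and Ec: "E \<subseteq> fst c"
    then have E: "E \<in> sets (borel_sigma X)" by simp
    have im: "x \<in> snd c ` E \<longleftrightarrow> x \<in> chart_image c \<and> coord_inv c x \<in> E" for x
      using chart_image_inter[OF chart[OF c], of E] Ec by (auto simp: Int_absorb2)
    have "emeasure (density dx (\<lambda>p. ennreal (h p))) E = (\<integral>\<^sup>+p. ennreal (h p) * indicator E p \<partial>dx)"
      using E hm by (intro emeasure_density) auto
    also have "\<dots> = (\<integral>\<^sup>+p. indicator (fst c) p * (ennreal (h p) * indicator E p) \<partial>dx)"
      using Ec by (intro nn_integral_cong) (auto simp: indicator_def)
    also have "\<dots> = (\<integral>\<^sup>+x. ennreal (indicator (chart_image c) x * area_density g c (coord_inv c x))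
        * ((ennreal (h (coord_inv c x)) * indicator E (coord_inv c x)) * indicator (chart_image c) x) \<partial>lborel)"
      using hm E by (intro nn_integral_chart c) auto
    also have "\<dots> = (\<integral>\<^sup>+ x\<in>snd c ` E. ennreal (area_density (conformal_metric h g) c (coord_inv c x)) \<partial>lborel)"
    proof (intro nn_integral_cong)
      fix x
      show "ennreal (indicator (chart_image c) x * area_density g c (coord_inv c x))
        * ((ennreal (h (coord_inv c x)) * indicator E (coord_inv c x)) * indicator (chart_image c) x) =
         ennreal (area_density (conformal_metric h g) c (coord_inv c x)) * indicator (snd c ` E) x"
      proof (cases "x \<in> snd c ` E")
        case True
        then have x: "x \<in> chart_image c" "coord_inv c x \<in> E" using im by auto
        have "ennreal (area_density g c (coord_inv c x)) * ennreal (h (coord_inv c x)) =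
            ennreal (h (coord_inv c x) * area_density g c (coord_inv c x))"
          using h(2)[of "coord_inv c x"] area_density_pos[OF c coord_inv_mem[OF chart[OF c] x(1)]]
          by (simp add: ennreal_mult mult.commute)
        then show ?thesis using True x h(2) by (simp add: area_density_conformal)
      next
        case False
        then show ?thesis using im[of x] by (auto simp: indicator_def)
      qed
    qed
    finally show "emeasure (density dx (\<lambda>p. ennreal (h p))) E =
      (\<integral>\<^sup>+ x\<in>snd c ` E. ennreal (area_density (conformal_metric h g) c (coord_inv c x)) \<partial>lborel)" .
  qed
qed

lemma C1_fun_pencil:
  assumes f: "continuous_map X euclidean f" "\<And>p. p \<in> topspace X \<Longrightarrow> 0 \<le> f p"
  shows "\<exists>F C. conformal_pencil dx f (Collect C1_fun) (\<lambda>u v. \<integral>p. energy u v p \<partial>dx) F C"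
proof -
  obtain F0 where F0: "\<forall>p\<in>topspace X. \<bar>f p\<bar> \<le> F0" using continuous_bounded[OF f(1)] by blast
  obtain C where C: "0 \<le> C" and weyl: "\<And>s k u. 0 \<le> s \<Longrightarrow> (\<forall>i<k. C1_fun (u i)) \<Longrightarrow>
     (\<forall>b. (\<exists>i<k. b i \<noteq> 0) \<longrightarrow>
        0 < (\<integral>p. (\<Sum>i<k. b i * u i p)\<^sup>2 \<partial>dx) \<and>
        (\<integral>p. energy (\<lambda>p. \<Sum>i<k. b i * u i p) (\<lambda>p. \<Sum>i<k. b i * u i p) p \<partial>dx)
          \<le> s * (\<integral>p. (\<Sum>i<k. b i * u i p)\<^sup>2 \<partial>dx)) \<Longrightarrow>
     real k \<le> C * (1 + s)"
    using weyl_upper_bound by blast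
  interpret finite_measure dx by (rule finite_measure_dx)
  have ie: "integrable dx (energy u v)" if "C1_fun u" "C1_fun v" for u v
    by (intro continuous_integrable energy_continuous that)
  \<comment> \<open>The pencil asks for a strictly positive bound of f, hence the maximum with
    1.\<close>
  have "conformal_pencil dx f (Collect C1_fun) (\<lambda>u v. \<integral>p. energy u v p \<partial>dx) (max F0 1) C"
  proof unfold_locales
    show "f \<in> borel_measurable dx" using continuous_map_borel_measurable[OF f(1)] by simp
    show "0 \<le> f x" "f x \<le> max F0 1" if "x \<in> space dx" for x using f(2) F0 that by force+
    show "(0::real) < max F0 1" by simp
    show "v \<in> borel_measurable dx" if "v \<in> Collect C1_fun" for v
      using that continuous_map_borel_measurable[OF C1_fun_continuous] by simp
    show "\<exists>B. \<forall>x\<in>space dx. \<bar>v x\<bar> \<le> B" if "v \<in> Collect C1_fun" for v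
      using that continuous_bounded[OF C1_fun_continuous] by simp
    show "(\<lambda>x. 0) \<in> Collect C1_fun" by (simp add: C1_fun_const)
    show "(\<lambda>x. u x + v x) \<in> Collect C1_fun" if "u \<in> Collect C1_fun" "v \<in> Collect C1_fun" for u v
      using that by (simp add: C1_fun_add)
    show "(\<lambda>x. a * v x) \<in> Collect C1_fun" if "v \<in> Collect C1_fun" for a v
      using that by (simp add: C1_fun_mult C1_fun_const)
    show "(\<integral>p. energy (\<lambda>x. u x + v x) w p \<partial>dx) = (\<integral>p. energy u w p \<partial>dx) + (\<integral>p. energy v w p \<partial>dx)"
      if "u \<in> Collect C1_fun" "v \<in> Collect C1_fun" "w \<in> Collect C1_fun" for u v w
    proof -
      have "(\<integral>p. energy (\<lambda>x. u x + v x) w p \<partial>dx) = (\<integral>p. energy u w p + energy v w p \<partial>dx)"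
        using that by (intro Bochner_Integration.integral_cong) (auto simp: energy_add)
      then show ?thesis using that ie by simp
    qed
    show "(\<integral>p. energy (\<lambda>x. a * u x) w p \<partial>dx) = a * (\<integral>p. energy u w p \<partial>dx)"
      if "u \<in> Collect C1_fun" "w \<in> Collect C1_fun" for a u w
    proof -
      have "(\<integral>p. energy (\<lambda>x. a * u x) w p \<partial>dx) = (\<integral>p. a * energy u w p \<partial>dx)"
        using that by (intro Bochner_Integration.integral_cong) (auto simp: energy_cmul)
      then show ?thesis by simp
    qed
    show "(\<integral>p. energy u v p \<partial>dx) = (\<integral>p. energy v u p \<partial>dx)" if "u \<in> Collect C1_fun" "v \<in> Collect C1_fun" for u v
      using that by (intro Bochner_Integration.integral_cong) (auto simp: energy_sym)
    show "0 \<le> (\<integral>p. energy u u p \<partial>dx)" if "u \<in> Collect C1_fun" for u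
      using that by (intro integral_nonneg_AE AE_I2) (simp add: energy_nonneg)
    show "0 \<le> C" by (rule C)
    show "real k \<le> C * (1 + s)"
      if "0 \<le> s" "\<And>i. i < k \<Longrightarrow> e i \<in> Collect C1_fun"
        "\<And>a. \<exists>i<k. a i \<noteq> 0 \<Longrightarrow> 0 < (\<integral>x. (\<Sum>i<k. a i * e i x)\<^sup>2 \<partial>dx) \<and>
          (\<integral>p. energy (\<lambda>x. \<Sum>i<k. a i * e i x) (\<lambda>x. \<Sum>i<k. a i * e i x) p \<partial>dx)
            \<le> s * (\<integral>x. (\<Sum>i<k. a i * e i x)\<^sup>2 \<partial>dx)" for s k and e :: "nat \<Rightarrow> 'a \<Rightarrow> real"
      by (rule weyl[OF that(1), of k e]) (use that(2,3) in auto)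
  qed
  then show ?thesis by blast
qed

text \<open>The conformal factor leaves the operator and enters the measure: an eigenfunction of the
  metric h g satisfies a weak equation with the energy of g and the weight h.\<close>

lemma eigenfunction_real_part:
  assumes e: "eigenfunction X A (conformal_metric h g) \<mu> \<phi>" and h: "\<And>p. 0 < h p"
    and L: "bounded_linear (L :: complex \<Rightarrow> real)" and w: "C1_fun w"
  shows "C1_fun (\<lambda>p. L (\<phi> p))"
    and "(\<integral>p. energy w (\<lambda>p. L (\<phi> p)) p \<partial>dx) = \<mu> * (\<integral>p. w p * L (\<phi> p) * h p \<partial>dx)"
proof -
  have s: "smooth_function A \<phi>" and ev: "\<And>p. p \<in> topspace X \<Longrightarrow> laplacian A (conformal_metric h g) \<phi> p = \<mu> *\<^sub>R \<phi> p"
    using e by (auto simp: eigenfunction_def)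
  have C2: "C2_fun (\<lambda>p. L (\<phi> p))" by (rule smooth_function_C2[OF s L])
  then show "C1_fun (\<lambda>p. L (\<phi> p))" by (simp add: C2_fun_def)
  have "laplacian A g (\<lambda>p. L (\<phi> p)) p = \<mu> * (L (\<phi> p) * h p)" if p: "p \<in> topspace X" for p
  proof -
    have "laplacian A g (\<lambda>p. L (\<phi> p)) p = L (h p *\<^sub>R (\<mu> *\<^sub>R \<phi> p))"
      using laplacian_bounded_linear[OF s L p] laplacian_conformal[of h A g \<phi> p, OF h] ev[OF p] by simp
    then show ?thesis using bounded_linear.linear[OF L] by (simp add: linear_cmul mult_ac)
  qed
  then have "(\<integral>p. w p * laplacian A g (\<lambda>p. L (\<phi> p)) p \<partial>dx) = (\<integral>p. \<mu> * (w p * L (\<phi> p) * h p) \<partial>dx)"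
    by (intro Bochner_Integration.integral_cong) (auto simp: mult_ac)
  then show "(\<integral>p. energy w (\<lambda>p. L (\<phi> p)) p \<partial>dx) = \<mu> * (\<integral>p. w p * L (\<phi> p) * h p \<partial>dx)"
    using green[OF w C2] by simp
qed

end

section \<open>Concentration of eigenfunctions\<close>

context conformal_pencil
begin

text \<open>Forces the concentration integral to vanish together with the norm.\<close>

lemma ipf_le: "u \<in> V \<Longrightarrow> ipf t u \<le> F * ip t u u"
proof -
  assume u: "u \<in> V"
  have "ipf t u \<le> (\<integral>x. F * ((u x)\<^sup>2 * exp (- (t * f x))) \<partial>M)"
    unfolding ipf_def
  proof (rule integral_mono)
    show "f x * (u x)\<^sup>2 * exp (- (t * f x)) \<le> F * ((u x)\<^sup>2 * exp (- (t * f x)))" if "x \<in> space M" for x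
      using mult_right_mono[OF f_le[OF that], of "(u x)\<^sup>2 * exp (- (t * f x))"] by (simp add: mult.assoc)
  qed (intro integrable_ipf integrable_mult_right integrable_ip2 u)+
  then show ?thesis by (simp add: ip_def power2_eq_square)
qed

text \<open>The two functions will be the real and imaginary parts of a complex eigenfunction.\<close>

lemma eigen_of_pair:
  assumes u: "u \<in> V" "\<And>w. w \<in> V \<Longrightarrow> D w u = \<mu> * ip t w u"
    and v: "v \<in> V" "\<And>w. w \<in> V \<Longrightarrow> D w v = \<mu> * ip t w v"
    and one: "ip t u u + ip t v v = 1" and \<eta>: "\<eta> \<le> ipf t u + ipf t v"
  shows "\<exists>\<psi>. eigen t \<mu> \<psi> \<and> \<eta> \<le> ipf t \<psi>"
proof -
  have normalise: "\<exists>\<psi>. eigen t \<mu> \<psi> \<and> \<eta> \<le> ipf t \<psi>"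
    if z: "z \<in> V" "\<And>w. w \<in> V \<Longrightarrow> D w z = \<mu> * ip t w z" "0 < ip t z z" "\<eta> * ip t z z \<le> ipf t z" for z
  proof -
    define k where "k = 1 / sqrt (ip t z z)"
    define \<psi> where "\<psi> = (\<lambda>x. k * z x)"
    have k2: "k\<^sup>2 * ip t z z = 1" using z(3) by (simp add: k_def power_divide)
    have sc: "ip t w \<psi> = k * ip t w z" for w
      unfolding \<psi>_def using ip_scale[of t k z w] ip_sym by metis
    have "ip t \<psi> \<psi> = 1"
      unfolding sc using ip_scale[of t k z z] k2 by (simp add: \<psi>_def power2_eq_square mult.assoc)
    moreover have \<psi>: "\<psi> \<in> V" unfolding \<psi>_def by (rule V_scale[OF z(1)])
    moreover have "D w \<psi> = \<mu> * ip t w \<psi>" if w: "w \<in> V" for w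
      using D_sym[OF w \<psi>] D_scale[OF z(1) w, of k] D_sym[OF z(1) w] z(2)[OF w] by (simp add: sc[unfolded \<psi>_def] \<psi>_def)
    ultimately have "eigen t \<mu> \<psi>" by (simp add: eigen_def)
    moreover have "ipf t \<psi> = k\<^sup>2 * ipf t z"
      unfolding ipf_def \<psi>_def Bochner_Integration.integral_mult_right_zero[symmetric]
      by (intro Bochner_Integration.integral_cong) (auto simp: power_mult_distrib)
    moreover have "\<eta> \<le> k\<^sup>2 * ipf t z"
      using mult_left_mono[OF z(4), of "k\<^sup>2"] k2 by (simp add: mult.left_commute)
    ultimately show ?thesis by auto
  qed
  \<comment> \<open>The norms add up to 1 and the concentration integrals to at least \<eta>, so one
    of the two quotients is at least \<eta>. A part of norm zero contributes nothing, by
    \<open>ipf_le\<close>.\<close>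
  have or: "(0 < ip t u u \<and> \<eta> * ip t u u \<le> ipf t u) \<or> (0 < ip t v v \<and> \<eta> * ip t v v \<le> ipf t v)"
  proof (rule ccontr)
    assume neg: "\<not> ?thesis"
    have *: "ipf t z \<le> \<eta> * ip t z z \<and> (0 < ip t z z \<longrightarrow> ipf t z < \<eta> * ip t z z)"
      if z: "z \<in> V" "\<not> (0 < ip t z z \<and> \<eta> * ip t z z \<le> ipf t z)" for z
    proof (cases "0 < ip t z z")
      case False
      then have "ip t z z = 0" using ip_nonneg[of t z] by simp
      then show ?thesis using ipf_le[OF z(1), of t] by simp
    qed (use z in auto)
    have "0 < ip t u u \<or> 0 < ip t v v" using one ip_nonneg[of t u] ip_nonneg[of t v] by linarith
    then have "ipf t u + ipf t v < \<eta> * ip t u u + \<eta> * ip t v v"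
      using *[OF u(1)] *[OF v(1)] neg by fastforce
    also have "\<dots> = \<eta>" using one by (simp add: distrib_left[symmetric])
    finally show False using \<eta> by simp
  qed
  from or show ?thesis
  proof
    assume "0 < ip t u u \<and> \<eta> * ip t u u \<le> ipf t u"
    then show ?thesis by (intro normalise[OF u]) auto
  next
    assume "0 < ip t v v \<and> \<eta> * ip t v v \<le> ipf t v"
    then show ?thesis by (intro normalise[OF v]) auto
  qed
qed

text \<open>The exceptional times are defined through all eigenfunctions with eigenvalue in the
  interval at once, so the null set does not depend on a later choice of a sequence.\<close>

lemma AE_no_concentration:
  fixes lam l q :: "nat \<Rightarrow> real"
  assumes l0: "\<And>m. 0 \<le> l m" and lam: "filterlim lam at_top sequentially" and l: "l \<longlonglongrightarrow> 0"
    and q: "\<And>m. 0 < q m" "q \<longlonglongrightarrow> 0" and sum: "summable (\<lambda>m. l m / q m)" and \<epsilon>: "0 < \<epsilon>"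
  shows "AE t in lebesgue. t \<in> {0<..1} \<longrightarrow> (\<forall>\<^sub>F m in sequentially.
    \<forall>\<mu> \<phi>. \<mu> \<in> {lam m - l m..lam m + l m} \<longrightarrow> eigen t \<mu> \<phi> \<longrightarrow> ipf t \<phi> < \<epsilon> * q m)"
proof -
  text \<open>The intervals may be degenerate; enlarging them costs only a summable amount.\<close>
  define l' where "l' = (\<lambda>m. l m + q m * (1/2)^m)"
  have l'pos: "0 < l' m" for m using l0[of m] q(1)[of m] by (simp add: l'_def add_nonneg_pos)
  have "(\<lambda>m. q m * (1/2)^m) \<longlonglongrightarrow> 0 * 0"
    by (intro tendsto_mult q(2) LIMSEQ_power_zero) simp
  then have "l' \<longlonglongrightarrow> 0" unfolding l'_def using tendsto_add[OF l] by fastforce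
  then have ev1: "\<forall>\<^sub>F m in sequentially. l' m < 1/2" by (rule order_tendstoD) simp
  have ev2: "\<forall>\<^sub>F m in sequentially. 2 \<le> lam m" using lam by (simp add: filterlim_at_top)
  have "l' m / q m = l m / q m + (1/2)^m" for m
    using q(1)[of m] by (simp add: l'_def add_divide_distrib)
  then have sum': "summable (\<lambda>m. l' m / q m)"
    using summable_add[OF sum, of "\<lambda>m. (1/2)^m"] by (simp add: summable_geometric)
  obtain m0 where m0: "\<And>m. m0 \<le> m \<Longrightarrow> l' m < 1/2 \<and> 2 \<le> lam m"
    using eventually_conj[OF ev1 ev2] by (auto simp: eventually_sequentially)
  define Bad where "Bad = (\<lambda>m. {t\<in>{0<..1}. \<exists>\<mu> \<phi>. \<mu> \<in> {lam m - l' m..lam m + l' m} \<and> eigen t \<mu> \<phi> \<and> \<epsilon> * q m \<le> ipf t \<phi>})"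
  \<comment> \<open>64 = 16 * 4: once lam \<ge> 2 and l' < 1/2, the quotient (1 + lam + 2 l') / (lam
    - l') is at most 4, so the frequency drops out of the bound.\<close>
  define bd where "bd = (\<lambda>m. 64 * C / \<epsilon> * (l' m / q m))"
  have "\<exists>E. E \<in> sets lebesgue \<and> Bad m \<subseteq> E \<and> emeasure lebesgue E \<le> ennreal (bd m)" if m: "m0 \<le> m" for m
  proof -
    have lm: "0 < l' m" "l' m < 1/2" "2 \<le> lam m" using l'pos m0[OF m] by auto
    have \<eta>: "0 < \<epsilon> * q m" using \<epsilon> q(1) by simp
    have gap: "0 < lam m - 2 * l' m" using lm by simp
    obtain E where E: "E \<in> sets lebesgue" "Bad m \<subseteq> E"
      "emeasure lebesgue E \<le> ennreal (16 * l' m * C * (1 + lam m + 2 * l' m) / ((lam m - l' m) * (\<epsilon> * q m)))"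
      unfolding Bad_def by (rule exceptional_set_measure_le[OF lm(1) gap \<eta>])
    have "16 * l' m * C * (1 + lam m + 2 * l' m) / ((lam m - l' m) * (\<epsilon> * q m))
        = (16 * C / \<epsilon> * (l' m / q m)) * ((1 + lam m + 2 * l' m) / (lam m - l' m))"
      by (simp add: field_simps)
    also have "\<dots> \<le> (16 * C / \<epsilon> * (l' m / q m)) * 4"
    proof (rule mult_left_mono)
      show "(1 + lam m + 2 * l' m) / (lam m - l' m) \<le> 4"
        using lm by (simp add: divide_le_eq)
      show "0 \<le> 16 * C / \<epsilon> * (l' m / q m)" using C_nonneg \<epsilon> lm(1) q(1)[of m] by simp
    qed
    also have "\<dots> = bd m" by (simp add: bd_def)
    finally have "emeasure lebesgue E \<le> ennreal (bd m)" using E(3) ennreal_leI order_trans by blast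
    with E(1,2) show ?thesis by blast
  qed
  \<comment> \<open>Measurability of \<open>Bad m\<close> is not known, so the Borel-Cantelli lemma
    is applied to measurable supersets.\<close>
  then have "\<forall>m. \<exists>E. m0 \<le> m \<longrightarrow> E \<in> sets lebesgue \<and> Bad m \<subseteq> E \<and> emeasure lebesgue E \<le> ennreal (bd m)"
    by blast
  from choice[OF this] obtain E where
    E: "\<forall>m. m0 \<le> m \<longrightarrow> E m \<in> sets lebesgue \<and> Bad m \<subseteq> E m \<and> emeasure lebesgue (E m) \<le> ennreal (bd m)"
    by (elim exE)
  define E' where "E' = (\<lambda>m. E (m + m0))"
  have E': "E' m \<in> sets lebesgue" "Bad (m + m0) \<subseteq> E' m" "emeasure lebesgue (E' m) \<le> ennreal (bd (m + m0))" for m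
    using E[rule_format, of "m + m0"] by (auto simp: E'_def)
  have bd0: "0 \<le> bd m" for m using C_nonneg \<epsilon> l'pos[of m] q(1)[of m] by (simp add: bd_def)
  have sbd: "summable (\<lambda>m. bd (m + m0))"
    unfolding bd_def using summable_ignore_initial_segment[OF summable_mult[OF sum']] .
  have "AE t in lebesgue. \<forall>\<^sub>F m in sequentially. t \<in> space lebesgue - E' m"
  proof (rule borel_cantelli_AE1[OF E'(1)])
    show "emeasure lebesgue (E' m) < \<infinity>" for m
      using le_less_trans[OF E'(3)] by simp
    have "measure lebesgue (E' m) \<le> bd (m + m0)" for m
      using E'(3)[of m] bd0 unfolding measure_def by (rule enn2real_leI[rotated])
    then show "summable (\<lambda>m. measure lebesgue (E' m))"
      by (intro summable_comparison_test'[OF sbd, of 0]) simp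
  qed
  then show ?thesis
  proof eventually_elim
    fix t assume ev: "\<forall>\<^sub>F m in sequentially. t \<in> space lebesgue - E' m"
    show "t \<in> {0<..1} \<longrightarrow> (\<forall>\<^sub>F m in sequentially.
      \<forall>\<mu> \<phi>. \<mu> \<in> {lam m - l m..lam m + l m} \<longrightarrow> eigen t \<mu> \<phi> \<longrightarrow> ipf t \<phi> < \<epsilon> * q m)"
    proof
      assume t: "t \<in> {0<..1}"
      have "\<forall>\<^sub>F m in sequentially. \<forall>\<mu> \<phi>. \<mu> \<in> {lam (m + m0) - l (m + m0)..lam (m + m0) + l (m + m0)} \<longrightarrow>
          eigen t \<mu> \<phi> \<longrightarrow> ipf t \<phi> < \<epsilon> * q (m + m0)"
        using ev
      proof eventually_elim
        fix m assume "t \<in> space lebesgue - E' m"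
        then have nb: "t \<notin> Bad (m + m0)" using E'(2) by blast
        have ll: "l (m + m0) \<le> l' (m + m0)" using q(1)[of "m + m0"] by (simp add: l'_def)
        show "\<forall>\<mu> \<phi>. \<mu> \<in> {lam (m + m0) - l (m + m0)..lam (m + m0) + l (m + m0)} \<longrightarrow>
          eigen t \<mu> \<phi> \<longrightarrow> ipf t \<phi> < \<epsilon> * q (m + m0)"
        proof (intro allI impI)
          fix \<mu> \<phi> assume \<mu>: "\<mu> \<in> {lam (m + m0) - l (m + m0)..lam (m + m0) + l (m + m0)}" and e: "eigen t \<mu> \<phi>"
          have \<mu>': "\<mu> \<in> {lam (m + m0) - l' (m + m0)..lam (m + m0) + l' (m + m0)}"
            using \<mu> ll by auto
          show "ipf t \<phi> < \<epsilon> * q (m + m0)"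
          proof (rule ccontr)
            assume "\<not> ?thesis"
            then have "\<epsilon> * q (m + m0) \<le> ipf t \<phi>" by simp
            then have "t \<in> Bad (m + m0)" unfolding Bad_def using t \<mu>' e by blast
            then show False using nb by blast
          qed
        qed
      qed
      then show "\<forall>\<^sub>F m in sequentially.
        \<forall>\<mu> \<phi>. \<mu> \<in> {lam m - l m..lam m + l m} \<longrightarrow> eigen t \<mu> \<phi> \<longrightarrow> ipf t \<phi> < \<epsilon> * q m"
        by (subst (asm) eventually_sequentially_seg)
    qed
  qed
qed

end

text \<open>On a compact set away from its zeros, f has a positive minimum, so the concentration
  integral controls the local mass.\<close>

lemma (in closed_riemannian_surface) tendsto_zero_L2_loc_if:
  assumes f: "continuous_map X euclidean f" "\<And>p. p \<in> topspace X \<Longrightarrow> 0 \<le> f p"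
    and h: "continuous_map X euclidean h" "\<And>p. 0 < h p"
    and \<phi>: "\<And>m. continuous_map X euclidean (\<lambda>p. (cmod (\<phi> m p))\<^sup>2)"
    and lim: "(\<lambda>m. \<integral>p. f p * (cmod (\<phi> m p))\<^sup>2 \<partial>density dx (\<lambda>p. ennreal (h p))) \<longlonglongrightarrow> 0"
  shows "tendsto_zero_L2_loc X (density dx (\<lambda>p. ennreal (h p))) (topspace X - {p \<in> topspace X. f p = 0}) \<phi>"
  unfolding tendsto_zero_L2_loc_def
proof (intro allI impI)
  fix K assume "compactin X K \<and> K \<subseteq> topspace X - {p \<in> topspace X. f p = 0}"
  then have K: "compactin X K" "K \<subseteq> topspace X" "\<And>p. p \<in> K \<Longrightarrow> f p \<noteq> 0" by auto
  let ?M = "density dx (\<lambda>p. ennreal (h p))"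
  have Ks: "K \<in> sets (borel_sigma X)"
    using compactin_imp_closedin[OF Hausdorff K(1)] by (rule closedin_borel_sigma)
  have hm: "h \<in> borel_measurable (borel_sigma X)" by (rule continuous_map_borel_measurable[OF h(1)])
  have int: "integrable ?M u" if u: "continuous_map X euclidean u" for u :: "'a \<Rightarrow> real"
  proof -
    have "integrable dx (\<lambda>p. h p * u p)" by (intro continuous_integrable continuous_map_real_mult h u)
    then show ?thesis
      using hm continuous_map_borel_measurable[OF u] h(2) by (subst integrable_density) (auto intro: less_imp_le)
  qed
  show "(\<lambda>m. LINT p:K|?M. (cmod (\<phi> m p))\<^sup>2) \<longlonglongrightarrow> 0"
  proof (cases "K = {}")
    case True
    then show ?thesis by (simp add: set_lebesgue_integral_def)
  next
    case False
    have "compactin euclidean (f ` K)" using K(1) f(1) by (rule image_compactin)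
    then have "compact (f ` K)" by simp
    then obtain p0 where p0: "p0 \<in> K" "\<And>p. p \<in> K \<Longrightarrow> f p0 \<le> f p"
      using compact_attains_inf[of "f ` K"] False by auto
    have d: "0 < f p0" using K(2,3) p0(1) f(2)[of p0] by force
    have le: "(LINT p:K|?M. (cmod (\<phi> m p))\<^sup>2) \<le> (1 / f p0) * (\<integral>p. f p * (cmod (\<phi> m p))\<^sup>2 \<partial>?M)" for m
    proof -
      have "(LINT p:K|?M. (cmod (\<phi> m p))\<^sup>2) \<le> (\<integral>p. (1 / f p0) * (f p * (cmod (\<phi> m p))\<^sup>2) \<partial>?M)"
        unfolding set_lebesgue_integral_def
      proof (rule integral_mono)
        show "integrable ?M (\<lambda>p. indicator K p *\<^sub>R (cmod (\<phi> m p))\<^sup>2)"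
          using Ks by (intro integrable_mult_indicator int \<phi>) simp
        show "integrable ?M (\<lambda>p. (1 / f p0) * (f p * (cmod (\<phi> m p))\<^sup>2))"
          by (intro integrable_mult_right int continuous_map_real_mult f \<phi>)
        fix p assume "p \<in> space ?M"
        then have p: "p \<in> topspace X" by simp
        show "indicator K p *\<^sub>R (cmod (\<phi> m p))\<^sup>2 \<le> (1 / f p0) * (f p * (cmod (\<phi> m p))\<^sup>2)"
        proof (cases "p \<in> K")
          case True
          have "1 * (cmod (\<phi> m p))\<^sup>2 \<le> (f p / f p0) * (cmod (\<phi> m p))\<^sup>2"
            using p0(2)[OF True] d by (intro mult_right_mono) auto
          then show ?thesis using True by simp
        next
          case False
          then show ?thesis using f(2)[OF p] d by simp
        qed
      qed
      then show ?thesis by simp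
    qed
    have "(\<lambda>m. (1 / f p0) * (\<integral>p. f p * (cmod (\<phi> m p))\<^sup>2 \<partial>?M)) \<longlonglongrightarrow> (1 / f p0) * 0"
      by (intro tendsto_mult tendsto_const lim)
    then have lim': "(\<lambda>m. (1 / f p0) * (\<integral>p. f p * (cmod (\<phi> m p))\<^sup>2 \<partial>?M)) \<longlonglongrightarrow> 0" by simp
    show ?thesis
    proof (rule tendsto_sandwich[OF _ _ tendsto_const lim'])
      show "\<forall>\<^sub>F m in sequentially. 0 \<le> (LINT p:K|?M. (cmod (\<phi> m p))\<^sup>2)"
        unfolding set_lebesgue_integral_def by (intro always_eventually allI integral_nonneg_AE AE_I2) simp
    qed (use le in auto)
  qed
qed

theorem theorem4p1:
  fixes X :: "'a topology" and A :: "'a chart set" and g0 :: "'a metric_tensor"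
    and f :: "'a \<Rightarrow> real" and g :: "real \<Rightarrow> 'a metric_tensor" and dx :: "real \<Rightarrow> 'a measure"
    and lam l q :: "nat \<Rightarrow> real" and I :: "nat \<Rightarrow> real set"
  assumes "closed_surface X A" and "riemannian_metric A g0"
    and "smooth_function A f" and "\<forall>p\<in>topspace X. f p \<ge> 0" and "\<exists>p\<in>topspace X. f p \<noteq> 0"
  defines "g \<equiv> \<lambda>t. conformal_metric (\<lambda>p. exp (- t * f p)) g0"
    and "dx \<equiv> \<lambda>t. area_measure X A (g t)"
    and "I \<equiv> \<lambda>m. {lam m - l m .. lam m + l m}"
  assumes "\<forall>m. l m \<ge> 0"
    and "\<forall>t\<in>{0..1}. \<forall>m. \<exists>\<mu>\<in>I m. eigenvalue X A (g t) \<mu>"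
    and "filterlim lam at_top sequentially" and "summable l"
    and "\<forall>m. q m > 0" and "q \<longlonglongrightarrow> 0" and "summable (\<lambda>m. l m / q m)"
  shows "AE t in lebesgue_on {0..1}.
    \<forall>\<phi> \<mu>.
      (\<forall>m. eigenfunction X A (g t) (\<mu> m) (\<phi> m) \<and> \<mu> m \<in> I m \<and>
           (\<integral>p. (cmod (\<phi> m p))\<^sup>2 \<partial>dx t) = 1) \<longrightarrow>
      (\<lambda>m. \<integral>p. f p * (cmod (\<phi> m p))\<^sup>2 \<partial>dx t) \<in> o(q) \<and>
      tendsto_zero_L2_loc X (dx t) (topspace X - {p \<in> topspace X. f p = 0}) \<phi>"
proof -
  interpret S: closed_riemannian_surface X A g0
    by unfold_locales (rule assms)+
  have fC: "S.C1_fun f" using S.smooth_function_C2[OF assms(3) bounded_linear_ident] by (simp add: S.C2_fun_def)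
  have fc: "continuous_map X euclidean f" by (rule S.C1_fun_continuous[OF fC])
  have f0: "0 \<le> f p" if "p \<in> topspace X" for p using assms(4) that by blast
  obtain F C where pencil: "conformal_pencil S.dx f (Collect S.C1_fun) (\<lambda>u v. \<integral>p. S.energy u v p \<partial>S.dx) F C"
    using S.C1_fun_pencil[OF fc f0] by blast
  interpret P: conformal_pencil S.dx f "Collect S.C1_fun" "\<lambda>u v. \<integral>p. S.energy u v p \<partial>S.dx" F C
    by (rule pencil)
  define h where "h = (\<lambda>t p. exp (- t * f p))"
  have h0: "0 < h t p" for t p by (simp add: h_def)
  have hc: "continuous_map X euclidean (h t)" for t
  proof (rule S.continuous_mapI_charts)
    fix c assume "c \<in> A"
    then show "continuous_on (chart_image c) (\<lambda>x. h t (coord_inv c x))"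
      unfolding h_def by (intro continuous_intros C1_onD(3)[OF S.C1_funD[OF fC]])
  qed
  have dxt: "dx t = density S.dx (\<lambda>p. ennreal (h t p))" for t
    using S.area_measure_conformal[OF hc h0, of t] by (simp add: dx_def g_def h_def)
  have gt: "g t = conformal_metric (h t) g0" for t by (simp add: g_def h_def)
  have int_dxt: "(\<integral>p. u p \<partial>dx t) = (\<integral>p. u p * exp (- (t * f p)) \<partial>S.dx)"
    if u: "continuous_map X euclidean u" for u :: "'a \<Rightarrow> real" and t
  proof -
    have "(\<integral>p. u p \<partial>dx t) = (\<integral>p. h t p *\<^sub>R u p \<partial>S.dx)"
      unfolding dxt using continuous_map_borel_measurable[OF u] continuous_map_borel_measurable[OF hc]
      by (intro integral_density) (auto intro!: AE_I2 less_imp_le[OF h0])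
    then show ?thesis by (simp add: h_def mult.commute)
  qed
  have lin: "bounded_linear Re" "bounded_linear Im" by (rule bounded_linear_Re bounded_linear_Im)+
  \<comment> \<open>Real and imaginary parts carry norm and concentration over to the real pencil;
    the last clause finds a real eigenfunction at least as concentrated as the complex one.\<close>
  have key: "P.ip t (\<lambda>p. Re (\<phi> p)) (\<lambda>p. Re (\<phi> p)) + P.ip t (\<lambda>p. Im (\<phi> p)) (\<lambda>p. Im (\<phi> p)) = (\<integral>p. (cmod (\<phi> p))\<^sup>2 \<partial>dx t)"
      "P.ipf t (\<lambda>p. Re (\<phi> p)) + P.ipf t (\<lambda>p. Im (\<phi> p)) = (\<integral>p. f p * (cmod (\<phi> p))\<^sup>2 \<partial>dx t)"
      "continuous_map X euclidean (\<lambda>p. (cmod (\<phi> p))\<^sup>2)"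
      "(\<integral>p. (cmod (\<phi> p))\<^sup>2 \<partial>dx t) = 1 \<Longrightarrow> \<eta> \<le> (\<integral>p. f p * (cmod (\<phi> p))\<^sup>2 \<partial>dx t) \<Longrightarrow>
        \<exists>\<psi>. P.eigen t \<mu> \<psi> \<and> \<eta> \<le> P.ipf t \<psi>"
    if e: "eigenfunction X A (g t) \<mu> \<phi>" for t \<mu> \<phi> \<eta>
  proof -
    note e' = e[unfolded gt]
    have C: "S.C1_fun (\<lambda>p. L (\<phi> p))" if "bounded_linear L" for L :: "complex \<Rightarrow> real"
      by (rule S.eigenfunction_real_part(1)[OF e' h0 that S.C1_fun_const[of 0]])
    have mem: "(\<lambda>p. Re (\<phi> p)) \<in> Collect S.C1_fun" "(\<lambda>p. Im (\<phi> p)) \<in> Collect S.C1_fun"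
      using C lin by auto
    have eq: "(\<integral>p. S.energy w (\<lambda>p. L (\<phi> p)) p \<partial>S.dx) = \<mu> * P.ip t w (\<lambda>p. L (\<phi> p))"
      if "bounded_linear L" "w \<in> Collect S.C1_fun" for L :: "complex \<Rightarrow> real" and w
      using S.eigenfunction_real_part(2)[OF e' h0 that(1)] that(2) by (simp add: P.ip_def h_def)
    show c: "continuous_map X euclidean (\<lambda>p. (cmod (\<phi> p))\<^sup>2)"
      unfolding cmod_power2 unfolding power2_eq_square
      by (intro S.C1_fun_continuous S.C1_fun_add S.C1_fun_mult C lin)
    show 1: "P.ip t (\<lambda>p. Re (\<phi> p)) (\<lambda>p. Re (\<phi> p)) + P.ip t (\<lambda>p. Im (\<phi> p)) (\<lambda>p. Im (\<phi> p)) = (\<integral>p. (cmod (\<phi> p))\<^sup>2 \<partial>dx t)"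
      unfolding int_dxt[OF c] P.ip_def unfolding cmod_power2 unfolding power2_eq_square distrib_right
      by (intro Bochner_Integration.integral_add[symmetric] P.integrable_ip mem)
    have fcc: "continuous_map X euclidean (\<lambda>p. f p * (cmod (\<phi> p))\<^sup>2)" by (intro continuous_map_real_mult fc c)
    show 2: "P.ipf t (\<lambda>p. Re (\<phi> p)) + P.ipf t (\<lambda>p. Im (\<phi> p)) = (\<integral>p. f p * (cmod (\<phi> p))\<^sup>2 \<partial>dx t)"
      unfolding int_dxt[OF fcc] P.ipf_def unfolding cmod_power2 distrib_left distrib_right
      by (intro Bochner_Integration.integral_add[symmetric] P.integrable_ipf mem)
    show "\<exists>\<psi>. P.eigen t \<mu> \<psi> \<and> \<eta> \<le> P.ipf t \<psi>"
      if "(\<integral>p. (cmod (\<phi> p))\<^sup>2 \<partial>dx t) = 1" "\<eta> \<le> (\<integral>p. f p * (cmod (\<phi> p))\<^sup>2 \<partial>dx t)"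
      by (rule P.eigen_of_pair[OF mem(1) eq[OF lin(1)] mem(2) eq[OF lin(2)]]) (use 1 2 that in auto)
  qed
  \<comment> \<open>The countably many thresholds 1 / (k + 1) are enough for little-o and leave a
    single null set. Time 0 is left out, because the steepness argument looks backwards in
    t.\<close>
  define good where "good = (\<lambda>k t. t \<in> {0<..1} \<longrightarrow> (\<forall>\<^sub>F m in sequentially.
    \<forall>\<mu> \<psi>. \<mu> \<in> I m \<longrightarrow> P.eigen t \<mu> \<psi> \<longrightarrow> P.ipf t \<psi> < (1 / real (Suc k)) * q m))"
  have "AE t in lebesgue. good k t" for k
    unfolding good_def I_def
    by (rule P.AE_no_concentration) (use assms summable_LIMSEQ_zero in auto)
  then have AE1: "AE t in lebesgue. \<forall>k. good k t" by (simp add: AE_all_countable)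
  have AE2: "AE t in lebesgue. t \<noteq> (0::real)"
    by (rule AE_completion) (rule AE_lborel_singleton)
  have "AE t in lebesgue. t \<in> {0..1} \<longrightarrow> (\<forall>k. good k t) \<and> t \<noteq> 0"
    using AE1 AE2 by eventually_elim auto
  then have "AE t in lebesgue_on {0..1}. (\<forall>k. good k t) \<and> t \<noteq> 0"
    by (subst AE_restrict_space_iff) auto
  then show ?thesis
  proof (rule AE_mp, intro AE_I2 impI allI)
    fix t \<phi> \<mu>
    assume "t \<in> space (lebesgue_on {0..1})" and gd: "(\<forall>k. good k t) \<and> t \<noteq> 0"
      and "\<forall>m. eigenfunction X A (g t) (\<mu> m) (\<phi> m) \<and> \<mu> m \<in> I m \<and> (\<integral>p. (cmod (\<phi> m p))\<^sup>2 \<partial>dx t) = 1"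
    then have t: "t \<in> {0<..1}" and e: "\<And>m. eigenfunction X A (g t) (\<mu> m) (\<phi> m)" "\<And>m. \<mu> m \<in> I m"
      "\<And>m. (\<integral>p. (cmod (\<phi> m p))\<^sup>2 \<partial>dx t) = 1"
      by auto
    define a where "a = (\<lambda>m. \<integral>p. f p * (cmod (\<phi> m p))\<^sup>2 \<partial>dx t)"
    have a0: "0 \<le> a m" for m
      unfolding a_def dxt by (intro integral_nonneg_AE AE_I2) (use f0 in auto)
    have small: "\<forall>\<^sub>F m in sequentially. a m < (1 / real (Suc k)) * q m" for k
    proof -
      have "\<forall>\<^sub>F m in sequentially. \<forall>\<mu> \<psi>. \<mu> \<in> I m \<longrightarrow> P.eigen t \<mu> \<psi> \<longrightarrow> P.ipf t \<psi> < (1 / real (Suc k)) * q m"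
        using gd t by (auto simp: good_def)
      then show ?thesis
      proof eventually_elim
        fix m assume *: "\<forall>\<mu> \<psi>. \<mu> \<in> I m \<longrightarrow> P.eigen t \<mu> \<psi> \<longrightarrow> P.ipf t \<psi> < (1 / real (Suc k)) * q m"
        show "a m < (1 / real (Suc k)) * q m"
        proof (rule ccontr)
          assume "\<not> ?thesis"
          then have "(1 / real (Suc k)) * q m \<le> a m" by simp
          then obtain \<psi> where "P.eigen t (\<mu> m) \<psi>" "(1 / real (Suc k)) * q m \<le> P.ipf t \<psi>"
            using key(4)[OF e(1)[of m] e(3)[of m]] unfolding a_def by blast
          moreover from this(1) have "P.ipf t \<psi> < (1 / real (Suc k)) * q m" using * e(2)[of m] by blast
          ultimately show False by linarith
        qed
      qed
    qed
    have oq: "a \<in> o(q)"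
    proof (rule landau_o.smallI)
      fix c :: real assume "0 < c"
      then obtain k where k: "1 / real (Suc k) < c" using nat_approx_posE by blast
      show "\<forall>\<^sub>F m in sequentially. norm (a m) \<le> c * norm (q m)"
        using small[of k]
      proof eventually_elim
        fix m assume "a m < (1 / real (Suc k)) * q m"
        also have "\<dots> \<le> c * q m" using k assms(13) by (intro mult_right_mono) (auto intro: less_imp_le)
        finally show "norm (a m) \<le> c * norm (q m)" using a0[of m] assms(13) by (simp add: less_imp_le)
      qed
    qed
    have "a \<longlonglongrightarrow> 0"
    proof (rule tendsto_sandwich[OF _ _ tendsto_const assms(14)])
      show "\<forall>\<^sub>F m in sequentially. a m \<le> q m" using small[of 0] by eventually_elim simp
    qed (use a0 in auto)
    then have "tendsto_zero_L2_loc X (dx t) (topspace X - {p \<in> topspace X. f p = 0}) \<phi>"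
      unfolding a_def dxt by (intro S.tendsto_zero_L2_loc_if fc f0 hc h0 key(3)[OF e(1)])
    then show "(\<lambda>m. \<integral>p. f p * (cmod (\<phi> m p))\<^sup>2 \<partial>dx t) \<in> o(q) \<and>
      tendsto_zero_L2_loc X (dx t) (topspace X - {p \<in> topspace X. f p = 0}) \<phi>"
      using oq by (simp add: a_def)
  qed
qed

end
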